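(* Let $V$ be a finite-dimensional vector space over $\Bbbk$ equipped with a non-degenerate symmetric bilinear form. Then the representation $(SO(V):\mathcal S^2V)$ of $SO(V)$ on the symmetric square of $V$ has GNIB.
   Context: The ground field $\Bbbk$ is algebraically closed of characteristic zero. For a Lie algebra $\mathfrak q$ and a finite-dimensional $\mathfrak q$-module $U$, the index is $\mathrm{ind}(\mathfrak q,U)=\dim U-\max_{\xi\in U^*}\dim(\mathfrak q\cdot\xi)$. For a rational representation $(G:U)$ of a reductive group $G$ with Lie algebra $\mathfrak g$, a vector $v\in U$ is nilpotent if $0\in\overline{G\cdot v}$; $\mathfrak g_v$ is the stabiliser of $v$ in $\mathfrak g$, and $U/\mathfrak g\cdot v$ is a $\mathfrak g_v$-module. $(G:U)$ has good nilpotent index behaviour (GNIB) if $\mathrm{ind}(\mathfrak g,U^* )=\mathrm{ind}(\mathfrak g_v,(U/\mathfrak g\cdot v)^* )$ for every nilpotent $v\in U$. (The representation in question is the isotropy representation of the symmetric pair $(GL(V),SO(V))$.) *)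

theory Defs
  imports
    "HOL-Algebra.AbelCoset"
    "Jordan_Normal_Form.VS_Connect"
    "HOL-Library.Poly_Mapping"
begin

text \<open>
  Vector spaces are HOL-Algebra modules over \<^term>\<open>class_ring\<close>, the record view of a type-class
  field. The fields \<^const>\<open>mult\<close> and \<^const>\<open>one\<close>, which the record type inherits from rings, are
  irrelevant and are filled arbitrarily below.
\<close>

abbreviation vdim :: "('k::field, 'v, 'm) module_scheme \<Rightarrow> nat" where
  "vdim \<equiv> vectorspace.dim class_ring"

definition ground_space :: "('k::field, 'k) module" where
  "ground_space = \<lparr>carrier = UNIV, mult = (*), one = 1, zero = 0, add = (+), smult = (*)\<rparr>"

definition dual_space :: "('k::field, 'u) module \<Rightarrow> ('k, 'u \<Rightarrow> 'k) module" where
  "dual_space U = (ring.func_space class_ring (carrier U))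
     \<lparr>carrier := LinearCombinations.module_hom class_ring U ground_space \<inter> extensional (carrier U)\<rparr>"

definition quotient_space :: "('k::field, 'u) module \<Rightarrow> 'u set \<Rightarrow> ('k, 'u set) module" where
  "quotient_space U W =
     \<lparr>carrier = a_rcosets\<^bsub>U\<^esub> W, mult = (\<lambda>_ _. W), one = W, zero = W, add = set_add U,
      smult = (\<lambda>c X. \<Union>u\<in>X. W +>\<^bsub>U\<^esub> (c \<odot>\<^bsub>U\<^esub> u))\<rparr>"

definition endomorphisms :: "('k::field, 'v) module \<Rightarrow> ('v \<Rightarrow> 'v) set" where
  "endomorphisms V = LinearCombinations.module_hom class_ring V V \<inter> extensional (carrier V)"

text \<open>
  The determinant of an endomorphism is that of its matrix in an arbitrary ordered basis; the
  description is unique because matrices of the same endomorphism are similar.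
\<close>

definition endo_det :: "('k::field, 'v) module \<Rightarrow> ('v \<Rightarrow> 'v) \<Rightarrow> 'k" where
  "endo_det V f = (THE d. \<exists>bs A.
     distinct bs \<and> vectorspace.basis class_ring V (set bs) \<and>
     A \<in> carrier_mat (length bs) (length bs) \<and>
     (\<forall>j<length bs. f (bs ! j) = (\<Oplus>\<^bsub>V\<^esub>i\<in>{..<length bs}. (A $$ (i, j)) \<odot>\<^bsub>V\<^esub> (bs ! i))) \<and>
     d = det A)"


text \<open>
  A set \<open>q\<close> acts on \<open>U\<close> through \<open>act x u\<close>. In the definitions that follow \<open>q\<close> is (the carrier of)
  a Lie algebra and \<open>U\<close> a \<open>q\<close>-module; the bracket of \<open>q\<close> does not enter the definition of the index.
\<close>

definition tangent_space :: "'q set \<Rightarrow> ('q \<Rightarrow> 'u \<Rightarrow> 'u) \<Rightarrow> 'u \<Rightarrow> 'u set" where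
  "tangent_space q act u = (\<lambda>x. act x u) ` q"

definition stabiliser ::
  "('k::field, 'u) module \<Rightarrow> 'q set \<Rightarrow> ('q \<Rightarrow> 'u \<Rightarrow> 'u) \<Rightarrow> 'u \<Rightarrow> 'q set" where
  "stabiliser U q act u = {x \<in> q. act x u = \<zero>\<^bsub>U\<^esub>}"

definition dual_action ::
  "('k::field, 'u) module \<Rightarrow> ('q \<Rightarrow> 'u \<Rightarrow> 'u) \<Rightarrow> 'q \<Rightarrow> ('u \<Rightarrow> 'k) \<Rightarrow> ('u \<Rightarrow> 'k)" where
  "dual_action U act x \<xi> = (\<lambda>u\<in>carrier U. - \<xi> (act x u))"

definition quotient_action ::
  "('k::field, 'u) module \<Rightarrow> 'u set \<Rightarrow> ('q \<Rightarrow> 'u \<Rightarrow> 'u) \<Rightarrow> 'q \<Rightarrow> 'u set \<Rightarrow> 'u set" where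
  "quotient_action U W act x X = (\<Union>u\<in>X. W +>\<^bsub>U\<^esub> act x u)"

definition index :: "'q set \<Rightarrow> ('k::field, 'u) module \<Rightarrow> ('q \<Rightarrow> 'u \<Rightarrow> 'u) \<Rightarrow> int" where
  "index q U act = int (vdim U) -
     int (Max {vdim ((dual_space U)\<lparr>carrier := tangent_space q (dual_action U act) \<xi>\<rparr>) | \<xi>.
                 \<xi> \<in> carrier (dual_space U)})"


inductive_set polynomial_functions :: "('k::field, 'u) module \<Rightarrow> ('u \<Rightarrow> 'k) set"
  for U where
  const: "(\<lambda>_. c) \<in> polynomial_functions U"
| linear: "\<xi> \<in> carrier (dual_space U) \<Longrightarrow> \<xi> \<in> polynomial_functions U"
| add: "p \<in> polynomial_functions U \<Longrightarrow> r \<in> polynomial_functions U \<Longrightarrow>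
    (\<lambda>u. p u + r u) \<in> polynomial_functions U"
| mult: "p \<in> polynomial_functions U \<Longrightarrow> r \<in> polynomial_functions U \<Longrightarrow>
    (\<lambda>u. p u * r u) \<in> polynomial_functions U"

definition zariski_closure :: "('k::field, 'u) module \<Rightarrow> 'u set \<Rightarrow> 'u set" where
  "zariski_closure U S =
     {u \<in> carrier U. \<forall>p\<in>polynomial_functions U. (\<forall>s\<in>S. p s = 0) \<longrightarrow> p u = 0}"

definition nilpotent_vector ::
  "'g set \<Rightarrow> ('g \<Rightarrow> 'u \<Rightarrow> 'u) \<Rightarrow> ('k::field, 'u) module \<Rightarrow> 'u \<Rightarrow> bool" where
  "nilpotent_vector G \<rho> U v \<longleftrightarrow>
     v \<in> carrier U \<and> \<zero>\<^bsub>U\<^esub> \<in> zariski_closure U ((\<lambda>g. \<rho> g v) ` G)"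

text \<open>
  Here \<open>G\<close> acts on \<open>U\<close> by \<open>\<rho>\<close>, \<open>\<gg>\<close> is the Lie algebra of \<open>G\<close> and \<open>\<delta>\<close> its action on \<open>U\<close>
  (the differential of \<open>\<rho>\<close>).
\<close>

definition GNIB ::
  "'g set \<Rightarrow> ('g \<Rightarrow> 'u \<Rightarrow> 'u) \<Rightarrow> 'q set \<Rightarrow> ('q \<Rightarrow> 'u \<Rightarrow> 'u) \<Rightarrow> ('k::field, 'u) module \<Rightarrow> bool" where
  "GNIB G \<rho> \<gg> \<delta> U \<longleftrightarrow>
     (\<forall>v. nilpotent_vector G \<rho> U v \<longrightarrow>
        (let W = tangent_space \<gg> \<delta> v; Q = quotient_space U W in
           index \<gg> (dual_space U) (dual_action U \<delta>) =
           index (stabiliser U \<gg> \<delta> v) (dual_space Q) (dual_action Q (quotient_action U W \<delta>))))"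


definition nondegenerate_symmetric_form ::
  "('k::field, 'v) module \<Rightarrow> ('v \<Rightarrow> 'v \<Rightarrow> 'k) \<Rightarrow> bool" where
  "nondegenerate_symmetric_form V B \<longleftrightarrow>
     (\<forall>u\<in>carrier V. (\<lambda>w. B u w) \<in> LinearCombinations.module_hom class_ring V ground_space) \<and>
     (\<forall>w\<in>carrier V. (\<lambda>u. B u w) \<in> LinearCombinations.module_hom class_ring V ground_space) \<and>
     (\<forall>u\<in>carrier V. \<forall>w\<in>carrier V. B u w = B w u) \<and>
     (\<forall>u\<in>carrier V. (\<forall>w\<in>carrier V. B u w = 0) \<longrightarrow> u = \<zero>\<^bsub>V\<^esub>)"

definition SO :: "('k::field, 'v) module \<Rightarrow> ('v \<Rightarrow> 'v \<Rightarrow> 'k) \<Rightarrow> ('v \<Rightarrow> 'v) set" where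
  "SO V B = {g \<in> endomorphisms V.
     (\<forall>u\<in>carrier V. \<forall>w\<in>carrier V. B (g u) (g w) = B u w) \<and> endo_det V g = 1}"

text \<open>The Lie algebra of \<open>SO V B\<close>, i.e. the endomorphisms that are skew with respect to \<open>B\<close>.\<close>

definition so :: "('k::field, 'v) module \<Rightarrow> ('v \<Rightarrow> 'v \<Rightarrow> 'k) \<Rightarrow> ('v \<Rightarrow> 'v) set" where
  "so V B = {x \<in> endomorphisms V.
     \<forall>u\<in>carrier V. \<forall>w\<in>carrier V. B (x u) w + B u (x w) = 0}"


text \<open>
  The symmetric square is the vector space freely generated by the symbols \<open>u \<cdot> w\<close> (the basis
  vectors \<open>pure u w\<close>) modulo the relations making \<open>u \<cdot> w\<close> bilinear and symmetric.
\<close>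

definition free_space :: "'b set \<Rightarrow> ('k::field, 'b \<Rightarrow>\<^sub>0 'k) module" where
  "free_space S =
     \<lparr>carrier = {f. Poly_Mapping.keys f \<subseteq> S}, mult = (\<lambda>_ _. 0), one = 0, zero = 0, add = (+),
      smult = (\<lambda>c. Poly_Mapping.map ((*) c))\<rparr>"

definition linear_extension :: "('b \<Rightarrow> ('c \<Rightarrow>\<^sub>0 'k)) \<Rightarrow> ('b \<Rightarrow>\<^sub>0 'k) \<Rightarrow> ('c \<Rightarrow>\<^sub>0 'k::field)" where
  "linear_extension F f =
     (\<Sum>b\<in>Poly_Mapping.keys f. Poly_Mapping.map ((*) (Poly_Mapping.lookup f b)) (F b))"

abbreviation pure :: "'v \<Rightarrow> 'v \<Rightarrow> ('v \<times> 'v \<Rightarrow>\<^sub>0 'k::field)" where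
  "pure u w \<equiv> Poly_Mapping.single (u, w) 1"

abbreviation free_square :: "('k::field, 'v) module \<Rightarrow> ('k, 'v \<times> 'v \<Rightarrow>\<^sub>0 'k) module" where
  "free_square V \<equiv> free_space (carrier V \<times> carrier V)"

definition sym2_relations :: "('k::field, 'v) module \<Rightarrow> ('v \<times> 'v \<Rightarrow>\<^sub>0 'k) set" where
  "sym2_relations V = LinearCombinations.module.span class_ring (free_square V)
     ({pure (u \<oplus>\<^bsub>V\<^esub> u') w - pure u w - pure u' w | u u' w.
         u \<in> carrier V \<and> u' \<in> carrier V \<and> w \<in> carrier V} \<union>
      {pure u (w \<oplus>\<^bsub>V\<^esub> w') - pure u w - pure u w' | u w w'.
         u \<in> carrier V \<and> w \<in> carrier V \<and> w' \<in> carrier V} \<union>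
      {pure (c \<odot>\<^bsub>V\<^esub> u) w - Poly_Mapping.single (u, w) c | c u w.
         u \<in> carrier V \<and> w \<in> carrier V} \<union>
      {pure u (c \<odot>\<^bsub>V\<^esub> w) - Poly_Mapping.single (u, w) c | c u w.
         u \<in> carrier V \<and> w \<in> carrier V} \<union>
      {pure u w - pure w u | u w. u \<in> carrier V \<and> w \<in> carrier V})"

definition sym2 :: "('k::field, 'v) module \<Rightarrow> ('k, ('v \<times> 'v \<Rightarrow>\<^sub>0 'k) set) module" where
  "sym2 V = quotient_space (free_square V) (sym2_relations V)"

definition sym2_group_action ::
  "('k::field, 'v) module \<Rightarrow> ('v \<Rightarrow> 'v) \<Rightarrow> ('v \<times> 'v \<Rightarrow>\<^sub>0 'k) set \<Rightarrow> ('v \<times> 'v \<Rightarrow>\<^sub>0 'k) set" where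
  "sym2_group_action V = quotient_action (free_square V) (sym2_relations V)
     (\<lambda>g. linear_extension (\<lambda>(u, w). pure (g u) (g w)))"

definition sym2_lie_action ::
  "('k::field, 'v) module \<Rightarrow> ('v \<Rightarrow> 'v) \<Rightarrow> ('v \<times> 'v \<Rightarrow>\<^sub>0 'k) set \<Rightarrow> ('v \<times> 'v \<Rightarrow>\<^sub>0 'k) set" where
  "sym2_lie_action V = quotient_action (free_square V) (sym2_relations V)
     (\<lambda>x. linear_extension (\<lambda>(u, w). pure (x u) w + pure u (x w)))"

end

theory Submission
  imports Defs "Jordan_Normal_Form.Char_Poly"
begin

hide_const (open) Multiset.mult Polynomial.smult

text \<open>
  Both indices are dimensions of generic orbits: replacing a space by its double dual, the left-hand
  side is \<open>dim U\<close> minus the maximal dimension of an orbit \<open>\<gg> \<cdot> u\<close>, and the right-hand side is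
  \<open>dim U - dim (\<gg> \<cdot> v)\<close> minus the maximal dimension of \<open>\<gg>\<^sub>v \<cdot> \<eta>\<close> in \<open>U / \<gg> \<cdot> v\<close>. By rank-nullity
  the two agree as soon as some \<open>w\<close> satisfies: \<open>x \<cdot> v = 0\<close> and \<open>x \<cdot> w \<in> \<gg> \<cdot> v\<close> imply \<open>x = 0\<close>,
  for the given \<open>v\<close> and for \<open>v = 0\<close>.

  A basis identifies \<open>S\<^sup>2V\<close> with symmetric matrices \<open>S\<close>. With the Gram matrix \<open>G\<close> and \<open>A = S G\<close>, an
  element \<open>x\<close> of the Lie algebra acts by \<open>A \<mapsto> [x, A]\<close> on self-adjoint operators. The coefficients of
  the characteristic polynomial are invariant polynomials, so nilpotent vectors give nilpotent \<open>A\<close>.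
  The required \<open>C\<close> is built by splitting off Jordan blocks: choose \<open>w\<close> with \<open>(w, A\<^sup>s w) = 1\<close> for \<open>s = d\<close>
  and \<open>0\<close> otherwise, where \<open>A\<^sup>d \<noteq> 0 = A\<^bsup>d+1\<^esup>\<close>, put \<open>E = (w, \<cdot>) w\<close> and \<open>C = a E + C'\<close>, where \<open>C'\<close>
  is a solution on the orthogonal complement of the block. If \<open>[x, C] = [y, A]\<close>, then
  \<open>\<Sum>\<^sub>s A\<^sup>s [x, C] A\<^bsup>d-s\<^esup> = 0\<close> by telescoping, which says that the component of \<open>x w\<close> in the complement
  is an eigenvector of \<open>\<Sum>\<^sub>s A\<^sup>s C' A\<^bsup>d-s\<^esup>\<close> for \<open>a\<close>; a generic \<open>a\<close> excludes this.
\<close>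

section \<open>Generic self-adjoint operators relative to a nilpotent one\<close>

text \<open>Averaging over the powers of \<open>A\<close> removes the unknown \<open>y\<close>, but
  only if \<open>A^(d+1)\<close> vanishes on the whole remaining space and not just on one block;
  hence \<open>d\<close> is the exact top exponent there and a longest block is split off each time.
  The eigenvalue argument leaves open the component of \<open>x w\<close> inside the block. It
  vanishes for another reason: \<open>x\<close> commutes with \<open>A\<close>, so every
  \<open>A^s x\<close> is skew and (A^s w, x w) = (w, A^s x w) = 0. Then \<open>x\<close> kills
  \<open>w\<close>, hence every \<open>A^s w\<close>, and by skewness its image is orthogonal to the
  block; what is left lives on the complement, where \<open>C'\<close> takes over. Subspaces are
  never formed in the iteration: a self-adjoint idempotent \<open>P\<close> commuting with
  \<open>A\<close> stands for its image, so the matrix size and the ambient form stay fixed.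
  Characteristic zero enters through division by 2 and the infinitude of the field, algebraic
  closure through the square root that normalises \<open>w\<close>. The case v = 0 shows that a
  generic stabiliser is trivial, so both indices turn out to be the dimension of the module minus
  that of the Lie algebra.\<close>

text \<open>\<open>hsum A X k\<close> is \<open>\<Sum>\<^sub>s A\<^bsup>k-s\<^esup> X A\<^sup>s\<close> over \<open>s \<le> k\<close>; matrices carry no additive type-class structure.\<close>

fun hsum :: "'a::semiring_1 mat \<Rightarrow> 'a mat \<Rightarrow> nat \<Rightarrow> 'a mat" where
  "hsum A X 0 = X"
| "hsum A X (Suc k) = A * hsum A X k + X * A ^\<^sub>m Suc k"

section \<open>Power-weighted sums of square matrices and their telescoping identity\<close>

locale square_matrices =
  fixes n :: nat and ty :: "'k::field itself"
begin

abbreviation M :: "'k mat set" where "M \<equiv> carrier_mat n n"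

lemma mult_M [simp, intro]: "X \<in> M \<Longrightarrow> Y \<in> M \<Longrightarrow> X * Y \<in> M" by simp

lemma minus_M [simp]: "X \<in> M \<Longrightarrow> Y \<in> M \<Longrightarrow> X - Y \<in> M"
  by (rule minus_carrier_mat)

lemma one_M [simp]: "X \<in> M \<Longrightarrow> 1\<^sub>m n * X = X" "X \<in> M \<Longrightarrow> X * 1\<^sub>m n = X"
  and zero_M [simp]: "X \<in> M \<Longrightarrow> 0\<^sub>m n n * X = 0\<^sub>m n n" "X \<in> M \<Longrightarrow> X * 0\<^sub>m n n = 0\<^sub>m n n"
  by simp_all

lemma minus_zero_M [simp]: "X \<in> M \<Longrightarrow> X - 0\<^sub>m n n = X"
  by (auto intro!: eq_matI)

lemmas ring_M = assoc_mult_mat[of _ n n _ n _ n] mult_add_distrib_mat[of _ n n _ n]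
  add_mult_distrib_mat[of _ n n _ _ n] minus_mult_distrib_mat[of _ n n _ _ n]
  mult_minus_distrib_mat[of _ n n _ n]

lemma add_left_comm_M: "X \<in> M \<Longrightarrow> Y \<in> M \<Longrightarrow> Z \<in> M \<Longrightarrow> X + (Y + Z) = Y + (X + Z)"
  by (intro eq_matI) auto

lemmas add_ac_M = assoc_add_mat[of _ n n] comm_add_mat[of _ n n] add_left_comm_M

lemma pow_M [simp, intro]: "A \<in> M \<Longrightarrow> A ^\<^sub>m k \<in> M" by simp

lemma hsum_M [simp, intro]: "A \<in> M \<Longrightarrow> X \<in> M \<Longrightarrow> hsum A X k \<in> M"
  by (induction k) auto

lemma pow_commute:
  assumes "A \<in> M" "Y \<in> M" "Y * A = A * Y"
  shows "Y * A ^\<^sub>m k = A ^\<^sub>m k * Y"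
proof (induction k)
  case 0 with assms show ?case by simp
next
  case (Suc k)
  have "Y * A ^\<^sub>m Suc k = (Y * A ^\<^sub>m k) * A" using assms by (simp add: ring_M)
  also have "\<dots> = A ^\<^sub>m k * (Y * A)" using assms Suc by (simp add: ring_M)
  also have "\<dots> = A ^\<^sub>m Suc k * Y" unfolding assms(3) using assms by (simp add: ring_M)
  finally show ?case .
qed

lemma pow_Suc_left: "A \<in> M \<Longrightarrow> A ^\<^sub>m Suc k = A * A ^\<^sub>m k"
  using pow_commute[of A A k] by simp

text \<open>The definition splits off the summand with all powers on the right; here the one with
  all powers on the left is split off and \<open>A\<close> is factored out on the right. Having both
  recursions is what makes the sum telescope, and what makes it self-adjoint for self-adjoint
  \<open>A\<close> and \<open>X\<close>.\<close>

lemma hsum_Suc_right: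
  assumes "A \<in> M" "X \<in> M"
  shows "hsum A X (Suc k) = hsum A X k * A + A ^\<^sub>m Suc k * X"
proof (induction k)
  case 0 show ?case using assms by (simp add: comm_add_mat[of _ n n])
next
  case (Suc k)
  let ?h = "hsum A X k" and ?p = "A ^\<^sub>m Suc k"
  have p: "A ^\<^sub>m Suc (Suc k) = A * ?p" using assms pow_Suc_left by blast
  have "hsum A X (Suc (Suc k)) = A * (?h * A + ?p * X) + X * (?p * A)"
    using Suc by simp
  also have "\<dots> = A * (?h * A) + A * ?p * X + X * ?p * A"
    using assms by (simp add: ring_M del: pow_mat.simps)
  also have "\<dots> = (A * ?h + X * ?p) * A + A * ?p * X"
    using assms by (simp add: ring_M add_ac_M del: pow_mat.simps)
  finally show ?case unfolding p by simp
qed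

text \<open>The sum with index \<open>k + 1\<close> is evaluated from both ends and the results are
  compared. If \<open>A^(k+1)\<close> annihilates \<open>X\<close> on both sides, the sum therefore
  commutes with \<open>A\<close>; by the same identity the sum over a bracket
  \<open>X A - A X\<close> is then zero.\<close>

lemma hsum_telescope:
  assumes "A \<in> M" "X \<in> M"
  shows "A * hsum A X k - hsum A X k * A = A ^\<^sub>m Suc k * X - X * A ^\<^sub>m Suc k"
proof -
  have e: "A * hsum A X k + X * A ^\<^sub>m Suc k = hsum A X k * A + A ^\<^sub>m Suc k * X"
    using hsum_Suc_right[OF assms] by simp
  have "P - Q = R - S" if "P + S = Q + R" "P \<in> M" "Q \<in> M" "R \<in> M" "S \<in> M" for P Q R S
  proof (rule eq_matI)
    fix i j assume ij: "i < dim_row (R - S)" "j < dim_col (R - S)"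
    have "P $$ (i,j) + S $$ (i,j) = Q $$ (i,j) + R $$ (i,j)"
      using arg_cong[OF that(1), of "\<lambda>Z. Z $$ (i,j)"] that(2-) ij by simp
    then have "P $$ (i,j) - Q $$ (i,j) = R $$ (i,j) - S $$ (i,j)" by (simp add: algebra_simps)
    then show "(P - Q) $$ (i,j) = (R - S) $$ (i,j)" using that ij by simp
  qed (use that in auto)
  from this[OF e] assms show ?thesis by (simp del: pow_mat.simps)
qed

text \<open>A factor commuting with \<open>A\<close> slides past the powers to the middle of each
  summand. Projectors and the Lie algebra element \<open>x\<close> are moved into and out of the
  sums in this way.\<close>

lemma hsum_mult_left:
  assumes "A \<in> M" "X \<in> M" "Y \<in> M" "Y * A = A * Y"
  shows "Y * hsum A X k = hsum A (Y * X) k"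
proof (induction k)
  case (Suc k)
  have "Y * hsum A X (Suc k) = Y * A * hsum A X k + Y * X * A ^\<^sub>m Suc k"
    using assms(1-3) by (simp add: ring_M del: pow_mat.simps)
  then show ?case unfolding assms(4) using assms(1-3) Suc by (simp add: ring_M del: pow_mat.simps)
qed simp

lemma hsum_mult_right:
  assumes "A \<in> M" "X \<in> M" "Y \<in> M" "Y * A = A * Y"
  shows "hsum A X k * Y = hsum A (X * Y) k"
proof (induction k)
  case (Suc k)
  have "hsum A X (Suc k) * Y = A * (hsum A X k * Y) + X * (A ^\<^sub>m Suc k * Y)"
    using assms(1-3) by (simp add: ring_M del: pow_mat.simps)
  then show ?case unfolding pow_commute[OF assms(1,3,4), symmetric] using assms Suc
    by (simp add: ring_M del: pow_mat.simps)
qed simp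

lemma hsum_minus:
  assumes "A \<in> M" "X \<in> M" "Y \<in> M"
  shows "hsum A (X - Y) k = hsum A X k - hsum A Y k"
proof (induction k)
  case (Suc k)
  have "(P - Q) + (R - S) = (P + R) - (Q + S)" if "P \<in> M" "Q \<in> M" "R \<in> M" "S \<in> M" for P Q R S
    using that by (intro eq_matI) auto
  then show ?case using assms Suc by (simp add: ring_M del: pow_mat.simps)
qed simp

lemma hsum_add:
  assumes "A \<in> M" "X \<in> M" "Y \<in> M"
  shows "hsum A (X + Y) k = hsum A X k + hsum A Y k"
  using assms by (induction k) (simp_all add: ring_M add_ac_M del: pow_mat.simps)

lemma hsum_smult:
  assumes "A \<in> M" "X \<in> M"
  shows "hsum A (a \<cdot>\<^sub>m X) k = a \<cdot>\<^sub>m hsum A X k"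
proof (induction k)
  case (Suc k)
  then show ?case using assms
    by (simp add: mult_smult_distrib[of _ n n _ n] mult_smult_assoc_mat[of _ n n _ n]
        add_smult_distrib_left_mat[of _ n n] del: pow_mat.simps)
qed simp

lemma hsum_zero: "A \<in> M \<Longrightarrow> hsum A (0\<^sub>m n n) k = 0\<^sub>m n n"
  by (induction k) (simp_all del: pow_mat.simps)

text \<open>The characteristic polynomial has finitely many roots, so an infinite field contains a
  scalar that is no eigenvalue. The conclusion is phrased for square matrices \<open>X\<close>
  because it is used for the operator \<open>P' * x * E\<close>; every nonzero column of
  \<open>X\<close> would be an eigenvector.\<close>

lemma ex_non_eigenvalue:
  fixes N :: "'k mat"
  assumes N: "N \<in> M" and inf: "infinite (UNIV :: 'k set)"
  obtains a where "\<And>X. X \<in> M \<Longrightarrow> a \<cdot>\<^sub>m X = N * X \<Longrightarrow> X = 0\<^sub>m n n"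
proof -
  have "char_poly N \<noteq> 0" using degree_monic_char_poly[OF N] by auto
  then have "finite {a. poly (char_poly N) a = 0}" by (rule poly_roots_finite)
  then obtain a where "poly (char_poly N) a \<noteq> 0" using inf by (metis (mono_tags) UNIV_eq_I mem_Collect_eq)
  then have ne: "\<not> eigenvalue N a" using eigenvalue_root_char_poly[OF N] by simp
  show ?thesis
  proof (rule that)
    fix X assume X: "X \<in> M" and e: "a \<cdot>\<^sub>m X = N * X"
    show "X = 0\<^sub>m n n"
    proof (rule eq_matI)
      fix i j assume ij: "i < dim_row (0\<^sub>m n n)" "j < dim_col (0\<^sub>m n n)"
      have "N *\<^sub>v col X j = col (N * X) j" using N X ij by (intro col_mult2[symmetric]) auto
      also have "\<dots> = a \<cdot>\<^sub>v col X j" unfolding e[symmetric] using X ij by (intro eq_vecI) auto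
      finally have "col X j = 0\<^sub>v n" using ne X ij N unfolding eigenvalue_def eigenvector_def
        by (metis carrier_matD(1) col_carrier_vec col_dim)
      then have "col X j $ i = 0" using ij by simp
      then show "X $$ (i,j) = 0\<^sub>m n n $$ (i,j)" using X ij by simp
    qed (use X in auto)
  qed
qed

end

section \<open>Adjoints for a non-degenerate symmetric form and normalised cyclic vectors\<close>

locale symmetric_form = square_matrices n "TYPE('k)"
  for n and G :: "'k::{alg_closed_field, field_char_0} mat" +
  assumes G_M [simp]: "G \<in> carrier_mat n n" and G_sym: "transpose_mat G = G"
    and G_cancel: "\<And>X. X \<in> carrier_mat n n \<Longrightarrow> G * X = 0\<^sub>m n n \<Longrightarrow> X = 0\<^sub>m n n"
begin

text \<open>Vectors are one-column matrices, so that rank-one operators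
  \<open>w * (transpose_mat w * G)\<close> are ordinary matrix products and obey the same
  associativity laws.\<close>

abbreviation cols1 :: "'k mat set" where "cols1 \<equiv> carrier_mat n 1"

definition form :: "'k mat \<Rightarrow> 'k mat \<Rightarrow> 'k" where
  "form u v = (transpose_mat u * (G * v)) $$ (0, 0)"

definition selfadj :: "'k mat \<Rightarrow> bool" where
  "selfadj X \<longleftrightarrow> X \<in> M \<and> transpose_mat X * G = G * X"

definition skewadj :: "'k mat \<Rightarrow> bool" where
  "skewadj X \<longleftrightarrow> X \<in> M \<and> transpose_mat X * G = - (G * X)"

lemma selfadj_M [simp]: "selfadj X \<Longrightarrow> X \<in> M"
  and skewadj_M [simp]: "skewadj X \<Longrightarrow> X \<in> M"
  by (simp_all add: selfadj_def skewadj_def)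

lemma mult_cols1 [simp]: "X \<in> M \<Longrightarrow> w \<in> cols1 \<Longrightarrow> X * w \<in> cols1"
  by simp

lemma mult_cols1_Suc: "X \<in> M \<Longrightarrow> w \<in> carrier_mat n (Suc 0) \<Longrightarrow> X * w \<in> carrier_mat n (Suc 0)"
  by simp

lemma form_add_left: "u \<in> cols1 \<Longrightarrow> u' \<in> cols1 \<Longrightarrow> v \<in> cols1 \<Longrightarrow> form (u + u') v = form u v + form u' v"
  using add_mult_distrib_mat[of "transpose_mat u" 1 n "transpose_mat u'" "G * v" 1] mult_carrier_mat[OF G_M, of v 1]
  by (simp add: form_def transpose_add[of _ n 1] del: index_mult_mat(1))

lemma form_add_right: "u \<in> cols1 \<Longrightarrow> v \<in> cols1 \<Longrightarrow> v' \<in> cols1 \<Longrightarrow> form u (v + v') = form u v + form u v'"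
  using mult_carrier_mat[OF G_M, of v 1] mult_carrier_mat[OF G_M, of v' 1]
  by (simp add: form_def mult_add_distrib_mat[of _ n n _ 1] mult_add_distrib_mat[of _ 1 n _ 1] del: index_mult_mat(1))

lemma form_smult_right: "u \<in> cols1 \<Longrightarrow> v \<in> cols1 \<Longrightarrow> form u (c \<cdot>\<^sub>m v) = c * form u v"
  using mult_carrier_mat[OF G_M, of v 1]
  by (simp add: form_def mult_smult_distrib[of _ n n _ 1] mult_smult_distrib[of _ 1 n _ 1] del: index_mult_mat(1))

lemma form_sym:
  assumes "u \<in> cols1" "v \<in> cols1"
  shows "form u v = form v u"
proof -
  have "transpose_mat (transpose_mat u * (G * v)) = transpose_mat v * (G * u)"
    using assms transpose_mult[of "transpose_mat u" 1 n "G * v" 1] transpose_mult[of G n n v 1]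
      assoc_mult_mat[of "transpose_mat v" 1 n G n u 1] mult_carrier_mat[OF G_M, of v 1] by (simp add: G_sym)
  then have "transpose_mat (transpose_mat u * (G * v)) $$ (0, 0) = form v u" by (simp add: form_def)
  then show ?thesis using assms by (simp add: form_def)
qed

lemma form_smult_left: "u \<in> cols1 \<Longrightarrow> v \<in> cols1 \<Longrightarrow> form (c \<cdot>\<^sub>m u) v = c * form u v"
  using form_sym[of "c \<cdot>\<^sub>m u" v] form_sym[of u v] form_smult_right by simp

lemma form_adj:
  assumes "X \<in> M" "Y \<in> M" "transpose_mat X * G = G * Y" "u \<in> cols1" "v \<in> cols1"
  shows "form (X * u) v = form u (Y * v)"
proof -
  have "transpose_mat (X * u) * (G * v) = transpose_mat u * (transpose_mat X * (G * v))"
    using assms(1,4,5) transpose_mult[of X n n u 1]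
      assoc_mult_mat[of "transpose_mat u" 1 n "transpose_mat X" n "G * v" 1] mult_carrier_mat[OF G_M, of v 1]
    by simp
  also have "transpose_mat X * (G * v) = G * (Y * v)"
    using assms assoc_mult_mat[of "transpose_mat X" n n G n v 1] assoc_mult_mat[of G n n Y n v 1] by simp
  finally show ?thesis by (simp add: form_def)
qed

lemma selfadj_pow: "selfadj A \<Longrightarrow> selfadj (A ^\<^sub>m k)"
proof (induction k)
  case 0
  then have "dim_row A = n" by (auto simp: selfadj_def)
  then show ?case using left_mult_one_mat[OF G_M] right_mult_one_mat[OF G_M] by (simp add: selfadj_def)
next
  case (Suc k)
  then have A: "A \<in> M" "A ^\<^sub>m k \<in> M" "transpose_mat A * G = G * A" "transpose_mat (A ^\<^sub>m k) * G = G * A ^\<^sub>m k"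
    by (simp_all add: selfadj_def)
  have "transpose_mat (A ^\<^sub>m Suc k) * G = transpose_mat A * (transpose_mat (A ^\<^sub>m k) * G)"
    using A by (simp add: transpose_mult[of _ n n _ n] ring_M)
  also have "\<dots> = transpose_mat A * G * A ^\<^sub>m k" unfolding A(4) using A(1,2) by (simp add: ring_M)
  also have "\<dots> = G * (A ^\<^sub>m Suc k)" unfolding A(3) pow_Suc_left[OF A(1)] using A(1,2) by (simp add: ring_M)
  finally show ?case using A by (simp add: selfadj_def)
qed

lemma form_pow:
  assumes "selfadj A" "u \<in> cols1" "v \<in> cols1"
  shows "form (A ^\<^sub>m i * u) v = form u (A ^\<^sub>m i * v)"
  using form_adj selfadj_pow[OF assms(1)] assms(2,3) by (simp add: selfadj_def)

lemma pow_add_apply: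
  assumes "A \<in> M" "u \<in> cols1"
  shows "A ^\<^sub>m i * (A ^\<^sub>m j * u) = A ^\<^sub>m (i + j) * u"
proof -
  have "A ^\<^sub>m i * A ^\<^sub>m j = A ^\<^sub>m (i + j)"
  proof (induction j)
    case (Suc j) then show ?case using assms(1) by (simp flip: ring_M(1))
  qed (use assms in simp)
  then show ?thesis using assms by (simp flip: assoc_mult_mat[of _ n n _ n _ 1])
qed

text \<open>Write q(s) = (w, A^s w). Self-adjointness of \<open>A\<close> turns each cross term into
  a value of q at a shifted exponent. If q vanishes above \<open>d\<close>, the correction by
  \<open>A^m w\<close> leaves all q(s) with s + m > d unchanged.\<close>

lemma form_perturb:
  fixes c m
  assumes A: "selfadj A" and w: "w \<in> cols1"
  defines "w' \<equiv> w + c \<cdot>\<^sub>m (A ^\<^sub>m m * w)"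
  shows "form w' (A ^\<^sub>m s * w') = form w (A ^\<^sub>m s * w) + 2 * c * form w (A ^\<^sub>m (s + m) * w)
    + c\<^sup>2 * form w (A ^\<^sub>m (s + 2 * m) * w)"
proof -
  have AM: "A \<in> M" using A by simp
  have s: "A ^\<^sub>m s * w' = A ^\<^sub>m s * w + c \<cdot>\<^sub>m (A ^\<^sub>m (s + m) * w)"
    unfolding w'_def using AM w
    by (simp add: mult_add_distrib_mat[of _ n n _ 1] mult_smult_distrib[of _ n n _ 1] pow_add_apply mult_cols1_Suc)
  have m: "form (A ^\<^sub>m m * w) (A ^\<^sub>m t * w) = form w (A ^\<^sub>m (t + m) * w)" for t
    using AM w A by (simp add: form_pow pow_add_apply add.commute mult_cols1_Suc)
  have "form w' (A ^\<^sub>m s * w') = form w (A ^\<^sub>m s * w) + c * form w (A ^\<^sub>m (s + m) * w)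
      + c * (form (A ^\<^sub>m m * w) (A ^\<^sub>m s * w) + c * form (A ^\<^sub>m m * w) (A ^\<^sub>m (s + m) * w))"
    unfolding s unfolding w'_def using AM w
    by (simp add: form_add_left form_add_right form_smult_left form_smult_right mult_cols1_Suc distrib_left)
  also have "\<dots> = form w (A ^\<^sub>m s * w) + 2 * c * form w (A ^\<^sub>m (s + m) * w)
    + c\<^sup>2 * form w (A ^\<^sub>m (s + m + m) * w)"
    unfolding m by (simp add: power2_eq_square algebra_simps)
  also have "s + m + m = s + 2 * m" by simp
  finally show ?thesis .
qed

text \<open>A triangular elimination on the values (w, A^s w): the top one is scaled to 1, then
  those at d - 1, d - 2, ... are removed one at a time by adding multiples of A w, A^2 w, .... A
  correction never disturbs the values already settled. Since \<open>P\<close> commutes with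
  \<open>A\<close>, the vector stays in the image of \<open>P\<close>.\<close>

lemma normalised_generator:
  assumes A: "selfadj A" and P: "P \<in> M" "P * A = A * P" and w: "w \<in> cols1" "P * w = w"
    and top: "form w (A ^\<^sub>m d * w) \<noteq> 0" and above: "\<And>s. s > d \<Longrightarrow> form w (A ^\<^sub>m s * w) = 0"
  obtains w' where "w' \<in> cols1" "P * w' = w'"
    "\<And>s. form w' (A ^\<^sub>m s * w') = (if s = d then 1 else 0)"
proof -
  have AM: "A \<in> M" using A by simp
  have "\<exists>w'\<in>cols1. P * w' = w' \<and> form w' (A ^\<^sub>m d * w') = 1
      \<and> (\<forall>s. s > d \<or> s < d \<and> d \<le> s + j \<longrightarrow> form w' (A ^\<^sub>m s * w') = 0)" if "j \<le> d" for j
    using that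
  proof (induction j)
    case 0
    \<comment> \<open>Scaling by \<open>c\<close> multiplies every value by \<open>c^2\<close>, so
      making the top value 1 needs a square root.\<close>
    obtain c where c: "c\<^sup>2 = inverse (form w (A ^\<^sub>m d * w))" using nth_root_exists[of 2] by fastforce
    have "form (c \<cdot>\<^sub>m w) (A ^\<^sub>m s * (c \<cdot>\<^sub>m w)) = c\<^sup>2 * form w (A ^\<^sub>m s * w)" for s
      using AM w by (simp add: mult_smult_distrib[of _ n n _ 1] form_smult_left form_smult_right power2_eq_square mult_cols1_Suc)
    then have q: "form (c \<cdot>\<^sub>m w) (A ^\<^sub>m s * (c \<cdot>\<^sub>m w)) = c\<^sup>2 * form w (A ^\<^sub>m s * w)" for s by blast
    have "P * (c \<cdot>\<^sub>m w) = c \<cdot>\<^sub>m w" using w P(1) by (simp add: mult_smult_distrib[of _ n n _ 1])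
    moreover have "c \<cdot>\<^sub>m w \<in> cols1" using w by simp
    ultimately show ?case using top above by (intro bexI[of _ "c \<cdot>\<^sub>m w"]) (simp_all add: q c)
  next
    case (Suc j)
    then obtain v where v: "v \<in> cols1" "P * v = v" "form v (A ^\<^sub>m d * v) = 1"
      "\<And>s. s > d \<or> s < d \<and> d \<le> s + j \<Longrightarrow> form v (A ^\<^sub>m s * v) = 0" by auto
    \<comment> \<open>At exponent \<open>d - Suc j\<close> the linear term of
      \<open>form_perturb\<close> contributes \<open>2 * c\<close> times the top value 1, and the
      quadratic term lies above \<open>d\<close>; this \<open>c\<close> cancels the value
      exactly.\<close>
    define c where "c = - form v (A ^\<^sub>m (d - Suc j) * v) / 2"
    define v' where "v' = v + c \<cdot>\<^sub>m (A ^\<^sub>m Suc j * v)"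
    have v': "form v' (A ^\<^sub>m s * v') = form v (A ^\<^sub>m s * v) + 2 * c * form v (A ^\<^sub>m (s + Suc j) * v)
      + c\<^sup>2 * form v (A ^\<^sub>m (s + 2 * Suc j) * v)" for s
      unfolding v'_def by (rule form_perturb[OF A v(1)])
    have "P * (A ^\<^sub>m Suc j * v) = A ^\<^sub>m Suc j * v"
      using assoc_mult_mat[of P n n "A ^\<^sub>m Suc j" n v 1] assoc_mult_mat[of "A ^\<^sub>m Suc j" n n P n v 1]
        pow_commute[OF AM P, of "Suc j"] v AM P by (simp del: pow_mat.simps)
    then have Pv: "P * v' = v'" unfolding v'_def using v AM P
      by (simp add: mult_add_distrib_mat[of _ n n _ 1] mult_smult_distrib[of _ n n _ 1] mult_cols1_Suc del: pow_mat.simps)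
    have "form v' (A ^\<^sub>m s * v') = 0" if "s > d \<or> s < d \<and> d \<le> s + Suc j" for s
    proof (cases "s + Suc j = d")
      case True
      then have s: "s = d - Suc j" by simp
      have "s + 2 * Suc j > d" using True by simp
      then have "form v (A ^\<^sub>m (s + 2 * Suc j) * v) = 0" using v(4) by blast
      then show ?thesis unfolding v' True v(3) by (simp add: c_def s)
    next
      case False
      then have "form v (A ^\<^sub>m s * v) = 0" "form v (A ^\<^sub>m (s + Suc j) * v) = 0"
        "form v (A ^\<^sub>m (s + 2 * Suc j) * v) = 0"
        using that by (auto intro!: v(4) simp del: pow_mat.simps)
      then show ?thesis unfolding v' by simp
    qed
    moreover have "form v' (A ^\<^sub>m d * v') = 1"
      unfolding v' using v(3) v(4)[of "d + Suc j"] v(4)[of "d + 2 * Suc j"] by (simp del: pow_mat.simps)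
    moreover have "v' \<in> cols1" unfolding v'_def using v AM by (simp add: mult_cols1_Suc del: pow_mat.simps)
    ultimately show ?case using Pv by blast
  qed
  from this[of d] show ?thesis using that by (metis le_add2 nat_neq_iff order_refl)
qed

text \<open>Polarisation: the bilinear form (u, N v) is symmetric because \<open>N\<close> is
  self-adjoint, so a vanishing quadratic form would force it to vanish, as 2 is invertible. Then
  \<open>G * N\<close> has only zero entries, contradicting non-degeneracy.\<close>

lemma form_nondegenerate_on:
  assumes N: "selfadj N" "N \<noteq> 0\<^sub>m n n"
  obtains v where "v \<in> cols1" "form v (N * v) \<noteq> 0"
proof (rule ccontr)
  assume "\<not> thesis"
  then have q: "form v (N * v) = 0" if "v \<in> cols1" for v using that \<open>\<And>v. v \<in> cols1 \<Longrightarrow> form v (N * v) \<noteq> 0 \<Longrightarrow> thesis\<close> by blast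
  have NM: "N \<in> M" using N by simp
  have b: "form u (N * v) = 0" if uv: "u \<in> cols1" "v \<in> cols1" for u v
  proof -
    have "form v (N * u) = form (N * v) u" using form_adj[of N N v u] N uv by (simp add: selfadj_def)
    also have "\<dots> = form u (N * v)" using form_sym uv NM by simp
    finally have "form (u + v) (N * (u + v)) = form u (N * u) + form v (N * v) + 2 * form u (N * v)"
      using uv NM by (simp add: form_add_left form_add_right mult_add_distrib_mat[of _ n n _ 1])
    then show ?thesis using q uv by simp
  qed
  \<comment> \<open>Standard basis columns, used to read off the entries of \<open>G * N\<close>
    from the values of the form.\<close>
  define e :: "nat \<Rightarrow> 'k mat" where "e k = mat n 1 (\<lambda>(i, _). if i = k then 1 else 0)" for k
  have e: "e k \<in> cols1" for k by (simp add: e_def)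
  have "(G * N) $$ (k, l) = 0" if kl: "k < n" "l < n" for k l
  proof -
    have GN: "(X * e l) $$ (i, 0) = X $$ (i, l)" if "X \<in> carrier_mat m n" "i < m" for X :: "'k mat" and m i
      using that kl by (auto simp: e_def scalar_prod_def if_distrib[of "\<lambda>x. _ * x"] cong: if_cong)
    have "form (e k) (N * e l) = (transpose_mat (e k) * ((G * N) * e l)) $$ (0, 0)"
      using NM e by (simp add: form_def assoc_mult_mat[of _ n n _ n _ 1])
    also have "\<dots> = ((transpose_mat (e k) * (G * N)) * e l) $$ (0, 0)"
      using NM e by (simp add: assoc_mult_mat[of _ 1 n _ n _ 1])
    also have "\<dots> = (transpose_mat (e k) * (G * N)) $$ (0, l)"
      by (rule GN) (use NM in \<open>auto simp: e_def\<close>)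
    also have "\<dots> = (G * N) $$ (k, l)" 
      unfolding times_mat_def[of "transpose_mat (e k)"] using NM kl carrier_matD[OF G_M]
      by (simp add: e_def scalar_prod_def if_distrib[of "\<lambda>x. x * _"] del: index_mult_mat(1) cong: if_cong)
    finally show ?thesis using b[OF e e] by simp
  qed
  then have "G * N = 0\<^sub>m n n" using NM by (intro eq_matI) (auto simp del: index_mult_mat(1) simp: carrier_matD[OF G_M])
  then show False using G_cancel NM N by blast
qed

text \<open>The relation \<open>transpose_mat X * G = G * X'\<close> expresses that
  \<open>X'\<close> is the adjoint of \<open>X\<close>. Keeping it as a relation avoids an inverse
  of \<open>G\<close>; by \<open>adj_unique\<close> it still determines \<open>X'\<close>.\<close>

lemma adj_mult:
  assumes "X \<in> M" "X' \<in> M" "Y \<in> M" "Y' \<in> M"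
    and "transpose_mat X * G = G * X'" "transpose_mat Y * G = G * Y'"
  shows "transpose_mat (X * Y) * G = G * (Y' * X')"
proof -
  have "transpose_mat (X * Y) * G = transpose_mat Y * (transpose_mat X * G)"
    using assms(1-4) by (simp add: transpose_mult[of _ n n _ n] ring_M)
  also have "\<dots> = transpose_mat Y * G * X'" unfolding assms(5) using assms(1-4) by (simp add: ring_M)
  finally show ?thesis unfolding assms(6) using assms(1-4) by (simp add: ring_M)
qed

lemma adj_add:
  assumes "X \<in> M" "X' \<in> M" "Y \<in> M" "Y' \<in> M"
    and "transpose_mat X * G = G * X'" "transpose_mat Y * G = G * Y'"
  shows "transpose_mat (X + Y) * G = G * (X' + Y')"
  using assms by (simp add: transpose_add[of _ n n] ring_M)

lemma adj_unique:
  assumes "Y \<in> M" "Y' \<in> M" "G * Y = G * Y'"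
  shows "Y = Y'"
proof -
  have "G * (Y - Y') = 0\<^sub>m n n" using assms by (simp add: ring_M)
  then have "Y - Y' = 0\<^sub>m n n" using G_cancel[OF minus_carrier_mat[OF assms(2)]] by blast
  show ?thesis
  proof (rule eq_matI)
    fix i j assume ij: "i < dim_row Y'" "j < dim_col Y'"
    then have "(Y - Y') $$ (i,j) = 0" unfolding \<open>Y - Y' = 0\<^sub>m n n\<close> using assms by simp
    then show "Y $$ (i,j) = Y' $$ (i,j)" using ij assms by simp
  qed (use assms in auto)
qed

text \<open>Taking adjoints reverses every product and so turns the left recursion into the right
  one, which has the same value by \<open>hsum_Suc_right\<close>.\<close>

lemma selfadj_hsum:
  assumes A: "selfadj A" and X: "selfadj X"
  shows "selfadj (hsum A X k)"
proof (induction k)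
  case (Suc k)
  have M: "A \<in> M" "X \<in> M" using assms by auto
  note D = A[unfolded selfadj_def] X[unfolded selfadj_def] Suc[unfolded selfadj_def]
    selfadj_pow[OF A, of "Suc k", unfolded selfadj_def]
  have "transpose_mat (A * hsum A X k + X * A ^\<^sub>m Suc k) * G = G * (hsum A X k * A + A ^\<^sub>m Suc k * X)"
    using D by (intro adj_add adj_mult mult_M) blast+
  then show ?case using M hsum_Suc_right[OF M, of k] by (simp add: selfadj_def)
qed (use X in simp)

section \<open>Rank-one operators and the splitting off of a longest Jordan block\<close>

lemma rank_one_apply:
  assumes w: "w \<in> cols1" and u: "u \<in> cols1"
  shows "(w * (transpose_mat w * G)) * u = form w u \<cdot>\<^sub>m w"
proof -
  let ?r = "transpose_mat w * G"
  have wT: "transpose_mat w \<in> carrier_mat 1 n" using w by simp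
  have r: "?r \<in> carrier_mat 1 n" using mult_carrier_mat[OF wT G_M] .
  have "?r * u = transpose_mat w * (G * u)" by (rule assoc_mult_mat[OF wT G_M u])
  moreover have "B = B $$ (0,0) \<cdot>\<^sub>m 1\<^sub>m 1" if "B \<in> carrier_mat 1 1" for B :: "'k mat"
    using that by (intro eq_matI) auto
  ultimately have "?r * u = form w u \<cdot>\<^sub>m 1\<^sub>m 1"
    unfolding form_def using mult_carrier_mat[OF r u] by metis
  then have "w * ?r * u = w * (form w u \<cdot>\<^sub>m 1\<^sub>m 1)" using assoc_mult_mat[OF w r u] by simp
  also have "\<dots> = form w u \<cdot>\<^sub>m w"
    using mult_smult_distrib[OF w one_carrier_mat] w by simp
  finally show ?thesis .
qed

text \<open>The inner product in the middle collapses to the scalar (w, X w). With \<open>X\<close>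
  a power of \<open>A\<close> this encodes the normalisation of \<open>w\<close>; with
  \<open>X\<close> skew the scalar is zero. These two consequences let \<open>E\<close> replace the
  vector \<open>w\<close> from here on.\<close>

lemma rank_one_absorb:
  assumes w: "w \<in> cols1" and X: "X \<in> M"
  shows "(w * (transpose_mat w * G)) * X * (w * (transpose_mat w * G)) = form w (X * w) \<cdot>\<^sub>m (w * (transpose_mat w * G))"
proof -
  let ?r = "transpose_mat w * G" and ?E = "w * (transpose_mat w * G)"
  have r: "?r \<in> carrier_mat 1 n" using w by (intro mult_carrier_mat[of _ _ n] G_M) simp
  have E: "?E \<in> M" by (rule mult_carrier_mat[OF w r])
  have "?E * X * ?E = (?E * X * w) * ?r" by (rule assoc_mult_mat[OF mult_carrier_mat[OF E X] w r, symmetric])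
  also have "?E * X * w = ?E * (X * w)" by (rule assoc_mult_mat[OF E X w])
  also have "\<dots> = form w (X * w) \<cdot>\<^sub>m w" by (rule rank_one_apply[OF w mult_cols1[OF X w]])
  also have "(form w (X * w) \<cdot>\<^sub>m w) * ?r = form w (X * w) \<cdot>\<^sub>m ?E" by (rule mult_smult_assoc_mat[OF w r])
  finally show ?thesis .
qed

lemma skewadj_adj: "skewadj x \<Longrightarrow> transpose_mat x * G = G * (- x)"
  using uminus_mult_right_mat[of G x] carrier_matD[OF G_M] by (auto simp: skewadj_def)

lemma skewadj_form: 
  assumes x: "skewadj x" and w: "w \<in> cols1"
  shows "form w (x * w) = 0"
proof -
  have xw: "x * w \<in> cols1" using x w by (simp add: mult_cols1_Suc)
  have "(- x) * w = - (x * w)" using carrier_matD[OF skewadj_M[OF x]] carrier_matD[OF w] by (intro uminus_mult_left_mat) simp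
  also have "- (x * w) = (- 1) \<cdot>\<^sub>m (x * w)" by (rule eq_matI) (auto simp del: index_mult_mat(1))
  finally have "(- x) * w = (- 1) \<cdot>\<^sub>m (x * w)" .
  then have "form (x * w) w = - form w (x * w)"
    using form_adj[OF _ _ skewadj_adj[OF x] w w] form_smult_right[OF w xw, of "-1"] x by simp
  then show ?thesis using form_sym[OF xw w] by simp
qed

text \<open>For an idempotent this is the rank. It serves only as the measure of the induction over
  idempotents, and counting fixed vectors makes its strict decrease easy to show.\<close>

definition fixed_rank :: "'k mat \<Rightarrow> nat" where
  "fixed_rank P = Max {card b | b. b \<subseteq> {v \<in> carrier_vec n. P *\<^sub>v v = v}
     \<and> module.lin_indpt class_ring (module_vec TYPE('k) n) b}"

text \<open>Vectors fixed by \<open>P'\<close> are fixed by \<open>P\<close>. A nonzero column of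
  \<open>E\<close> is fixed by \<open>P\<close> but killed by \<open>P'\<close>, hence lies outside
  the span of any set of vectors fixed by \<open>P'\<close>; adding it to a largest independent set
  for \<open>P'\<close> gives a larger one for \<open>P\<close>.\<close>

lemma fixed_rank_less:
  assumes P: "P \<in> M" "P' \<in> M" "P * P' = P'" and E: "E \<in> M" "P * E = E" "P' * E = 0\<^sub>m n n" "E \<noteq> 0\<^sub>m n n"
  shows "fixed_rank P' < fixed_rank P"
proof -
  interpret vec_space "TYPE('k)" n .
  let ?F = "\<lambda>P. {v \<in> carrier_vec n. P *\<^sub>v v = v}"
  let ?S = "\<lambda>P. {card b | b. b \<subseteq> ?F P \<and> lin_indpt b}"
  have fin: "finite b \<and> card b \<le> dim" if "b \<subseteq> ?F P" "lin_indpt b" for b and P :: "'k mat"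
    using li_le_dim[OF fin_dim _ that(2)] that(1) by auto
  have finS: "finite (?S P)" for P :: "'k mat"
    by (rule finite_subset[of _ "{..dim}"]) (use fin in auto)
  have "{} \<subseteq> ?F P' \<and> lin_indpt {}" by (simp add: lin_dep_def)
  then have "0 \<in> ?S P'" by force
  define m where "m = Max (?S P')"
  have "m \<in> ?S P'" unfolding m_def using \<open>0 \<in> ?S P'\<close> finS[of P'] Max_in by blast
  then obtain b where b: "b \<subseteq> ?F P'" "lin_indpt b" "card b = m" by blast
  have finb: "finite b" using fin b by blast
  have bc: "b \<subseteq> carrier_vec n" using b by auto
  have "\<exists>i<n. \<exists>j<n. E $$ (i, j) \<noteq> 0"
  proof (rule ccontr)
    assume "\<not> ?thesis"
    then have "E = 0\<^sub>m n n" using E(1) by (intro eq_matI) auto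
    then show False using E(4) by simp
  qed
  then obtain i j where ij: "i < n" "j < n" "E $$ (i, j) \<noteq> 0" by blast
  define v where "v = col E j"
  have v: "v \<in> carrier_vec n" unfolding v_def carrier_vec_def using E(1) by simp
  have "P *\<^sub>v v = col (P * E) j" "P' *\<^sub>v v = col (P' * E) j"
    unfolding v_def using ij by (intro col_mult2[symmetric, OF _ E(1)]; use P in simp)+
  then have Pv: "P *\<^sub>v v = v" "P' *\<^sub>v v = 0\<^sub>v n" unfolding E using ij by (simp_all add: v_def)
  have "v $ i \<noteq> 0" unfolding v_def using ij E(1) by simp
  then have "v \<noteq> 0\<^sub>v n" using ij by auto
  have sub: "submodule class_ring (?F P') V"
    using P(2) by unfold_locales (auto simp: module_vec_simps mult_add_distrib_mat_vec[of _ n n] mult_mat_vec[of _ n n])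
  have "v \<notin> span b"
  proof
    assume "v \<in> span b"
    then have "v \<in> ?F P'" using span_is_subset[OF b(1) sub] by blast
    then show False using Pv(2) \<open>v \<noteq> 0\<^sub>v n\<close> by simp
  qed
  moreover have "v \<notin> b" using calculation span_mem[OF bc] by blast
  ultimately have li: "lin_indpt (b \<union> {v})"
    using lin_dep_iff_in_span[OF bc b(2) v] by blast
  have "b \<subseteq> ?F P"
  proof
    fix u assume "u \<in> b"
    then have u: "u \<in> carrier_vec n" "P' *\<^sub>v u = u" using b by auto
    have "P *\<^sub>v (P' *\<^sub>v u) = P' *\<^sub>v u" using P u(1) assoc_mult_mat_vec[of P n n P' n u] by simp
    then show "u \<in> ?F P" using u by simp
  qed
  then have "card (b \<union> {v}) \<in> ?S P" using li v Pv(1) by blast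
  then have "card (b \<union> {v}) \<le> Max (?S P)" using finS Max_ge by blast
  moreover have "card (b \<union> {v}) = Suc (card b)" using finb \<open>v \<notin> b\<close> by simp
  ultimately show ?thesis using b(3) unfolding fixed_rank_def m_def by simp
qed

text \<open>The operator \<open>A^d P\<close> is nonzero and self-adjoint, so its quadratic form is
  nonzero at some \<open>v\<close>. Projecting \<open>v\<close> by \<open>P\<close> and normalising
  gives the generator \<open>w\<close> of a block of length \<open>d + 1\<close>, and
  \<open>E\<close> is u \<mapsto> (w, u) w.\<close>

lemma exists_block:
  assumes A: "selfadj A" and P: "selfadj P" and PP: "P * P = P" and PA: "P * A = A * P"
    and nil: "A ^\<^sub>m N * P = 0\<^sub>m n n" and False: "P \<noteq> 0\<^sub>m n n"
  obtains E d where "E \<noteq> 0\<^sub>m n n" "E \<in> M" "selfadj E"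
    "P * E = E" "E * P = E" "\<And>s. E * A ^\<^sub>m s * E = (if s = d then E else 0\<^sub>m n n)"
    "\<And>x. skewadj x \<Longrightarrow> E * x * E = 0\<^sub>m n n" "A ^\<^sub>m Suc d * P = 0\<^sub>m n n"
proof -
  have AM [simp]: "A \<in> M" and PM [simp]: "P \<in> M" using A P by auto
  have ApM [simp]: "A ^\<^sub>m k \<in> M" for k by simp
  \<comment> \<open>The largest exponent at which \<open>A\<close> is still nonzero on the image of
    \<open>P\<close>; its minimal definition yields both \<open>A^(d+1) P = 0\<close> and
    \<open>A^d P \<noteq> 0\<close>.\<close>
  define d where "d = (LEAST k. A ^\<^sub>m Suc k * P = 0\<^sub>m n n)"
  have "A ^\<^sub>m Suc N * P = 0\<^sub>m n n"
    using nil right_mult_zero_mat[OF AM] by (simp add: pow_Suc_left ring_M del: pow_mat.simps)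
  then have d0: "A ^\<^sub>m Suc d * P = 0\<^sub>m n n" unfolding d_def by (rule LeastI)
  have d1: "A ^\<^sub>m d * P \<noteq> 0\<^sub>m n n"
  proof (cases d)
    case 0
    have "dim_row A = n" using AM by (rule carrier_matD(1))
    then show ?thesis using False 0 by simp
  next
    case (Suc k)
    then show ?thesis using not_less_Least[of k "\<lambda>k. A ^\<^sub>m Suc k * P = 0\<^sub>m n n"] by (simp add: d_def)
  qed
  have PAk: "P * A ^\<^sub>m k = A ^\<^sub>m k * P" for k by (rule pow_commute) (use PA in auto)
  have vanish: "A ^\<^sub>m k * P = 0\<^sub>m n n" if "k > d" for k
  proof -
    have "A ^\<^sub>m (Suc d + i) * P = 0\<^sub>m n n" for i
    proof (induction i)
      case (Suc i)
      have "A ^\<^sub>m (Suc d + Suc i) * P = A * (A ^\<^sub>m (Suc d + i) * P)"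
        using pow_Suc_left[of A "Suc d + i"] by (simp add: ring_M del: pow_mat.simps)
      then show ?case unfolding Suc by simp
    qed (use d0 in simp)
    from this[of "k - Suc d"] show ?thesis using that by (simp del: pow_mat.simps)
  qed
  have "selfadj (A ^\<^sub>m d * P)"
    using adj_mult[of "A ^\<^sub>m d" "A ^\<^sub>m d" P P] selfadj_pow[OF A, of d] P PAk[of d]
    by (simp add: selfadj_def)
  then obtain v where v: "v \<in> cols1" "form v (A ^\<^sub>m d * P * v) \<noteq> 0"
    using form_nondegenerate_on d1 by blast
  \<comment> \<open>Since \<open>P\<close> is a self-adjoint idempotent commuting with
    \<open>A\<close>, replacing \<open>v\<close> by \<open>P * v\<close> moves the generator into
    the image of \<open>P\<close> and keeps the nonzero top value.\<close>
  have fP: "form (P * v) (A ^\<^sub>m k * (P * v)) = form v (A ^\<^sub>m k * P * v)" for k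
  proof -
    have Akv: "A ^\<^sub>m k * (P * v) \<in> cols1" using v(1) by (intro mult_cols1) simp_all
    have "form (P * v) (A ^\<^sub>m k * (P * v)) = form v (P * (A ^\<^sub>m k * (P * v)))"
      using P v(1) Akv by (intro form_adj) (auto simp: selfadj_def)
    also have "P * (A ^\<^sub>m k * (P * v)) = (P * A ^\<^sub>m k * P) * v"
      using assoc_mult_mat[of P n n "A ^\<^sub>m k" n "P * v" 1] assoc_mult_mat[of "P * A ^\<^sub>m k" n n P n v 1]
        mult_cols1[OF PM v(1)] v(1) by simp
    also have "P * A ^\<^sub>m k * P = A ^\<^sub>m k * P"
      unfolding PAk using PP by (simp add: ring_M)
    finally show ?thesis .
  qed
  have Pv: "P * (P * v) = P * v" using assoc_mult_mat[of P n n P n v 1] v(1) PP by simp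
  have top: "form (P * v) (A ^\<^sub>m d * (P * v)) \<noteq> 0" unfolding fP by (rule v(2))
  have "form (P * v) (A ^\<^sub>m s * (P * v)) = 0" if "s > d" for s
  proof -
    have "0\<^sub>m n n * v = 0 \<cdot>\<^sub>m v" using v(1) by (intro eq_matI) auto
    then show ?thesis unfolding fP vanish[OF that] using form_smult_right[OF v(1) v(1), of 0] by simp
  qed
  then obtain w where w: "w \<in> cols1" "P * w = w"
      "\<And>s. form w (A ^\<^sub>m s * w) = (if s = d then 1 else 0)"
    using normalised_generator[OF A PM PA mult_cols1[OF PM v(1)] Pv top] by metis
  define E where "E = w * (transpose_mat w * G)"
  have rM: "transpose_mat w * G \<in> carrier_mat 1 n" using w(1) by simp
  have EM [simp]: "E \<in> M" unfolding E_def using w(1) rM by auto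
  have EXE: "E * X * E = form w (X * w) \<cdot>\<^sub>m E" if "X \<in> M" for X
    unfolding E_def by (rule rank_one_absorb[OF w(1) that])
  have EAE: "E * A ^\<^sub>m s * E = (if s = d then E else 0\<^sub>m n n)" for s
    using EXE[OF ApM] w(3) by (auto intro!: eq_matI simp: carrier_matD[OF EM] simp del: index_mult_mat(1))
  have E_adj: "selfadj E"
  proof -
    have wT: "transpose_mat w \<in> carrier_mat 1 n" using w(1) by simp
    have "transpose_mat E = transpose_mat (transpose_mat w * G) * transpose_mat w"
      unfolding E_def by (rule transpose_mult[OF w(1) rM])
    also have "transpose_mat (transpose_mat w * G) = G * w"
      using transpose_mult[OF wT G_M] unfolding G_sym by simp
    finally have "transpose_mat E * G = G * w * transpose_mat w * G" by simp
    also have "\<dots> = G * w * (transpose_mat w * G)"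
      by (rule assoc_mult_mat[OF mult_cols1[OF G_M w(1)] wT G_M])
    also have "\<dots> = G * E" unfolding E_def by (rule assoc_mult_mat[OF G_M w(1) rM])
    finally show ?thesis by (simp add: selfadj_def)
  qed
  have PE: "P * E = E" unfolding E_def
    using assoc_mult_mat[of P n n w 1 "transpose_mat w * G" n] w rM by simp
  have EP: "E * P = E"
  proof (rule adj_unique)
    show "G * (E * P) = G * E"
      using adj_mult[of P P E E] P E_adj PE by (simp add: selfadj_def)
  qed simp_all
  have "E * x * E = 0\<^sub>m n n" if "skewadj x" for x
    unfolding EXE[OF skewadj_M[OF that]] skewadj_form[OF that w(1)] using carrier_matD[OF EM] by (intro eq_matI) auto
  moreover have "E \<noteq> 0\<^sub>m n n"
  proof
    assume E0: "E = 0\<^sub>m n n"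
    have c: "A ^\<^sub>m d * w \<in> cols1" by (rule mult_cols1[OF ApM w(1)])
    \<comment> \<open>Because (w, A^d w) = 1, the operator \<open>E\<close> maps
      \<open>A^d w\<close> to \<open>w\<close>. If \<open>E\<close> were zero, \<open>w\<close>
      would be zero, against the same normalisation.\<close>
    have "w = E * (A ^\<^sub>m d * w)"
      unfolding E_def rank_one_apply[OF w(1) c] w(3) using w(1) by (auto intro!: eq_matI)
    also have "\<dots> = 0 \<cdot>\<^sub>m w" unfolding E0 left_mult_zero_mat[OF c] using w(1) by (auto intro!: eq_matI)
    finally have z: "0 \<cdot>\<^sub>m w = w" ..
    have "form w (A ^\<^sub>m d * w) = 0"
      using form_smult_left[OF w(1) c, of 0] unfolding z by simp
    then show False using w(3)[of d] by simp
  qed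
  ultimately show thesis using that[OF _ EM E_adj PE EP EAE _ d0] by blast
qed

end

section \<open>Extending a solution across one block\<close>

locale nilpotent_block = symmetric_form n G for n and G :: "'k::{alg_closed_field, field_char_0} mat" +
  fixes A P E :: "'k mat" and d :: nat
  assumes A: "selfadj A" and P: "selfadj P" and PP: "P * P = P" and PA: "P * A = A * P"
    and E: "selfadj E" and PE: "P * E = E" and EP: "E * P = E"
    and EAE: "\<And>s. E * A ^\<^sub>m s * E = (if s = d then E else 0\<^sub>m n n)"
    and ExE: "\<And>x. skewadj x \<Longrightarrow> E * x * E = 0\<^sub>m n n" and top: "A ^\<^sub>m Suc d * P = 0\<^sub>m n n"
begin

lemma AM [simp]: "A \<in> M" and PM [simp]: "P \<in> M" and EM [simp]: "E \<in> M"
  using A P E by auto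

lemma diff_zero_imp_eq:
  assumes "X \<in> M" "Y \<in> M" "X - Y = 0\<^sub>m n n"
  shows "X = Y"
proof (rule eq_matI)
  fix i j assume "i < dim_row Y" "j < dim_col Y"
  then show "X $$ (i,j) = Y $$ (i,j)"
    using arg_cong[OF assms(3), of "\<lambda>Z. Z $$ (i,j)"] assms(1,2) by simp
qed (use assms in auto)

text \<open>For \<open>E\<close> = (w, .) w this is u \<mapsto> \<Sum>s. (A^s w, u) A^(d-s) w. The
  normalisation makes the vectors A^s w and A^(d-s) w dual bases, so it is the orthogonal projector
  onto the block; \<open>P'\<close> then projects onto the complement of the block within the image
  of \<open>P\<close>.\<close>

definition Q :: "'k mat" where "Q = hsum A E d"
definition P' :: "'k mat" where "P' = P - Q"

lemma QM [simp]: "Q \<in> M" by (simp add: Q_def)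
lemma P'M [simp]: "P' \<in> M" by (simp add: P'_def)

lemma PAk: "P * A ^\<^sub>m k = A ^\<^sub>m k * P" 
  by (rule pow_commute) (use PA in auto)

lemma Q_adj: "selfadj Q" unfolding Q_def by (rule selfadj_hsum[OF A E])

lemma top_left: "Y \<in> M \<Longrightarrow> P * Y = Y \<Longrightarrow> A ^\<^sub>m Suc d * Y = 0\<^sub>m n n"
  using ring_M(1)[OF pow_M[OF AM, of "Suc d"] PM, of Y] top by simp

lemma top_right: "Y \<in> M \<Longrightarrow> Y * P = Y \<Longrightarrow> Y * A ^\<^sub>m Suc d = 0\<^sub>m n n"
  using ring_M(1)[OF _ PM pow_M[OF AM, of "Suc d"], of Y] PAk[of "Suc d"] top by simp

text \<open>The telescoped commutator is \<open>A^(d+1) E - E A^(d+1)\<close>, and both terms vanish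
  because \<open>E\<close> is supported on the image of \<open>P\<close>.\<close>

lemma QA: "Q * A = A * Q"
  using diff_zero_imp_eq[of "A * Q" "Q * A"] hsum_telescope[OF AM EM, of d] top_left[OF EM PE] top_right[OF EM EP]
  by (simp add: Q_def del: pow_mat.simps)

text \<open>Among the products A^(k-s) E A^s E only the one with s = d can survive. It does not
  occur for k < d, and for k = d it carries no further power of \<open>A\<close>.\<close>

lemma hsum_E: "k \<le> d \<Longrightarrow> hsum A E k * E = (if k = d then E else 0\<^sub>m n n)"
proof (induction k)
  case 0
  have "dim_row A = n" using AM by (rule carrier_matD(1))
  then show ?case using EAE[of 0] by simp
next
  case (Suc k)
  have "hsum A E (Suc k) * E = A * (hsum A E k * E) + E * A ^\<^sub>m Suc k * E"
    by (simp add: ring_M del: pow_mat.simps)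
  then show ?case unfolding EAE using Suc by simp
qed

lemma QE: "Q * E = E"
  using hsum_E[of d] by (simp add: Q_def)

lemma EQ: "E * Q = E"
  by (rule adj_unique) (use adj_mult[of Q Q E E] Q_adj E QE in \<open>simp_all add: selfadj_def\<close>)

text \<open>As \<open>Q\<close> commutes with \<open>A\<close>, it can be pulled inside its own
  defining sum, where it meets \<open>E\<close> and disappears by \<open>QE\<close>. The identities
  for \<open>P\<close> follow the same pattern.\<close>

lemma QQ: "Q * Q = Q"
  using hsum_mult_left[OF AM EM QM QA, of d] QE by (simp add: Q_def)

lemma PQ: "P * Q = Q"
  using hsum_mult_left[OF AM EM PM PA, of d] PE by (simp add: Q_def)

lemma QP: "Q * P = Q"
  using hsum_mult_right[OF AM EM PM PA, of d] EP by (simp add: Q_def)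

lemma P'P': "P' * P' = P'"
  unfolding P'_def using PP PQ QP QQ by (simp add: ring_M) (intro eq_matI; simp)?

lemma P'A: "P' * A = A * P'"
  unfolding P'_def using PA QA by (simp add: ring_M)

lemma P'_adj: "selfadj P'"
  using P Q_adj by (simp add: selfadj_def P'_def transpose_minus[of _ n n] ring_M)

lemma PP': "P * P' = P'" and P'P: "P' * P = P'" and P'E: "P' * E = 0\<^sub>m n n" and EP': "E * P' = 0\<^sub>m n n"
  and P'Q: "P' * Q = 0\<^sub>m n n"
  unfolding P'_def by (simp_all add: ring_M PP PQ QP PE EP QE EQ QQ)

text \<open>The decomposition \<open>P = Q + P'\<close> cuts \<open>x\<close> into corners, each of
  which vanishes for its own reason: complement to complement by the induction hypothesis, block to
  block by skewness, block to complement by the choice of \<open>a\<close>, and complement to block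
  by taking adjoints.\<close>

lemma regular_extension:
  assumes C': "selfadj C'" "P' * C' = C'" "C' * P' = C'"
    and IH: "\<And>x y. skewadj x \<Longrightarrow> y \<in> M \<Longrightarrow> x * A = A * x \<Longrightarrow> P' * x = x \<Longrightarrow> x * P' = x \<Longrightarrow> P' * y = y
      \<Longrightarrow> y * P' = y \<Longrightarrow> x * C' - C' * x = y * A - A * y \<Longrightarrow> x = 0\<^sub>m n n"
    and a: "\<And>X. X \<in> M \<Longrightarrow> a \<cdot>\<^sub>m X = hsum A C' d * X \<Longrightarrow> X = 0\<^sub>m n n"
    and x: "skewadj x" "x * A = A * x" "P * x = x" "x * P = x" and y: "y \<in> M" "P * y = y" "y * P = y"
    and eq: "x * (a \<cdot>\<^sub>m E + C') - (a \<cdot>\<^sub>m E + C') * x = y * A - A * y"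
  shows "x = 0\<^sub>m n n"
proof -
  have M [simp]: "x \<in> M" "y \<in> M" "C' \<in> M" using x(1) y(1) C'(1) by auto
  let ?C = "a \<cdot>\<^sub>m E + C'"
  have CM [simp]: "?C \<in> M" by simp
  have P'a: "P' * (P' * X) = P' * X" "E * (P' * X) = 0\<^sub>m n n" "P' * (E * X) = 0\<^sub>m n n"
    "P' * (C' * X) = C' * X" "C' * (P' * X) = C' * X" if "X \<in> M" for X
    using that P'P' EP' P'E C' by (simp_all flip: ring_M(1))
  have P'C: "P' * ?C = C'" "?C * P' = C'"
    by (simp_all add: ring_M mult_smult_distrib[of _ n n _ n] mult_smult_assoc_mat[of _ n n _ n] EP' P'E C')
  \<comment> \<open>Compressing the equation by \<open>P'\<close> on both sides reproduces it with
    \<open>C'\<close> in place of \<open>C\<close>, since \<open>P'\<close> commutes with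
    \<open>A\<close> and annihilates \<open>E\<close>; the compressed \<open>x\<close> and
    \<open>y\<close> meet the induction hypothesis.\<close>
  have P'xP': "P' * x * P' = 0\<^sub>m n n"
  proof (rule IH)
    show "skewadj (P' * x * P')"
    proof -
      have "transpose_mat (P' * x * P') * G = G * (P' * ((- x) * P'))"
        using P'_adj by (intro adj_mult skewadj_adj x mult_M) (auto simp: selfadj_def)
      also have "P' * ((- x) * P') = - (P' * x * P')"
        by (simp add: ring_M carrier_matD[OF P'M] carrier_matD[OF M(1)])
      finally show ?thesis by (simp add: skewadj_def carrier_matD[OF P'M] carrier_matD[OF G_M])
    qed
    have c: "x * (A * X) = A * (x * X)" "P' * (A * X) = A * (P' * X)" if "X \<in> M" for X
      using that x(2) P'A by (simp_all flip: ring_M(1))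
    show "(P' * x * P') * A = A * (P' * x * P')" by (simp add: ring_M P'A c)
    show "P' * (P' * x * P') = P' * x * P'" "P' * x * P' * P' = P' * x * P'"
      "P' * (P' * y * P') = P' * y * P'" "P' * y * P' * P' = P' * y * P'"
      using P'P' by (simp_all add: ring_M P'a)
    have "P' * (x * ?C - ?C * x) * P' = P' * x * (?C * P') - (P' * ?C) * x * P'"
      by (simp add: ring_M)
    also have "\<dots> = P' * x * P' * C' - C' * (P' * x * P')"
      unfolding P'C using C' by (simp add: ring_M P'a)
    finally have 1: "P' * (x * ?C - ?C * x) * P' = P' * x * P' * C' - C' * (P' * x * P')" .
    have "P' * (y * A - A * y) * P' = P' * y * (A * P') - (P' * A) * y * P'"
      by (simp add: ring_M)
    also have "\<dots> = P' * y * P' * A - A * (P' * y * P')"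
      by (simp add: ring_M P'A c)
    finally show "P' * x * P' * C' - C' * (P' * x * P') = P' * y * P' * A - A * (P' * y * P')"
      using 1 eq by simp
  qed simp_all
  have skew_Ax: "skewadj (A ^\<^sub>m k * x)" for k
  proof -
    have "transpose_mat (A ^\<^sub>m k * x) * G = G * ((- x) * A ^\<^sub>m k)"
      using selfadj_pow[OF A, of k] by (intro adj_mult skewadj_adj x) (auto simp: selfadj_def)
    also have "(- x) * A ^\<^sub>m k = - (A ^\<^sub>m k * x)"
      using pow_commute[OF AM M(1) x(2), of k] by (simp add: carrier_matD[OF AM] carrier_matD[OF M(1)])
    finally show ?thesis by (simp add: skewadj_def carrier_matD[OF AM] carrier_matD[OF G_M])
  qed
  \<comment> \<open>Each summand contains \<open>E * (A^s x) * E\<close>, which is zero because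
    \<open>A^s x\<close> is skew. For \<open>k = d\<close> the result is
    \<open>Q * x * E = 0\<close>.\<close>
  have hxE: "hsum A E k * (x * E) = 0\<^sub>m n n" for k
  proof (induction k)
    case 0 then show ?case using ExE[OF x(1)] by (simp add: ring_M)
  next
    case (Suc k)
    have "hsum A E (Suc k) * (x * E) = A * (hsum A E k * (x * E)) + E * (A ^\<^sub>m Suc k * x) * E"
      by (simp add: ring_M del: pow_mat.simps)
    then show ?case unfolding Suc ExE[OF skew_Ax] by simp
  qed
  define H where "H = hsum A C' d"
  have HM [simp]: "H \<in> M" by (simp add: H_def)
  have hC: "hsum A ?C d = a \<cdot>\<^sub>m Q + H" by (simp add: hsum_add hsum_smult Q_def H_def)
  have HP': "H * P' = H" and P'H: "P' * H = H"
    using hsum_mult_right[OF AM M(3) P'M P'A, of d] hsum_mult_left[OF AM M(3) P'M P'A, of d] C'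
    by (simp_all add: H_def)
  have HE: "H * E = 0\<^sub>m n n" using ring_M(1)[OF HM P'M EM] HP' P'E by simp
  \<comment> \<open>Averaging eliminates \<open>y\<close>: on the right-hand side the sum telescopes
    to powers \<open>A^(d+1)\<close> next to \<open>y\<close>, which is supported on the image of
    \<open>P\<close>. On the left, \<open>x\<close> commutes with \<open>A\<close> and leaves the
    sum, so \<open>x\<close> commutes with the average of \<open>C\<close>.\<close>
  have "hsum A (x * ?C - ?C * x) d = hsum A y d * A - A * hsum A y d"
    unfolding eq using hsum_mult_right[OF AM y(1) AM, of d] hsum_mult_left[OF AM y(1) AM, of d]
    by (simp add: hsum_minus)
  also have "\<dots> = 0\<^sub>m n n"
    using diff_zero_imp_eq[of "A * hsum A y d" "hsum A y d * A"] hsum_telescope[OF AM y(1), of d]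
      top_left[OF y(1,2)] top_right[OF y(1,3)] by (simp del: pow_mat.simps)
  finally have "x * (a \<cdot>\<^sub>m Q + H) - (a \<cdot>\<^sub>m Q + H) * x = 0\<^sub>m n n"
    using hsum_mult_right[OF AM CM M(1) x(2), of d] hsum_mult_left[OF AM CM M(1) x(2), of d]
    by (simp add: hsum_minus hC)
  then have "x * (a \<cdot>\<^sub>m Q + H) = (a \<cdot>\<^sub>m Q + H) * x" by (rule diff_zero_imp_eq[rotated 2]) simp_all
  \<comment> \<open>The commutation is now read in the corner from \<open>w\<close> to the
    complement: \<open>E\<close> on the right selects the eigenvalue \<open>a\<close> of the block,
    \<open>P'\<close> on the left selects \<open>H\<close>.\<close>
  then have "P' * (x * (a \<cdot>\<^sub>m Q + H)) * E = P' * ((a \<cdot>\<^sub>m Q + H) * x) * E" by simp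
  also have "P' * (x * (a \<cdot>\<^sub>m Q + H)) * E = a \<cdot>\<^sub>m (P' * x * E)"
    by (simp add: ring_M mult_smult_distrib[of _ n n _ n] mult_smult_assoc_mat[of _ n n _ n] QE HE)
  also have "P' * ((a \<cdot>\<^sub>m Q + H) * x) * E = (P' * (a \<cdot>\<^sub>m Q + H)) * x * E"
    by (simp add: ring_M)
  also have "P' * (a \<cdot>\<^sub>m Q + H) = H * P'"
    by (simp add: ring_M mult_smult_distrib[of _ n n _ n] P'Q P'H HP')
  also have "H * P' * x * E = H * (P' * x * E)" by (simp add: ring_M)
  finally have P'xE: "P' * x * E = 0\<^sub>m n n" by (intro a) (simp_all add: H_def)
  have "P' * x * E = x * E - Q * (x * E)" unfolding P'_def using x(3) by (simp add: ring_M flip: ring_M(1))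
  then have xE: "x * E = 0\<^sub>m n n" using P'xE hxE[of d] diff_zero_imp_eq[of "x * E" "0\<^sub>m n n"] unfolding Q_def by simp
  have xQ: "x * Q = 0\<^sub>m n n"
    using hsum_mult_left[OF AM EM M(1) x(2), of d] by (simp add: xE Q_def hsum_zero)
  \<comment> \<open>The adjoint of \<open>x * Q\<close> is \<open>- (Q * x)\<close>, so killing the
    block also forces the image of \<open>x\<close> to be orthogonal to it.\<close>
  have "transpose_mat (x * Q) * G = G * (Q * (- x))"
    using Q_adj by (intro adj_mult skewadj_adj x) (auto simp: selfadj_def)
  then have "G * (- (Q * x)) = 0\<^sub>m n n" unfolding xQ by (simp add: carrier_matD[OF QM] carrier_matD[OF M(1)])
  then have "- (Q * x) = 0\<^sub>m n n" by (rule G_cancel[rotated]) simp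
  then have "- (- (Q * x)) = 0\<^sub>m n n" by (auto intro!: eq_matI)
  then have Qx: "Q * x = 0\<^sub>m n n" unfolding uminus_uminus_mat .
  have "P' * x = x" "x * P' = x" unfolding P'_def using x(3,4) Qx xQ by (simp_all add: ring_M)
  then show ?thesis using P'xP' by simp
qed

end

context symmetric_form begin

text \<open>The statement is relative to \<open>P\<close> so that the complement of a block is an
  instance with the same \<open>A\<close> and the same form; the induction is on the rank of
  \<open>P\<close>, and the case of interest is \<open>P = 1\<close>. Commutation with
  \<open>A\<close> stands for annihilating the nilpotent vector, the bracket equation for landing in
  its tangent space.\<close>

lemma generic_selfadj:
  assumes A: "selfadj A" and P: "selfadj P" "P * P = P" "P * A = A * P" and nil: "A ^\<^sub>m N * P = 0\<^sub>m n n"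
  shows "\<exists>C. selfadj C \<and> P * C = C \<and> C * P = C \<and>
    (\<forall>x y. skewadj x \<longrightarrow> y \<in> M \<longrightarrow> x * A = A * x \<longrightarrow> P * x = x \<longrightarrow> x * P = x \<longrightarrow> P * y = y \<longrightarrow> y * P = y
      \<longrightarrow> x * C - C * x = y * A - A * y \<longrightarrow> x = 0\<^sub>m n n)"
  using P nil
proof (induction "fixed_rank P" arbitrary: P rule: less_induct)
  case less
  have AM: "A \<in> M" and PM: "P \<in> M" using A less.prems by auto
  show ?case
  proof (cases "P = 0\<^sub>m n n")
    case True
    have "x = 0\<^sub>m n n" if "skewadj x" "P * x = x" for x using that True zero_M(1)[of x] by simp
    moreover have "selfadj (0\<^sub>m n n)" by (simp add: selfadj_def carrier_matD[OF G_M])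
    ultimately show ?thesis using True by (intro exI[of _ "0\<^sub>m n n"]) simp
  next
    case False
    from exists_block[OF A less.prems False] obtain E d where E0: "E \<noteq> 0\<^sub>m n n" and
      EF: "E \<in> M" "selfadj E" "P * E = E" "E * P = E" "\<And>s. E * A ^\<^sub>m s * E = (if s = d then E else 0\<^sub>m n n)"
       "\<And>x. skewadj x \<Longrightarrow> E * x * E = 0\<^sub>m n n" "A ^\<^sub>m Suc d * P = 0\<^sub>m n n" by blast
    interpret nilpotent_block n G A P E d
      by unfold_locales (use A less.prems EF in auto)
    have "fixed_rank P' < fixed_rank P" by (rule fixed_rank_less[OF PM P'M PP' EM PE P'E E0])
    moreover have "A ^\<^sub>m N * P' = 0\<^sub>m n n"
      using ring_M(1)[OF pow_M[OF AM, of N] PM P'M] less.prems(4) PP' by simp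
    ultimately obtain C' where C': "selfadj C'" "P' * C' = C'" "C' * P' = C'"
      "\<And>x y. skewadj x \<Longrightarrow> y \<in> M \<Longrightarrow> x * A = A * x \<Longrightarrow> P' * x = x \<Longrightarrow> x * P' = x \<Longrightarrow> P' * y = y
      \<Longrightarrow> y * P' = y \<Longrightarrow> x * C' - C' * x = y * A - A * y \<Longrightarrow> x = 0\<^sub>m n n"
      using less.hyps[of P'] P'_adj P'P' P'A by blast
    have C'M: "C' \<in> M" using C' by simp
    \<comment> \<open>The solution \<open>C'\<close> on the complement is fixed before
      \<open>a\<close>, so only finitely many values have to be avoided.\<close>
    obtain a where a: "\<And>X. X \<in> M \<Longrightarrow> a \<cdot>\<^sub>m X = hsum A C' d * X \<Longrightarrow> X = 0\<^sub>m n n"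
      using ex_non_eigenvalue[OF hsum_M[OF AM C'M], of d] infinite_UNIV_char_0 by blast
    define C where "C = a \<cdot>\<^sub>m E + C'"
    have "transpose_mat (a \<cdot>\<^sub>m E) = a \<cdot>\<^sub>m transpose_mat E" by (rule eq_matI) auto
    then have "selfadj C" using C'(1) E 
      by (simp add: C_def selfadj_def transpose_add[of _ n n] ring_M mult_smult_distrib[of _ n n _ n] mult_smult_assoc_mat[of _ n n _ n])
    moreover have "P * C' = C'" "C' * P = C'"
      using ring_M(1)[OF PM P'M C'M] ring_M(1)[OF C'M P'M PM] C'(2,3) PP' P'P by simp_all
    then have "P * C = C" "C * P = C" using EM PE EP PM C'M
      by (simp_all add: C_def ring_M mult_smult_distrib[of _ n n _ n] mult_smult_assoc_mat[of _ n n _ n])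
    moreover have "x = 0\<^sub>m n n" if "skewadj x" "y \<in> M" "x * A = A * x" "P * x = x" "x * P = x" "P * y = y" "y * P = y"
      "x * C - C * x = y * A - A * y" for x y
      by (rule regular_extension[OF C' a that(1,3,4,5,2,6,7) that(8)[unfolded C_def]])
    ultimately show ?thesis by (intro exI[of _ C]) (simp; blast)
  qed
qed

end

text \<open>Comparing coefficients in \<open>(X - A) adj (X - A) = X\<^sup>n\<close> from the top down shows that the coefficient
  of \<open>X\<^bsup>n-1-i\<^esup>\<close> in the adjugate is \<open>A\<^sup>i\<close>.\<close>

lemma nilpotent_if_char_poly_eq_monom:
  fixes A :: "'a::field mat"
  assumes A: "A \<in> carrier_mat n n" and cp: "char_poly A = monom 1 n"
  shows "A ^\<^sub>m n = 0\<^sub>m n n"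
proof -
  interpret square_matrices n "TYPE('a)" .
  let ?X = "char_poly_matrix A"
  have X: "?X \<in> carrier_mat n n" using A by (simp add: char_poly_matrix_def)
  define adj where "adj = adj_mat ?X"
  have adj: "adj \<in> carrier_mat n n" "?X * adj = monom 1 n \<cdot>\<^sub>m 1\<^sub>m n"
    using adj_mat(1,2)[OF X] cp unfolding adj_def char_poly_def by auto
  \<comment> \<open>The adjugate is viewed as a polynomial with matrix coefficients
    \<open>B k\<close>. The coefficient of X^k in (X - A) adj = X^n relates \<open>B (k - 1)\<close>
    to \<open>A * B k\<close>; the identity matrix enters only at \<open>k = n\<close>.\<close>
  define B where "B k = mat n n (\<lambda>(i, j). coeff (adj $$ (i, j)) k)" for k
  have BM [simp]: "B k \<in> M" for k by (simp add: B_def)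
  have eqs: "(if k = 0 then 0 else B (k - 1) $$ (i, j)) = (A * B k) $$ (i, j) + (if k = n \<and> i = j then 1 else 0)"
    if ij: "i < n" "j < n" for i j k
  proof -
    have "(?X * adj) $$ (i, j) = (\<Sum>l<n. ?X $$ (i, l) * adj $$ (l, j))"
      using X adj(1) ij by (simp add: scalar_prod_def atLeast0LessThan)
    also have "\<dots> = (\<Sum>l<n. (if l = i then [:0, 1:] * adj $$ (i, j) else 0) - Polynomial.smult (A $$ (i, l)) (adj $$ (l, j)))"
      using ij A by (intro sum.cong) (auto simp: char_poly_matrix_def algebra_simps)
    also have "\<dots> = pCons 0 (adj $$ (i, j)) - (\<Sum>l<n. Polynomial.smult (A $$ (i, l)) (adj $$ (l, j)))"
      using ij by (simp add: sum_subtractf)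
    finally have "coeff ((?X * adj) $$ (i, j)) k = coeff (pCons 0 (adj $$ (i, j))) k
      - (\<Sum>l<n. A $$ (i, l) * coeff (adj $$ (l, j)) k)"
      by (simp add: coeff_sum)
    moreover have "(\<Sum>l<n. A $$ (i, l) * coeff (adj $$ (l, j)) k) = (A * B k) $$ (i, j)"
      using A ij by (simp add: scalar_prod_def B_def atLeast0LessThan)
    moreover have "coeff ((?X * adj) $$ (i, j)) k = (if k = n \<and> i = j then 1 else 0)"
      unfolding adj(2) using ij by simp
    moreover have "coeff (pCons 0 (adj $$ (i, j))) k = (if k = 0 then 0 else B (k - 1) $$ (i, j))"
      using ij by (simp add: B_def coeff_pCons split: nat.split)
    ultimately show ?thesis by simp
  qed
  have rec: "B k = A * B (Suc k) + (if Suc k = n then 1\<^sub>m n else 0\<^sub>m n n)" for k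
    using eqs[of _ _ "Suc k"] A by (intro eq_matI) (auto simp del: index_mult_mat(1) simp: B_def[of k])
  \<comment> \<open>Large enough to exceed \<open>n\<close> and all degrees in the adjugate, so that
    \<open>B K = 0\<close> starts the recursion, which runs unperturbed down to index
    \<open>n\<close>.\<close>
  define K where "K = Suc (Max {degree (adj $$ (i, j)) | i j. i < n \<and> j < n} + n)"
  have fin: "finite {degree (adj $$ (i, j)) | i j. i < n \<and> j < n}"
    using finite_image_set2[of "\<lambda>i. i < n" "\<lambda>j. j < n" "\<lambda>i j. degree (adj $$ (i, j))"] by simp
  have "B K = 0\<^sub>m n n"
  proof (rule eq_matI)
    fix i j assume "i < dim_row (0\<^sub>m n n)" "j < dim_col (0\<^sub>m n n)"
    then have ij: "i < n" "j < n" by auto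
    then have "degree (adj $$ (i, j)) \<le> Max {degree (adj $$ (i, j)) | i j. i < n \<and> j < n}"
      by (intro Max_ge[OF fin]) blast
    then have "degree (adj $$ (i, j)) < K" unfolding K_def by simp
    then show "B K $$ (i, j) = 0\<^sub>m n n $$ (i, j)" using ij by (simp add: B_def coeff_eq_0)
  qed (simp_all add: B_def)
  then have high: "B (K - i) = 0\<^sub>m n n" if "i \<le> K - n" for i
    using that
  proof (induction i)
    case (Suc i)
    then have "K - Suc i \<ge> n" "Suc (K - Suc i) = K - i" by (auto simp: K_def)
    then show ?case using rec[of "K - Suc i"] Suc A by (simp add: K_def)
  qed simp
  have Bn: "B n = 0\<^sub>m n n" using high[of "K - n"] by (simp add: K_def)
  have low: "B (n - Suc i) = A ^\<^sub>m i" if "i < n" for i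
    using that
  proof (induction i)
    case 0 then show ?case using rec[of "n - 1"] Bn A by simp
  next
    case (Suc i)
    then have "n - Suc i \<noteq> n" by simp
    with Suc have "B (n - Suc (Suc i)) = A * B (n - Suc i)" using rec[of "n - Suc (Suc i)"] A
      by (simp add: Suc_diff_Suc)
    then show ?case using Suc pow_Suc_left[OF A] by simp
  qed
  show ?thesis
  proof (cases n)
    case 0 then show ?thesis using A by (intro eq_matI) auto
  next
    case (Suc m)
    \<comment> \<open>The constant coefficient closes the recursion: \<open>A * B 0 = 0\<close>, and
      \<open>B 0\<close> has been identified with \<open>A^(n-1)\<close>.\<close>
    have "A * B 0 = 0\<^sub>m n n"
      using eqs[of _ _ 0] A Suc by (intro eq_matI) (auto simp del: index_mult_mat(1) simp: carrier_matD[OF BM])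
    then show ?thesis using low[of m] pow_Suc_left[OF A, of m] Suc by simp
  qed
qed

section \<open>From self-adjoint operators back to symmetric matrices\<close>

context symmetric_form begin

text \<open>Right multiplication by \<open>G\<close> carries symmetric matrices to self-adjoint
  ones, with inverse right multiplication by \<open>H\<close>. For skew-adjoint \<open>X\<close> it
  turns \<open>X * Z + Z * transpose_mat X\<close> into the commutator of \<open>X\<close> and
  \<open>Z * G\<close>, so \<open>T = C * H\<close> inherits the property of
  \<open>C\<close>.\<close>

lemma generic_symmetric:
  assumes H: "H \<in> M" "G * H = 1\<^sub>m n" "H * G = 1\<^sub>m n"
    and S: "S \<in> M" "transpose_mat S = S" and nil: "(S * G) ^\<^sub>m N = 0\<^sub>m n n"
  obtains T where "T \<in> M" "transpose_mat T = T"
    "\<And>X Y. skewadj X \<Longrightarrow> skewadj Y \<Longrightarrow> X * S + S * transpose_mat X = 0\<^sub>m n n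
      \<Longrightarrow> X * T + T * transpose_mat X = Y * S + S * transpose_mat Y \<Longrightarrow> X = 0\<^sub>m n n"
proof -
  have SG: "selfadj (S * G)" unfolding selfadj_def using S G_sym
    by (simp add: transpose_mult[of _ n n _ n] ring_M)
  have one: "selfadj (1\<^sub>m n)" by (simp add: selfadj_def)
  have nil': "(S * G) ^\<^sub>m N * 1\<^sub>m n = 0\<^sub>m n n" using nil by simp
  from generic_selfadj[OF SG one _ _ nil'] S obtain C where C: "selfadj C"
    "\<And>x y. skewadj x \<Longrightarrow> y \<in> M \<Longrightarrow> x * (S * G) = S * G * x
        \<Longrightarrow> x * C - C * x = y * (S * G) - S * G * y \<Longrightarrow> x = 0\<^sub>m n n"
    by (auto simp: ring_M)
  have CM: "C \<in> M" "transpose_mat C * G = G * C" using C(1) by (auto simp: selfadj_def)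
  define T where "T = C * H"
  have TM: "T \<in> M" using CM H by (simp add: T_def)
  have TG: "T * G = C" using CM H by (simp add: T_def ring_M)
  have HT: "transpose_mat H = H"
  proof -
    have "transpose_mat H = transpose_mat H * (G * H)" using H by simp
    also have "\<dots> = (transpose_mat H * G) * H" using H by (simp add: ring_M)
    also have "transpose_mat H * G = transpose_mat (G * H)" using H(1) G_sym by (simp add: transpose_mult[of _ n n _ n])
    finally show ?thesis using H by simp
  qed
  have "transpose_mat T = H * transpose_mat C" using CM H HT by (simp add: T_def transpose_mult[of _ n n _ n])
  also have "transpose_mat C = transpose_mat C * G * H" using CM(1) H by (simp add: ring_M)
  also have "\<dots> = G * C * H" unfolding CM(2) ..
  also have "H * (G * C * H) = (H * G) * (C * H)" using CM(1) H(1) by (simp add: ring_M)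
  finally have TT: "transpose_mat T = T" using CM H by (simp add: T_def)
  have comm: "(X * Z + Z * transpose_mat X) * G = X * (Z * G) - Z * G * X" if X: "skewadj X" and Z: "Z \<in> M" for X Z
  proof -
    have XM: "X \<in> M" using X by simp
    have "(X * Z + Z * transpose_mat X) * G = X * (Z * G) + Z * (transpose_mat X * G)"
      using XM Z by (simp add: ring_M)
    also have "Z * (transpose_mat X * G) = - (Z * G * X)"
      using X Z XM unfolding skewadj_def by (simp add: ring_M carrier_matD[OF G_M])
    finally show ?thesis using XM Z by (auto intro!: eq_matI simp del: index_mult_mat(1))
  qed
  have zero: "X = 0\<^sub>m n n" if sk: "skewadj X" "skewadj Y" and 0: "X * S + S * transpose_mat X = 0\<^sub>m n n"
    and e: "X * T + T * transpose_mat X = Y * S + S * transpose_mat Y" for X Y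
  proof (rule C(2)[OF sk(1) skewadj_M[OF sk(2)]])
    have XM: "X \<in> M" using sk by simp
    have "X * (S * G) - S * G * X = 0\<^sub>m n n" using comm[OF sk(1) S(1)] 0 by simp
    then have "X * (S * G) - S * G * X + S * G * X = S * G * X" using S XM by simp
    moreover have "P - R + R = P" if "P \<in> M" "R \<in> M" for P R :: "'k mat"
      using that by (auto intro!: eq_matI)
    ultimately show "X * (S * G) = S * G * X" using S XM by simp
    show "X * C - C * X = Y * (S * G) - S * G * Y"
      using comm[OF sk(1) TM] comm[OF sk(2) S(1)] e unfolding TG by simp
  qed
  show ?thesis by (rule that[OF TM TT zero])
qed

end

section \<open>Indices of dual modules\<close>

abbreviation kvs :: "('k::field, 'u, 'm) module_scheme \<Rightarrow> bool" where
  "kvs U \<equiv> vectorspace class_ring U"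

abbreviation fd :: "('k::field, 'u, 'm) module_scheme \<Rightarrow> bool" where
  "fd U \<equiv> vectorspace.fin_dim class_ring U"

abbreviation lhom :: "('k::field, 'u, 'm) module_scheme \<Rightarrow> ('k, 'w, 'n) module_scheme \<Rightarrow> ('u \<Rightarrow> 'w) set" where
  "lhom U W \<equiv> LinearCombinations.module_hom class_ring U W"

abbreviation subsp :: "'u set \<Rightarrow> ('k::field, 'u, 'm) module_scheme \<Rightarrow> bool" where
  "subsp S U \<equiv> VectorSpace.subspace class_ring S U"

lemma lhomI:
  assumes "\<And>u. u \<in> carrier U \<Longrightarrow> f u \<in> carrier W"
    and "\<And>u v. u \<in> carrier U \<Longrightarrow> v \<in> carrier U \<Longrightarrow> f (u \<oplus>\<^bsub>U\<^esub> v) = f u \<oplus>\<^bsub>W\<^esub> f v"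
    and "\<And>c u. u \<in> carrier U \<Longrightarrow> f (c \<odot>\<^bsub>U\<^esub> u) = c \<odot>\<^bsub>W\<^esub> f u"
  shows "f \<in> lhom U W"
  using assms by (auto simp: LinearCombinations.module_hom_def)

lemma lhomD:
  assumes "f \<in> lhom U W"
  shows "u \<in> carrier U \<Longrightarrow> f u \<in> carrier W"
    and "u \<in> carrier U \<Longrightarrow> v \<in> carrier U \<Longrightarrow> f (u \<oplus>\<^bsub>U\<^esub> v) = f u \<oplus>\<^bsub>W\<^esub> f v"
    and "u \<in> carrier U \<Longrightarrow> f (c \<odot>\<^bsub>U\<^esub> u) = c \<odot>\<^bsub>W\<^esub> f u"
  using assms by (auto simp: LinearCombinations.module_hom_def)

lemma linear_mapI: "kvs U \<Longrightarrow> kvs W \<Longrightarrow> f \<in> lhom U W \<Longrightarrow> linear_map class_ring U W f"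
  unfolding linear_map_def mod_hom_def mod_hom_axioms_def vectorspace_def by auto

lemma kvsI:
  fixes V :: "('k::field, 'v, 'm) module_scheme"
  assumes "\<zero>\<^bsub>V\<^esub> \<in> carrier V"
    and "\<And>v w. v \<in> carrier V \<Longrightarrow> w \<in> carrier V \<Longrightarrow> v \<oplus>\<^bsub>V\<^esub> w \<in> carrier V"
    and "\<And>c v. v \<in> carrier V \<Longrightarrow> c \<odot>\<^bsub>V\<^esub> v \<in> carrier V"
    and "\<And>v w. v \<in> carrier V \<Longrightarrow> w \<in> carrier V \<Longrightarrow> v \<oplus>\<^bsub>V\<^esub> w = w \<oplus>\<^bsub>V\<^esub> v"
    and "\<And>v w x. v \<in> carrier V \<Longrightarrow> w \<in> carrier V \<Longrightarrow> x \<in> carrier V \<Longrightarrow> v \<oplus>\<^bsub>V\<^esub> w \<oplus>\<^bsub>V\<^esub> x = v \<oplus>\<^bsub>V\<^esub> (w \<oplus>\<^bsub>V\<^esub> x)"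
    and "\<And>v. v \<in> carrier V \<Longrightarrow> v \<oplus>\<^bsub>V\<^esub> \<zero>\<^bsub>V\<^esub> = v"
    and "\<And>a b v. v \<in> carrier V \<Longrightarrow> (a * b) \<odot>\<^bsub>V\<^esub> v = a \<odot>\<^bsub>V\<^esub> (b \<odot>\<^bsub>V\<^esub> v)"
    and "\<And>v. v \<in> carrier V \<Longrightarrow> 1 \<odot>\<^bsub>V\<^esub> v = v"
    and "\<And>v. v \<in> carrier V \<Longrightarrow> 0 \<odot>\<^bsub>V\<^esub> v = \<zero>\<^bsub>V\<^esub>"
    and "\<And>a b v. v \<in> carrier V \<Longrightarrow> (a + b) \<odot>\<^bsub>V\<^esub> v = a \<odot>\<^bsub>V\<^esub> v \<oplus>\<^bsub>V\<^esub> b \<odot>\<^bsub>V\<^esub> v"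
    and "\<And>a v w. v \<in> carrier V \<Longrightarrow> w \<in> carrier V \<Longrightarrow> a \<odot>\<^bsub>V\<^esub> (v \<oplus>\<^bsub>V\<^esub> w) = a \<odot>\<^bsub>V\<^esub> v \<oplus>\<^bsub>V\<^esub> a \<odot>\<^bsub>V\<^esub> w"
  shows "kvs V"
proof (rule vs_criteria)
  show "\<forall>v\<in>carrier V. \<exists>neg_v\<in>carrier V. v \<oplus>\<^bsub>V\<^esub> neg_v = \<zero>\<^bsub>V\<^esub>"
  proof
    fix v assume v: "v \<in> carrier V"
    have "v \<oplus>\<^bsub>V\<^esub> (- 1) \<odot>\<^bsub>V\<^esub> v = (1 + - 1) \<odot>\<^bsub>V\<^esub> v" unfolding assms(10)[OF v] assms(8)[OF v] ..
    then show "\<exists>neg_v\<in>carrier V. v \<oplus>\<^bsub>V\<^esub> neg_v = \<zero>\<^bsub>V\<^esub>" using assms(3,9) v by auto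
  qed
qed (use assms in \<open>auto simp: class_field\<close>)

lemma subspI:
  assumes "kvs U" "S \<subseteq> carrier U" "\<zero>\<^bsub>U\<^esub> \<in> S" "\<And>u v. u \<in> S \<Longrightarrow> v \<in> S \<Longrightarrow> u \<oplus>\<^bsub>U\<^esub> v \<in> S"
    "\<And>c u. u \<in> S \<Longrightarrow> c \<odot>\<^bsub>U\<^esub> u \<in> S"
  shows "subsp S U"
  using assms unfolding VectorSpace.subspace_def submodule_def by (auto simp: vectorspace_def)

lemma subspD:
  assumes "subsp S U"
  shows "kvs U" "S \<subseteq> carrier U" "\<zero>\<^bsub>U\<^esub> \<in> S" "\<And>u v. u \<in> S \<Longrightarrow> v \<in> S \<Longrightarrow> u \<oplus>\<^bsub>U\<^esub> v \<in> S"
    "\<And>c u. u \<in> S \<Longrightarrow> c \<odot>\<^bsub>U\<^esub> u \<in> S"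
  using assms unfolding VectorSpace.subspace_def submodule_def by auto

lemma subsp_vs: "subsp S U \<Longrightarrow> kvs (U\<lparr>carrier := S\<rparr>)"
  using vectorspace.subspace_is_vs subspD(1) by blast

text \<open>Independent sets have independent images, which bounds their size by the dimension of
  the target; an independent set that is maximal then generates. Besides subspaces this covers a Lie
  algebra with an injective orbit map.\<close>

lemma inj_fin_dim:
  assumes f: "linear_map class_ring U W f" "inj_on f (carrier U)" and W: "fd W"
  shows "fd U"
proof -
  interpret linear_map class_ring U W f by fact
  have bound: "card A \<le> W.dim" if A: "finite A" "A \<subseteq> carrier U" "V.module.lin_indpt A" for A
  proof -
    have "W.module.lin_indpt (f ` A)"
    proof (rule W.module.finite_lin_indpt2)
      fix a assume "W.module.lincomb a (f ` A) = \<zero>\<^bsub>W\<^esub>"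
      then have "f (V.module.lincomb (a \<circ> f) A) = f \<zero>\<^bsub>U\<^esub>"
        using lincomb_linear_image[OF f(2) A(2) _ A(1), of a] by simp
      moreover have "V.module.lincomb (a \<circ> f) A \<in> carrier U" using A(2) by (intro V.module.lincomb_closed) auto
      ultimately have "V.module.lincomb (a \<circ> f) A = \<zero>\<^bsub>U\<^esub>" using f(2) by (meson V.module.M.zero_closed inj_onD)
      then have "(a \<circ> f) \<in> A \<rightarrow> {\<zero>\<^bsub>class_ring\<^esub>}"
        using V.not_lindepD[OF A(3,1) order_refl, of "a \<circ> f"] by simp
      then show "\<forall>v\<in>f ` A. a v = \<zero>\<^bsub>class_ring\<^esub>" by auto
    qed (use A in auto)
    then have "card (f ` A) \<le> W.dim" using W.li_le_dim(2)[OF W, of "f ` A"] A(2) by auto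
    then show ?thesis using card_image[of f A] inj_on_subset[OF f(2) A(2)] by simp
  qed
  have "finite A \<and> card A \<le> W.dim" if A: "A \<subseteq> carrier U \<and> V.module.lin_indpt A" for A
  proof (cases "finite A")
    case False
    then obtain B where "B \<subseteq> A" "finite B" "card B = Suc W.dim" using infinite_arbitrarily_large by blast
    then show ?thesis using bound[of B] A V.module.subset_li_is_li[of A B] by auto
  qed (use bound A in auto)
  moreover have "{} \<subseteq> carrier U \<and> V.module.lin_indpt {}" by (simp add: V.module.lin_dep_def)
  ultimately obtain A where A: "finite A" "maximal A (\<lambda>S. S \<subseteq> carrier U \<and> V.module.lin_indpt S)"
    using maximal_exists[of "\<lambda>S. S \<subseteq> carrier U \<and> V.module.lin_indpt S" W.dim "{}"] by blast
  then show ?thesis using V.max_li_is_gen[OF A(2)] unfolding V.fin_dim_def maximal_def by blast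
qed

lemma subsp_fd:
  assumes "subsp S U" "fd U"
  shows "fd (U\<lparr>carrier := S\<rparr>)"
proof (rule inj_fin_dim)
  show "linear_map class_ring (U\<lparr>carrier := S\<rparr>) U (\<lambda>x. x)"
    using assms(1) subspD[OF assms(1)] by (intro linear_mapI subsp_vs lhomI) auto
qed (use assms in auto)

lemma rank_nullity_image:
  assumes "kvs U" "kvs W" "f \<in> lhom U W" "fd U"
  shows "vdim (W\<lparr>carrier := f ` carrier U\<rparr>) + vdim (U\<lparr>carrier := {u \<in> carrier U. f u = \<zero>\<^bsub>W\<^esub>}\<rparr>) = vdim U"
proof -
  interpret linear_map class_ring U W f using assms by (intro linear_mapI)
  show ?thesis using rank_nullity[OF assms(4)] unfolding im_def ker_def by simp
qed

lemma hom_kernel_subsp: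
  assumes "kvs U" "kvs W" "f \<in> lhom U W"
  shows "subsp {u \<in> carrier U. f u = \<zero>\<^bsub>W\<^esub>} U"
proof -
  interpret linear_map class_ring U W f using assms by (intro linear_mapI)
  show ?thesis using kerT_is_subspace unfolding ker_def .
qed

lemma hom_image_subsp:
  assumes "kvs U" "kvs W" "f \<in> lhom U W"
  shows "subsp (f ` carrier U) W"
proof -
  interpret linear_map class_ring U W f using assms by (intro linear_mapI)
  show ?thesis using imT_is_subspace unfolding im_def .
qed

lemma vdim_inj_image:
  assumes "kvs U" "kvs W" "f \<in> lhom U W" "fd U" "inj_on f (carrier U)"
  shows "vdim (W\<lparr>carrier := f ` carrier U\<rparr>) = vdim U"
proof -
  interpret linear_map class_ring U W f using assms by (intro linear_mapI)
  show ?thesis using rank_nullity[OF assms(4)] inj_imp_dim_ker0[OF assms(5)] unfolding im_def by simp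
qed

lemma surj_fd:
  assumes "kvs U" "kvs W" "f \<in> lhom U W" "fd U" "f ` carrier U = carrier W"
  shows "fd W"
proof -
  interpret linear_map class_ring U W f using assms by (intro linear_mapI)
  show ?thesis using surj_fin_dim[OF assms(4,5)] .
qed

lemma inj_onI_kernel:
  assumes "kvs U" "kvs W" "f \<in> lhom U W" "\<And>u. u \<in> carrier U \<Longrightarrow> f u = \<zero>\<^bsub>W\<^esub> \<Longrightarrow> u = \<zero>\<^bsub>U\<^esub>"
  shows "inj_on f (carrier U)"
proof -
  interpret linear_map class_ring U W f using assms by (intro linear_mapI)
  show ?thesis by (rule Ke0_imp_inj) (use assms(4) in \<open>auto simp: ker_def\<close>)
qed

section \<open>Spaces of linear maps, duals and biduals\<close>

definition hom_space :: "('k::field, 'u, 'm) module_scheme \<Rightarrow> ('k, 'w, 'n) module_scheme \<Rightarrow> ('k, 'u \<Rightarrow> 'w) module" where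
  "hom_space U W = \<lparr>carrier = lhom U W \<inter> extensional (carrier U), mult = (\<lambda>_ _. \<lambda>u\<in>carrier U. \<zero>\<^bsub>W\<^esub>),
     one = (\<lambda>u\<in>carrier U. \<zero>\<^bsub>W\<^esub>), zero = (\<lambda>u\<in>carrier U. \<zero>\<^bsub>W\<^esub>),
     add = (\<lambda>f g. \<lambda>u\<in>carrier U. f u \<oplus>\<^bsub>W\<^esub> g u), smult = (\<lambda>c f. \<lambda>u\<in>carrier U. c \<odot>\<^bsub>W\<^esub> f u)\<rparr>"

lemma hom_space_simps [simp]:
  "carrier (hom_space U W) = lhom U W \<inter> extensional (carrier U)"
  "\<zero>\<^bsub>hom_space U W\<^esub> = (\<lambda>u\<in>carrier U. \<zero>\<^bsub>W\<^esub>)"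
  "f \<oplus>\<^bsub>hom_space U W\<^esub> g = (\<lambda>u\<in>carrier U. f u \<oplus>\<^bsub>W\<^esub> g u)"
  "c \<odot>\<^bsub>hom_space U W\<^esub> f = (\<lambda>u\<in>carrier U. c \<odot>\<^bsub>W\<^esub> f u)"
  by (simp_all add: hom_space_def)

lemma kvs_closed:
  assumes "kvs U"
  shows "\<zero>\<^bsub>U\<^esub> \<in> carrier U" "u \<in> carrier U \<Longrightarrow> v \<in> carrier U \<Longrightarrow> u \<oplus>\<^bsub>U\<^esub> v \<in> carrier U"
    "u \<in> carrier U \<Longrightarrow> c \<odot>\<^bsub>U\<^esub> u \<in> carrier U"
proof -
  interpret vectorspace class_ring U by fact
  show "\<zero>\<^bsub>U\<^esub> \<in> carrier U" "u \<in> carrier U \<Longrightarrow> v \<in> carrier U \<Longrightarrow> u \<oplus>\<^bsub>U\<^esub> v \<in> carrier U"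
    "u \<in> carrier U \<Longrightarrow> c \<odot>\<^bsub>U\<^esub> u \<in> carrier U" by (auto intro: module.smult_closed)
qed

lemma lhom_zero: "kvs U \<Longrightarrow> kvs W \<Longrightarrow> f \<in> lhom U W \<Longrightarrow> f \<zero>\<^bsub>U\<^esub> = \<zero>\<^bsub>W\<^esub>"
proof -
  assume a: "kvs U" "kvs W" "f \<in> lhom U W"
  interpret linear_map class_ring U W f using a by (intro linear_mapI)
  show ?thesis by simp
qed

lemma hom_space_vs:
  assumes U: "kvs U" and W: "kvs W"
  shows "kvs (hom_space U W)"
proof -
  interpret U: vectorspace class_ring U by fact
  interpret W: vectorspace class_ring W by fact
  have W_smult: "c \<odot>\<^bsub>W\<^esub> w \<in> carrier W" if "w \<in> carrier W" for c w using kvs_closed[OF W] that by blast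
  have ring: "(a * b) \<odot>\<^bsub>W\<^esub> w = a \<odot>\<^bsub>W\<^esub> (b \<odot>\<^bsub>W\<^esub> w)" "(a + b) \<odot>\<^bsub>W\<^esub> w = a \<odot>\<^bsub>W\<^esub> w \<oplus>\<^bsub>W\<^esub> b \<odot>\<^bsub>W\<^esub> w"
     "1 \<odot>\<^bsub>W\<^esub> w = w" "0 \<odot>\<^bsub>W\<^esub> w = \<zero>\<^bsub>W\<^esub>" "c \<odot>\<^bsub>W\<^esub> \<zero>\<^bsub>W\<^esub> = \<zero>\<^bsub>W\<^esub>" if "w \<in> carrier W" for a b c w
    using that W.smult_assoc1[of a b w] W.smult_l_distr[of a b w] W.smult_one[of w] W.lmult_0[of w] W.rmult_0[of c] by simp_all
  have dist: "c \<odot>\<^bsub>W\<^esub> (v \<oplus>\<^bsub>W\<^esub> w) = c \<odot>\<^bsub>W\<^esub> v \<oplus>\<^bsub>W\<^esub> c \<odot>\<^bsub>W\<^esub> w" if "v \<in> carrier W" "w \<in> carrier W" for c v w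
    using that W.smult_r_distr[of c v w] by simp
  note Ucl = kvs_closed[OF U]
  show ?thesis
  proof (rule kvsI, unfold hom_space_simps)
    show "(\<lambda>u\<in>carrier U. \<zero>\<^bsub>W\<^esub>) \<in> lhom U W \<inter> extensional (carrier U)"
      using Ucl ring(5) by (auto intro!: lhomI)
    fix f g h :: "_ \<Rightarrow> _" and a b
    assume f: "f \<in> lhom U W \<inter> extensional (carrier U)"
    then have fh: "f \<in> lhom U W" and fe: "f \<in> extensional (carrier U)" by auto
    note F = lhomD[OF fh]
    show "(\<lambda>u\<in>carrier U. a \<odot>\<^bsub>W\<^esub> f u) \<in> lhom U W \<inter> extensional (carrier U)"
      using Ucl F W_smult dist by (auto intro!: lhomI simp flip: ring(1) simp: mult.commute)
    show "(\<lambda>u\<in>carrier U. f u \<oplus>\<^bsub>W\<^esub> (\<lambda>u\<in>carrier U. \<zero>\<^bsub>W\<^esub>) u) = f"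
      "(\<lambda>u\<in>carrier U. (a * b) \<odot>\<^bsub>W\<^esub> f u) = (\<lambda>u\<in>carrier U. a \<odot>\<^bsub>W\<^esub> (\<lambda>u\<in>carrier U. b \<odot>\<^bsub>W\<^esub> f u) u)"
      "(\<lambda>u\<in>carrier U. 1 \<odot>\<^bsub>W\<^esub> f u) = f" "(\<lambda>u\<in>carrier U. 0 \<odot>\<^bsub>W\<^esub> f u) = (\<lambda>u\<in>carrier U. \<zero>\<^bsub>W\<^esub>)"
      "(\<lambda>u\<in>carrier U. (a + b) \<odot>\<^bsub>W\<^esub> f u) =
        (\<lambda>u\<in>carrier U. (\<lambda>u\<in>carrier U. a \<odot>\<^bsub>W\<^esub> f u) u \<oplus>\<^bsub>W\<^esub> (\<lambda>u\<in>carrier U. b \<odot>\<^bsub>W\<^esub> f u) u)"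
      using fe by (auto simp: fun_eq_iff F ring extensional_def)
    assume g: "g \<in> lhom U W \<inter> extensional (carrier U)"
    then have gh: "g \<in> lhom U W" by auto
    note G = lhomD[OF gh]
    show "(\<lambda>u\<in>carrier U. f u \<oplus>\<^bsub>W\<^esub> g u) \<in> lhom U W \<inter> extensional (carrier U)"
      using Ucl W_smult by (auto intro!: lhomI simp: F G W.a_ac dist)
    show "(\<lambda>u\<in>carrier U. f u \<oplus>\<^bsub>W\<^esub> g u) = (\<lambda>u\<in>carrier U. g u \<oplus>\<^bsub>W\<^esub> f u)"
      "(\<lambda>u\<in>carrier U. a \<odot>\<^bsub>W\<^esub> (\<lambda>u\<in>carrier U. f u \<oplus>\<^bsub>W\<^esub> g u) u) =
        (\<lambda>u\<in>carrier U. (\<lambda>u\<in>carrier U. a \<odot>\<^bsub>W\<^esub> f u) u \<oplus>\<^bsub>W\<^esub> (\<lambda>u\<in>carrier U. a \<odot>\<^bsub>W\<^esub> g u) u)"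
      by (auto simp: fun_eq_iff F G W.a_comm dist)
    assume "h \<in> lhom U W \<inter> extensional (carrier U)"
    then have "h \<in> lhom U W" by auto
    note H = lhomD[OF this]
    show "(\<lambda>u\<in>carrier U. (\<lambda>u\<in>carrier U. f u \<oplus>\<^bsub>W\<^esub> g u) u \<oplus>\<^bsub>W\<^esub> h u) =
        (\<lambda>u\<in>carrier U. f u \<oplus>\<^bsub>W\<^esub> (\<lambda>u\<in>carrier U. g u \<oplus>\<^bsub>W\<^esub> h u) u)"
      by (auto simp: fun_eq_iff F G H W.a_assoc)
  qed
qed

lemma ground_space_simps [simp]:
  "carrier ground_space = UNIV" "\<zero>\<^bsub>ground_space\<^esub> = 0" "a \<oplus>\<^bsub>ground_space\<^esub> b = a + b" "a \<odot>\<^bsub>ground_space\<^esub> b = a * b"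
  by (simp_all add: ground_space_def)

lemma ground_space_vs: "kvs (ground_space :: ('k::field, 'k) module)"
  by (rule kvsI) (auto simp: algebra_simps)

text \<open>The dual space and the ambient space of the Lie algebra are both instances of the same
  construction, so the vector space axioms are verified once.\<close>

lemma dual_space_eq: "dual_space U = hom_space U ground_space"
  by (simp add: dual_space_def hom_space_def class_ring.func_space_def fun_eq_iff)

lemma dual_space_vs: "kvs U \<Longrightarrow> kvs (dual_space U)"
  unfolding dual_space_eq by (intro hom_space_vs ground_space_vs)

lemma lhom_finsum:
  assumes "kvs U" "kvs W" "f \<in> lhom U W" "finite A" "g \<in> A \<rightarrow> carrier U"
  shows "f (\<Oplus>\<^bsub>U\<^esub>a\<in>A. g a) = (\<Oplus>\<^bsub>W\<^esub>a\<in>A. f (g a))"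
proof -
  interpret U: vectorspace class_ring U by fact
  interpret W: vectorspace class_ring W by fact
  from assms(4,5) show ?thesis
  proof (induction A rule: finite_induct)
    case empty then show ?case using lhom_zero[OF assms(1-3)] by simp
  next
    case (insert a A)
    then have g: "g a \<in> carrier U" "g \<in> A \<rightarrow> carrier U" by auto
    then have "(\<Oplus>\<^bsub>U\<^esub>a\<in>A. g a) \<in> carrier U" by simp
    moreover have "(\<lambda>a. f (g a)) \<in> insert a A \<rightarrow> carrier W" using insert.prems lhomD(1)[OF assms(3)] by auto
    ultimately show ?case using insert g by (simp add: lhomD(2)[OF assms(3)])
  qed
qed

lemma ground_space_finsum:
  fixes g :: "'a \<Rightarrow> 'k::field"
  assumes "finite A"
  shows "finsum ground_space g A = sum g A"
proof -
  interpret vectorspace class_ring "ground_space :: ('k, 'k) module" by (rule ground_space_vs)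
  from assms show ?thesis by (induction A rule: finite_induct) simp_all
qed

lemma dual_finsum:
  assumes "kvs U" "\<psi> \<in> lhom U ground_space" "finite A" "g \<in> A \<rightarrow> carrier U"
  shows "\<psi> (\<Oplus>\<^bsub>U\<^esub>a\<in>A. g a) = (\<Sum>a\<in>A. \<psi> (g a))"
  using lhom_finsum[OF assms(1) ground_space_vs assms(2-4)] assms(3) by (simp add: ground_space_finsum)

text \<open>A basis together with its dual basis: \<open>\<phi> b\<close> extracts the coefficient
  of \<open>b\<close>, and uniqueness of coefficients makes it linear. All later arguments with
  bases go through these functionals.\<close>

lemma coordinates:
  fixes U :: "('k::field, 'u, 'm) module_scheme"
  assumes U: "kvs U" and fd: "fd U"
  obtains \<beta> \<phi> where "finite \<beta>" "\<beta> \<subseteq> carrier U" "\<And>b. b \<in> \<beta> \<Longrightarrow> \<phi> b \<in> lhom U ground_space"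
    "\<And>b. b \<in> \<beta> \<Longrightarrow> \<phi> b \<in> extensional (carrier U)"
    "\<And>b c. b \<in> \<beta> \<Longrightarrow> c \<in> \<beta> \<Longrightarrow> \<phi> b c = (if b = c then 1 else 0)"
    "\<And>u. u \<in> carrier U \<Longrightarrow> (\<Oplus>\<^bsub>U\<^esub>b\<in>\<beta>. \<phi> b u \<odot>\<^bsub>U\<^esub> b) = u"
proof -
  interpret vectorspace class_ring U by fact
  obtain \<beta> where \<beta>: "finite \<beta>" "basis \<beta>" using finite_basis_exists[OF fd] by blast
  then have sub: "\<beta> \<subseteq> carrier U" by (simp add: basis_def)
  let ?A = "\<beta> \<rightarrow>\<^sub>E (UNIV :: 'k set)"
  have ex1: "\<exists>!a. a \<in> ?A \<and> lincomb a \<beta> = v" if "v \<in> carrier U" for v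
    using that \<beta>(2) unfolding basis_criterion[OF \<beta>(1) sub] by simp
  define crd where "crd v = (THE a. a \<in> ?A \<and> lincomb a \<beta> = v)" for v
  have crd: "crd v \<in> ?A" "lincomb (crd v) \<beta> = v" if "v \<in> carrier U" for v
    using theI'[OF ex1[OF that]] unfolding crd_def by auto
  have crd_unique: "crd v = a" if "a \<in> ?A" "lincomb a \<beta> = v" "v \<in> carrier U" for a v
    using the1_equality[OF ex1[OF that(3)]] that(1,2) unfolding crd_def by blast
  have cong: "lincomb (restrict a \<beta>) \<beta> = lincomb a \<beta>" for a
    unfolding lincomb_def by (intro finsum_cong2) (use sub in \<open>auto intro!: smult_closed\<close>)
  have add: "crd (u \<oplus>\<^bsub>U\<^esub> v) = (\<lambda>b\<in>\<beta>. crd u b + crd v b)" if "u \<in> carrier U" "v \<in> carrier U" for u v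
  proof (rule crd_unique)
    show "lincomb (\<lambda>b\<in>\<beta>. crd u b + crd v b) \<beta> = u \<oplus>\<^bsub>U\<^esub> v"
      unfolding cong using lincomb_sum[OF \<beta>(1) sub, of "crd u" "crd v"] crd that by simp
  qed (use that in auto)
  have smult: "crd (c \<odot>\<^bsub>U\<^esub> u) = (\<lambda>b\<in>\<beta>. c * crd u b)" if "u \<in> carrier U" for c u
  proof (rule crd_unique)
    show "lincomb (\<lambda>b\<in>\<beta>. c * crd u b) \<beta> = c \<odot>\<^bsub>U\<^esub> u"
      unfolding cong using lincomb_smult[OF sub, of "crd u" c] crd that by simp
  qed (use that in \<open>auto intro: smult_closed\<close>)
  have unit: "crd c = (\<lambda>b\<in>\<beta>. if b = c then 1 else 0)" if c: "c \<in> \<beta>" for c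
  proof (rule crd_unique)
    have "lincomb (\<lambda>b\<in>\<beta>. if b = c then 1 else 0) \<beta> = (\<Oplus>\<^bsub>U\<^esub>b\<in>\<beta>. if c = b then b else \<zero>\<^bsub>U\<^esub>)"
      unfolding cong lincomb_def using sub smult_one lmult_0 by (intro finsum_cong2) (auto intro!: smult_closed)
    also have "\<dots> = c" using add.finprod_singleton[OF c \<beta>(1), of "\<lambda>x. x"] sub by auto
    finally show "lincomb (\<lambda>b\<in>\<beta>. if b = c then 1 else 0) \<beta> = c" .
  qed (use c sub in auto)
  define \<phi> where "\<phi> b = (\<lambda>u\<in>carrier U. crd u b)" for b
  show thesis
  proof (rule that[OF \<beta>(1) sub])
    show "\<phi> b \<in> lhom U ground_space" if "b \<in> \<beta>" for b
      using that kvs_closed[OF U] by (intro lhomI) (auto simp: \<phi>_def add smult)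
    show "\<phi> b c = (if b = c then 1 else 0)" if "b \<in> \<beta>" "c \<in> \<beta>" for b c
      using that sub by (auto simp: \<phi>_def unit)
    show "(\<Oplus>\<^bsub>U\<^esub>b\<in>\<beta>. \<phi> b u \<odot>\<^bsub>U\<^esub> b) = u" if "u \<in> carrier U" for u
      using crd(2)[OF that] that by (simp add: \<phi>_def lincomb_def)
  qed (simp add: \<phi>_def)
qed

text \<open>A basis identifies the space with its dual through the dot product \<open>D\<close> of
  coordinate vectors. This isomorphism is not canonical, but it transports finiteness and
  dimension.\<close>

lemma dual_space_fd:
  fixes U :: "('k::field, 'u) module"
  assumes U: "kvs U" and fd: "fd U"
  shows "fd (dual_space U)" "vdim (dual_space U) = vdim U"
proof -
  obtain \<beta> \<phi> where \<beta>: "finite \<beta>" "\<beta> \<subseteq> carrier U" "\<And>b. b \<in> \<beta> \<Longrightarrow> \<phi> b \<in> lhom U ground_space"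
    "\<And>b. b \<in> \<beta> \<Longrightarrow> \<phi> b \<in> extensional (carrier U)"
    "\<And>b c. b \<in> \<beta> \<Longrightarrow> c \<in> \<beta> \<Longrightarrow> \<phi> b c = (if b = c then 1 else 0)"
    "\<And>u. u \<in> carrier U \<Longrightarrow> (\<Oplus>\<^bsub>U\<^esub>b\<in>\<beta>. \<phi> b u \<odot>\<^bsub>U\<^esub> b) = u"
    by (rule coordinates[OF assms], rule that) assumption+
  define D where "D u = (\<lambda>v\<in>carrier U. \<Sum>b\<in>\<beta>. \<phi> b u * \<phi> b v)" for u
  have mem: "b \<in> carrier U" if "b \<in> \<beta>" for b using \<beta>(2) that by auto
  note \<phi>D = lhomD[OF \<beta>(3)]
  note cl = kvs_closed[OF U]
  have hom: "D \<in> lhom U (dual_space U)"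
  proof (rule lhomI)
    fix u assume u: "u \<in> carrier U"
    have "D u \<in> lhom U ground_space"
    proof (rule lhomI)
      fix v w and c assume v: "v \<in> carrier U"
      show "D u (c \<odot>\<^bsub>U\<^esub> v) = c \<odot>\<^bsub>ground_space\<^esub> D u v"
        using v cl by (simp add: D_def \<phi>D(3) sum_distrib_left mult.left_commute)
      assume "w \<in> carrier U"
      then show "D u (v \<oplus>\<^bsub>U\<^esub> w) = D u v \<oplus>\<^bsub>ground_space\<^esub> D u w"
        using v cl by (simp add: D_def \<phi>D(2) sum.distrib distrib_left)
    qed simp
    then show "D u \<in> carrier (dual_space U)" by (simp add: dual_space_eq D_def)
    show "D (c \<odot>\<^bsub>U\<^esub> u) = c \<odot>\<^bsub>dual_space U\<^esub> D u" for c
      using u by (simp add: dual_space_eq D_def fun_eq_iff \<phi>D(3) sum_distrib_left mult.assoc)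
    fix v assume v: "v \<in> carrier U"
    show "D (u \<oplus>\<^bsub>U\<^esub> v) = D u \<oplus>\<^bsub>dual_space U\<^esub> D v"
      using u v by (simp add: dual_space_eq D_def fun_eq_iff \<phi>D(2) sum.distrib distrib_right)
  qed
  have inj: "inj_on D (carrier U)"
  proof (rule inj_onI_kernel[OF U dual_space_vs[OF U] hom])
    fix u assume u: "u \<in> carrier U" and "D u = \<zero>\<^bsub>dual_space U\<^esub>"
    then have "D u c = 0" if "c \<in> \<beta>" for c using mem[OF that] by (simp add: dual_space_eq)
    moreover have "D u c = \<phi> c u" if "c \<in> \<beta>" for c
      using mem[OF that] \<beta>(1) that by (simp add: D_def \<beta>(5) if_distrib[of "\<lambda>x. _ * x"] cong: if_cong)
    ultimately have 0: "\<phi> c u = 0" if "c \<in> \<beta>" for c using that by simp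
    interpret vectorspace class_ring U by fact
    have "(\<Oplus>\<^bsub>U\<^esub>b\<in>\<beta>. \<phi> b u \<odot>\<^bsub>U\<^esub> b) = (\<Oplus>\<^bsub>U\<^esub>b\<in>\<beta>. \<zero>\<^bsub>U\<^esub>)"
      using 0 mem lmult_0 by (intro finsum_cong2) auto
    then show "u = \<zero>\<^bsub>U\<^esub>" using \<beta>(6)[OF u] by simp
  qed
  have surj: "D ` carrier U = carrier (dual_space U)"
  proof
    show "D ` carrier U \<subseteq> carrier (dual_space U)" using lhomD(1)[OF hom] by auto
    show "carrier (dual_space U) \<subseteq> D ` carrier U"
    proof
      fix \<psi> assume "\<psi> \<in> carrier (dual_space U)"
      then have \<psi>: "\<psi> \<in> lhom U ground_space" "\<psi> \<in> extensional (carrier U)" by (auto simp: dual_space_eq)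
      interpret vectorspace class_ring U by fact
      \<comment> \<open>The coordinates of the preimage are the values of \<open>\<psi>\<close> on
        the basis.\<close>
      define u where "u = (\<Oplus>\<^bsub>U\<^esub>b\<in>\<beta>. \<psi> b \<odot>\<^bsub>U\<^esub> b)"
      have sm: "(\<lambda>b. c b \<odot>\<^bsub>U\<^esub> b) \<in> \<beta> \<rightarrow> carrier U" for c using mem cl by auto
      have u: "u \<in> carrier U" unfolding u_def by (rule finsum_closed[OF sm])
      have \<phi>u: "\<phi> c u = \<psi> c" if c: "c \<in> \<beta>" for c
        unfolding u_def dual_finsum[OF U \<beta>(3)[OF c] \<beta>(1) sm] using c \<beta>(1) mem
        by (simp add: \<phi>D \<beta>(5) if_distrib[of "\<lambda>x. _ * x"] cong: if_cong)
      have "\<psi> v = D u v" for v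
      proof (cases "v \<in> carrier U")
        case True
        have "\<psi> v = \<psi> (\<Oplus>\<^bsub>U\<^esub>b\<in>\<beta>. \<phi> b v \<odot>\<^bsub>U\<^esub> b)" using \<beta>(6)[OF True] by simp
        also have "\<dots> = (\<Sum>b\<in>\<beta>. \<phi> b v * \<psi> b)"
          unfolding dual_finsum[OF U \<psi>(1) \<beta>(1) sm] using mem lhomD[OF \<psi>(1)] by simp
        finally show ?thesis using True \<phi>u by (simp add: D_def mult.commute)
      qed (use \<psi>(2) in \<open>simp add: D_def extensional_def\<close>)
      then show "\<psi> \<in> D ` carrier U" using u by blast
    qed
  qed
  show "fd (dual_space U)" by (rule surj_fd[OF U dual_space_vs[OF U] hom fd surj])
  show "vdim (dual_space U) = vdim U"
    using vdim_inj_image[OF U dual_space_vs[OF U] hom fd inj] unfolding surj by simp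
qed

lemma dual_separates:
  fixes U :: "('k::field, 'u, 'm) module_scheme"
  assumes U: "kvs U" "fd U" and u: "u \<in> carrier U" and 0: "\<And>\<psi>. \<psi> \<in> lhom U ground_space \<Longrightarrow> \<psi> u = 0"
  shows "u = \<zero>\<^bsub>U\<^esub>"
proof (rule coordinates[OF U])
  fix \<beta> \<phi> assume \<beta>: "finite \<beta>" "\<beta> \<subseteq> carrier U" "\<And>b. b \<in> \<beta> \<Longrightarrow> \<phi> b \<in> lhom U ground_space"
    and sum: "\<And>u. u \<in> carrier U \<Longrightarrow> (\<Oplus>\<^bsub>U\<^esub>b\<in>\<beta>. \<phi> b u \<odot>\<^bsub>U\<^esub> b) = u"
  interpret vectorspace class_ring U by fact
  have "(\<Oplus>\<^bsub>U\<^esub>b\<in>\<beta>. \<phi> b u \<odot>\<^bsub>U\<^esub> b) = (\<Oplus>\<^bsub>U\<^esub>b\<in>\<beta>. \<zero>\<^bsub>U\<^esub>)"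
    using 0[OF \<beta>(3)] \<beta>(2) lmult_0 by (intro finsum_cong2) auto
  then show ?thesis using sum[OF u] by simp
qed

definition evaluation :: "('k::field, 'u) module \<Rightarrow> 'u \<Rightarrow> ('u \<Rightarrow> 'k) \<Rightarrow> 'k" where
  "evaluation U u = (\<lambda>\<psi>\<in>carrier (dual_space U). \<psi> u)"

lemma evaluation_hom:
  assumes U: "kvs U"
  shows "evaluation U \<in> lhom U (dual_space (dual_space U))"
proof (rule lhomI)
  note cl = kvs_closed[OF dual_space_vs[OF U]]
  fix u assume u: "u \<in> carrier U"
  have "evaluation U u \<in> lhom (dual_space U) ground_space"
    using cl u by (intro lhomI) (auto simp: evaluation_def dual_space_eq)
  then show "evaluation U u \<in> carrier (dual_space (dual_space U))"
    by (simp add: dual_space_eq[of "dual_space U"] evaluation_def)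
  show "evaluation U (c \<odot>\<^bsub>U\<^esub> u) = c \<odot>\<^bsub>dual_space (dual_space U)\<^esub> evaluation U u" for c
    using u by (auto simp: dual_space_eq evaluation_def fun_eq_iff lhomD(3))
  fix v assume "v \<in> carrier U"
  then show "evaluation U (u \<oplus>\<^bsub>U\<^esub> v) = evaluation U u \<oplus>\<^bsub>dual_space (dual_space U)\<^esub> evaluation U v"
    using u by (auto simp: dual_space_eq evaluation_def fun_eq_iff lhomD(2))
qed

lemma evaluation_inj:
  assumes U: "kvs U" "fd U"
  shows "inj_on (evaluation U) (carrier U)"
proof (rule inj_onI_kernel[OF U(1) dual_space_vs[OF dual_space_vs[OF U(1)]] evaluation_hom[OF U(1)]])
  fix u assume u: "u \<in> carrier U" and ev: "evaluation U u = \<zero>\<^bsub>dual_space (dual_space U)\<^esub>"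
  show "u = \<zero>\<^bsub>U\<^esub>"
  proof (rule dual_separates[OF U u])
    fix \<psi> assume \<psi>: "\<psi> \<in> lhom U ground_space"
    note cl = kvs_closed[OF U(1)]
    have "restrict \<psi> (carrier U) \<in> carrier (dual_space U)"
      using lhomD[OF \<psi>] cl by (auto simp: dual_space_eq intro!: lhomI)
    then have "restrict \<psi> (carrier U) u = 0"
      using fun_cong[OF ev, of "restrict \<psi> (carrier U)"] by (simp add: evaluation_def dual_space_eq[of "dual_space U"])
    then show "\<psi> u = 0" using u by simp
  qed
qed

text \<open>With b and \<open>\<phi> b\<close> dual bases, the preimage of \<open>\<xi>\<close> is
  the vector with coordinates \<open>\<xi> (\<phi> b)\<close>; this is checked by expanding an
  arbitrary functional as \<open>\<psi>\<close> = \<Sum>b. \<open>\<psi> b\<close>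
  \<open>\<phi> b\<close>.\<close>

lemma evaluation_surj:
  fixes U :: "('k::field, 'u) module"
  assumes U: "kvs U" "fd U"
  shows "evaluation U ` carrier U = carrier (dual_space (dual_space U))"
proof
  show "evaluation U ` carrier U \<subseteq> carrier (dual_space (dual_space U))"
    using lhomD(1)[OF evaluation_hom[OF U(1)]] by auto
  show "carrier (dual_space (dual_space U)) \<subseteq> evaluation U ` carrier U"
  proof
    fix \<xi> assume "\<xi> \<in> carrier (dual_space (dual_space U))"
    then have \<xi>: "\<xi> \<in> lhom (dual_space U) ground_space" "\<xi> \<in> extensional (carrier (dual_space U))"
      by (auto simp: dual_space_eq[of "dual_space U"])
    show "\<xi> \<in> evaluation U ` carrier U"
    proof (rule coordinates[OF U])
      fix \<beta> \<phi> assume \<beta>: "finite \<beta>" "\<beta> \<subseteq> carrier U" "\<And>b. b \<in> \<beta> \<Longrightarrow> \<phi> b \<in> lhom U ground_space"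
        "\<And>b. b \<in> \<beta> \<Longrightarrow> \<phi> b \<in> extensional (carrier U)"
        and sum: "\<And>u. u \<in> carrier U \<Longrightarrow> (\<Oplus>\<^bsub>U\<^esub>b\<in>\<beta>. \<phi> b u \<odot>\<^bsub>U\<^esub> b) = u"
      have \<phi>D: "\<phi> b \<in> carrier (dual_space U)" if "b \<in> \<beta>" for b using \<beta> that by (simp add: dual_space_eq)
      note D = dual_space_vs[OF U(1)]
      interpret vectorspace class_ring U by fact
      interpret D: vectorspace class_ring "dual_space U" by fact
      define u where "u = (\<Oplus>\<^bsub>U\<^esub>b\<in>\<beta>. \<xi> (\<phi> b) \<odot>\<^bsub>U\<^esub> b)"
      have sm: "(\<lambda>b. c b \<odot>\<^bsub>U\<^esub> b) \<in> \<beta> \<rightarrow> carrier U" for c using \<beta>(2) kvs_closed[OF U(1)] by auto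
      have u: "u \<in> carrier U" unfolding u_def by (rule finsum_closed[OF sm])
      have "\<xi> \<psi> = evaluation U u \<psi>" for \<psi>
      proof (cases "\<psi> \<in> carrier (dual_space U)")
        case True
        then have \<psi>: "\<psi> \<in> lhom U ground_space" "\<psi> \<in> extensional (carrier U)" by (auto simp: dual_space_eq)
        have smD: "(\<lambda>b. \<psi> b \<odot>\<^bsub>dual_space U\<^esub> \<phi> b) \<in> \<beta> \<rightarrow> carrier (dual_space U)"
          using \<phi>D kvs_closed[OF D] by auto
        have expand: "\<psi> = (\<Oplus>\<^bsub>dual_space U\<^esub>b\<in>\<beta>. \<psi> b \<odot>\<^bsub>dual_space U\<^esub> \<phi> b)" (is "_ = ?r")
        proof
          fix v
          have r: "?r \<in> carrier (dual_space U)" by (rule D.finsum_closed[OF smD])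
          show "\<psi> v = ?r v"
          proof (cases "v \<in> carrier U")
            case True
            have "(\<lambda>\<psi>. \<psi> v) \<in> lhom (dual_space U) ground_space" using True by (auto intro!: lhomI simp: dual_space_eq lhomD)
            from dual_finsum[OF D this \<beta>(1) smD] have "?r v = (\<Sum>b\<in>\<beta>. \<psi> b * \<phi> b v)" using True by (simp add: dual_space_eq)
            also have "\<dots> = \<psi> (\<Oplus>\<^bsub>U\<^esub>b\<in>\<beta>. \<phi> b v \<odot>\<^bsub>U\<^esub> b)"
              unfolding dual_finsum[OF U(1) \<psi>(1) \<beta>(1) sm] using lhomD(3)[OF \<psi>(1)] \<beta>(2)
              by (intro sum.cong) (auto simp: mult.commute)
            finally show ?thesis using sum[OF True] by simp
          next
            case False
            then show ?thesis using r \<psi>(2) by (auto simp: dual_space_eq extensional_def)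
          qed
        qed
        have "\<xi> \<psi> = (\<Sum>b\<in>\<beta>. \<xi> (\<psi> b \<odot>\<^bsub>dual_space U\<^esub> \<phi> b))"
          by (subst expand, rule dual_finsum[OF D \<xi>(1) \<beta>(1) smD])
        also have "\<dots> = (\<Sum>b\<in>\<beta>. \<psi> (\<xi> (\<phi> b) \<odot>\<^bsub>U\<^esub> b))"
          using lhomD(3)[OF \<xi>(1) \<phi>D] lhomD(3)[OF \<psi>(1)] \<beta>(2) by (intro sum.cong) (auto simp: mult.commute)
        also have "\<dots> = \<psi> u" unfolding u_def by (rule dual_finsum[OF U(1) \<psi>(1) \<beta>(1) sm, symmetric])
        finally show ?thesis using True by (simp add: evaluation_def)
      qed (use \<xi>(2) in \<open>simp add: evaluation_def extensional_def\<close>)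
      then show ?thesis using u by blast
    qed
  qed
qed

text \<open>Passing to the dual twice produces two minus signs, which cancel, so evaluation
  intertwines the original action with the bidual one. It therefore maps orbit tangent spaces
  isomorphically, and the index of the dual counts orbits in the space itself.\<close>

lemma index_dual:
  fixes U :: "('k::field, 'u) module"
  assumes U: "kvs U" "fd U" and act: "\<And>x. x \<in> q \<Longrightarrow> act x \<in> lhom U U"
    and sub: "\<And>u. u \<in> carrier U \<Longrightarrow> subsp (tangent_space q act u) U"
  shows "index q (dual_space U) (dual_action U act) =
    int (vdim U) - int (Max {vdim (U\<lparr>carrier := tangent_space q act u\<rparr>) | u. u \<in> carrier U})"
proof -
  let ?D = "dual_space U" and ?DD = "dual_space (dual_space U)" and ?ev = "evaluation U"
  have tan: "tangent_space q (dual_action ?D (dual_action U act)) (?ev u) = ?ev ` tangent_space q act u"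
    if u: "u \<in> carrier U" for u
  proof -
    have "dual_action ?D (dual_action U act) x (?ev u) = ?ev (act x u)" if x: "x \<in> q" for x
    proof -
      note A = lhomD[OF act[OF x]]
      have "dual_action U act x \<psi> \<in> carrier ?D" if "\<psi> \<in> carrier ?D" for \<psi>
        using that A kvs_closed[OF U(1)] by (auto simp: dual_action_def dual_space_eq lhomD intro!: lhomI)
      then show ?thesis using u by (auto simp: dual_action_def[of ?D] evaluation_def fun_eq_iff) (simp add: dual_action_def)
    qed
    then show ?thesis unfolding tangent_space_def by (simp add: image_image)
  qed
  have dims: "vdim (?DD\<lparr>carrier := ?ev ` tangent_space q act u\<rparr>) = vdim (U\<lparr>carrier := tangent_space q act u\<rparr>)"
    if u: "u \<in> carrier U" for u
  proof -
    note s = sub[OF u]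
    have ss: "tangent_space q act u \<subseteq> carrier U" by (rule subspD(2)[OF s])
    have "?ev \<in> lhom (U\<lparr>carrier := tangent_space q act u\<rparr>) ?DD"
      by (rule lhomI) (simp_all add: subsetD[OF ss] lhomD[OF evaluation_hom[OF U(1)]])
    from vdim_inj_image[OF subsp_vs[OF s] dual_space_vs[OF dual_space_vs[OF U(1)]] this subsp_fd[OF s U(2)]]
    show ?thesis using inj_on_subset[OF evaluation_inj[OF U] ss] by simp
  qed
  have "{vdim (?DD\<lparr>carrier := tangent_space q (dual_action ?D (dual_action U act)) \<xi>\<rparr>) | \<xi>. \<xi> \<in> carrier ?DD}
    = {vdim (U\<lparr>carrier := tangent_space q act u\<rparr>) | u. u \<in> carrier U}"
    unfolding evaluation_surj[OF U, symmetric] setcompr_eq_image Collect_mem_eq image_image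
    by (rule image_cong) (simp_all add: tan dims)
  then show ?thesis unfolding index_def dual_space_fd(2)[OF U] by simp
qed

text \<open>Rank-nullity bounds every orbit dimension by that of the Lie algebra, and a vector with
  trivial stabiliser attains the bound. The bound also makes the set of dimensions finite, as the
  maximum requires.\<close>

lemma Max_orbit_dim:
  fixes L :: "('k::field, 'q, 'n) module_scheme" and U :: "('k, 'u, 'm) module_scheme"
  assumes L: "kvs L" "fd L" and U: "kvs U" and act: "\<And>u. u \<in> carrier U \<Longrightarrow> (\<lambda>x. act x u) \<in> lhom L U"
    and w: "w \<in> carrier U" "\<And>x. x \<in> carrier L \<Longrightarrow> act x w = \<zero>\<^bsub>U\<^esub> \<Longrightarrow> x = \<zero>\<^bsub>L\<^esub>"
  shows "Max {vdim (U\<lparr>carrier := tangent_space (carrier L) act u\<rparr>) | u. u \<in> carrier U} = vdim L"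
proof -
  let ?d = "\<lambda>u. vdim (U\<lparr>carrier := tangent_space (carrier L) act u\<rparr>)"
  have le: "?d u \<le> vdim L" if "u \<in> carrier U" for u
    using rank_nullity_image[OF L(1) U act[OF that] L(2)] unfolding tangent_space_def by simp
  have eq: "?d w = vdim L" unfolding tangent_space_def
    by (rule vdim_inj_image[OF L(1) U act[OF w(1)] L(2) inj_onI_kernel[OF L(1) U act[OF w(1)] w(2)]])
  have "Max (?d ` carrier U) = vdim L"
  proof (rule Max_eqI)
    show "finite (?d ` carrier U)" by (rule finite_subset[of _ "{..vdim L}"]) (use le in blast, simp)
    show "y \<le> vdim L" if "y \<in> ?d ` carrier U" for y using that by (rule imageE) (simp add: le)
    show "vdim L \<in> ?d ` carrier U" unfolding eq[symmetric] using w(1) by (rule imageI)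
  qed
  then show ?thesis unfolding setcompr_eq_image Collect_mem_eq .
qed

section \<open>Quotient modules and the reduction of the index equality\<close>

locale quotient = fixes U :: "('k::field, 'u) module" and S :: "'u set"
  assumes S: "subsp S U"
begin

sublocale vectorspace class_ring U by (rule subspD(1)[OF S])

abbreviation Q where "Q \<equiv> quotient_space U S"
definition proj :: "'u \<Rightarrow> 'u set" where "proj u = S +>\<^bsub>U\<^esub> u"

lemma vsU: "kvs U" by (rule subspD(1)[OF S])

lemma proj_eq: "proj u = {s \<oplus>\<^bsub>U\<^esub> u | s. s \<in> S}"
  by (auto simp: proj_def a_r_coset_def')

lemma S_carrier: "s \<in> S \<Longrightarrow> s \<in> carrier U"
  using subspD(2)[OF S] by auto

lemma S_neg: "s \<in> S \<Longrightarrow> \<ominus>\<^bsub>U\<^esub> s \<in> S"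
  using subspD(5)[OF S, of s "- 1"] smult_minus_1[OF S_carrier, of s] by (simp add: class_ring_simps)

lemma proj_eq_iff:
  assumes "u \<in> carrier U" "v \<in> carrier U"
  shows "proj u = proj v \<longleftrightarrow> (\<exists>s\<in>S. u = s \<oplus>\<^bsub>U\<^esub> v)"
proof
  assume "proj u = proj v"
  moreover have "u \<in> proj u" unfolding proj_eq using subspD(3)[OF S] assms by force
  ultimately show "\<exists>s\<in>S. u = s \<oplus>\<^bsub>U\<^esub> v" unfolding proj_eq by blast
next
  have sub: "proj u \<subseteq> proj v" if s: "s \<in> S" "u = s \<oplus>\<^bsub>U\<^esub> v" and v: "v \<in> carrier U" for u v s
  proof
    fix x assume "x \<in> proj u"
    then obtain t where t: "t \<in> S" "x = t \<oplus>\<^bsub>U\<^esub> u" by (auto simp: proj_eq)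
    then have "x = (t \<oplus>\<^bsub>U\<^esub> s) \<oplus>\<^bsub>U\<^esub> v" using s v S_carrier a_assoc by simp
    then show "x \<in> proj v" using t s subspD(4)[OF S] unfolding proj_eq by blast
  qed
  assume "\<exists>s\<in>S. u = s \<oplus>\<^bsub>U\<^esub> v"
  then obtain s where s: "s \<in> S" "u = s \<oplus>\<^bsub>U\<^esub> v" by blast
  have "v = (\<ominus>\<^bsub>U\<^esub> s) \<oplus>\<^bsub>U\<^esub> u" unfolding s(2) using assms(2) S_carrier[OF s(1)] by (simp add: l_neg flip: a_assoc)
  then show "proj u = proj v" using sub[OF s assms(2)] sub[OF S_neg[OF s(1)] _ assms(1)] by blast
qed

lemma carrier_Q: "carrier Q = proj ` carrier U"
  by (auto simp: quotient_space_def A_RCOSETS_def' proj_def)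

lemma zero_Q: "\<zero>\<^bsub>Q\<^esub> = proj \<zero>\<^bsub>U\<^esub>"
  using S_carrier by (force simp: quotient_space_def proj_eq)

lemma proj_zero_iff: "u \<in> carrier U \<Longrightarrow> proj u = \<zero>\<^bsub>Q\<^esub> \<longleftrightarrow> u \<in> S"
  unfolding zero_Q using proj_eq_iff[of u "\<zero>\<^bsub>U\<^esub>"] S_carrier by auto

lemma add_Q: "u \<in> carrier U \<Longrightarrow> v \<in> carrier U \<Longrightarrow> proj u \<oplus>\<^bsub>Q\<^esub> proj v = proj (u \<oplus>\<^bsub>U\<^esub> v)"
proof -
  assume uv: "u \<in> carrier U" "v \<in> carrier U"
  have "set_add U (proj u) (proj v) = proj (u \<oplus>\<^bsub>U\<^esub> v)"
  proof
    show "set_add U (proj u) (proj v) \<subseteq> proj (u \<oplus>\<^bsub>U\<^esub> v)"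
    proof
      fix x assume "x \<in> set_add U (proj u) (proj v)"
      then obtain s t where st: "s \<in> S" "t \<in> S" "x = (s \<oplus>\<^bsub>U\<^esub> u) \<oplus>\<^bsub>U\<^esub> (t \<oplus>\<^bsub>U\<^esub> v)"
        unfolding set_add_def' proj_eq by blast
      then have "x = (s \<oplus>\<^bsub>U\<^esub> t) \<oplus>\<^bsub>U\<^esub> (u \<oplus>\<^bsub>U\<^esub> v)" using uv S_carrier a_ac by simp
      then show "x \<in> proj (u \<oplus>\<^bsub>U\<^esub> v)" unfolding proj_eq using st subspD(4)[OF S] by blast
    qed
    show "proj (u \<oplus>\<^bsub>U\<^esub> v) \<subseteq> set_add U (proj u) (proj v)"
    proof
      fix x assume "x \<in> proj (u \<oplus>\<^bsub>U\<^esub> v)"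
      then obtain s where s: "s \<in> S" "x = s \<oplus>\<^bsub>U\<^esub> (u \<oplus>\<^bsub>U\<^esub> v)" by (auto simp: proj_eq)
      then have "x = (s \<oplus>\<^bsub>U\<^esub> u) \<oplus>\<^bsub>U\<^esub> (\<zero>\<^bsub>U\<^esub> \<oplus>\<^bsub>U\<^esub> v)" using uv S_carrier a_assoc by simp
      then show "x \<in> set_add U (proj u) (proj v)"
        unfolding set_add_def' proj_eq using s(1) subspD(3)[OF S] by blast
    qed
  qed
  then show ?thesis by (simp add: quotient_space_def)
qed

text \<open>Operations on cosets are defined as unions over all representatives. When
  \<open>f\<close> changes only by an element of \<open>S\<close> along a coset, all cosets in that
  union coincide, and the union is a single coset.\<close>

lemma union_proj:
  assumes v: "v \<in> carrier U" and fv: "f v \<in> carrier U"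
    and f: "\<And>s. s \<in> S \<Longrightarrow> \<exists>t\<in>S. f (s \<oplus>\<^bsub>U\<^esub> v) = t \<oplus>\<^bsub>U\<^esub> f v"
  shows "(\<Union>u\<in>proj v. S +>\<^bsub>U\<^esub> f u) = proj (f v)"
proof -
  have "S +>\<^bsub>U\<^esub> f u = proj (f v)" if u: "u \<in> proj v" for u
  proof -
    obtain s where "s \<in> S" "u = s \<oplus>\<^bsub>U\<^esub> v" using u by (auto simp: proj_eq)
    then obtain t where t: "t \<in> S" "f u = t \<oplus>\<^bsub>U\<^esub> f v" using f by blast
    then have "proj (f u) = proj (f v)" using proj_eq_iff[of "f u" "f v"] fv S_carrier by auto
    then show ?thesis by (simp add: proj_def)
  qed
  then have "(\<Union>u\<in>proj v. S +>\<^bsub>U\<^esub> f u) = (\<Union>u\<in>proj v. proj (f v))" by (intro SUP_cong) simp_all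
  moreover have "v \<in> proj v" unfolding proj_eq using subspD(3)[OF S] v by force
  ultimately show ?thesis by auto
qed

lemma smult_Q: "u \<in> carrier U \<Longrightarrow> c \<odot>\<^bsub>Q\<^esub> proj u = proj (c \<odot>\<^bsub>U\<^esub> u)"
proof -
  assume u: "u \<in> carrier U"
  have "(\<Union>u\<in>proj u. S +>\<^bsub>U\<^esub> (c \<odot>\<^bsub>U\<^esub> u)) = proj (c \<odot>\<^bsub>U\<^esub> u)"
  proof (rule union_proj[OF u])
    show "\<exists>t\<in>S. c \<odot>\<^bsub>U\<^esub> (s \<oplus>\<^bsub>U\<^esub> u) = t \<oplus>\<^bsub>U\<^esub> c \<odot>\<^bsub>U\<^esub> u" if "s \<in> S" for s
      using smult_r_distr[of c s u] S_carrier[OF that] u subspD(5)[OF S that, of c] by auto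
  qed (use kvs_closed[OF vsU] u in auto)
  then show ?thesis by (simp add: quotient_space_def)
qed

lemma vsQ: "kvs Q"
proof (rule kvsI)
  note cl = kvs_closed[OF vsU]
  show "\<zero>\<^bsub>Q\<^esub> \<in> carrier Q" using cl by (simp add: zero_Q carrier_Q)
  fix X Y Z a b assume "X \<in> carrier Q"
  then obtain u where u: "u \<in> carrier U" "X = proj u" by (auto simp: carrier_Q)
  show "a \<odot>\<^bsub>Q\<^esub> X \<in> carrier Q" "X \<oplus>\<^bsub>Q\<^esub> \<zero>\<^bsub>Q\<^esub> = X" "(a * b) \<odot>\<^bsub>Q\<^esub> X = a \<odot>\<^bsub>Q\<^esub> (b \<odot>\<^bsub>Q\<^esub> X)"
    "1 \<odot>\<^bsub>Q\<^esub> X = X" "0 \<odot>\<^bsub>Q\<^esub> X = \<zero>\<^bsub>Q\<^esub>" "(a + b) \<odot>\<^bsub>Q\<^esub> X = a \<odot>\<^bsub>Q\<^esub> X \<oplus>\<^bsub>Q\<^esub> b \<odot>\<^bsub>Q\<^esub> X"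
    using u cl smult_assoc1[of a b u] smult_l_distr[of a b u] smult_one[of u] lmult_0[of u]
    by (simp_all add: carrier_Q smult_Q zero_Q add_Q)
  assume "Y \<in> carrier Q"
  then obtain v where v: "v \<in> carrier U" "Y = proj v" by (auto simp: carrier_Q)
  show "X \<oplus>\<^bsub>Q\<^esub> Y \<in> carrier Q" "X \<oplus>\<^bsub>Q\<^esub> Y = Y \<oplus>\<^bsub>Q\<^esub> X"
    "a \<odot>\<^bsub>Q\<^esub> (X \<oplus>\<^bsub>Q\<^esub> Y) = a \<odot>\<^bsub>Q\<^esub> X \<oplus>\<^bsub>Q\<^esub> a \<odot>\<^bsub>Q\<^esub> Y"
    using u v cl a_comm[of u v] smult_r_distr[of a u v] by (simp_all add: carrier_Q smult_Q add_Q)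
  assume "Z \<in> carrier Q"
  then obtain w where w: "w \<in> carrier U" "Z = proj w" by (auto simp: carrier_Q)
  show "X \<oplus>\<^bsub>Q\<^esub> Y \<oplus>\<^bsub>Q\<^esub> Z = X \<oplus>\<^bsub>Q\<^esub> (Y \<oplus>\<^bsub>Q\<^esub> Z)"
    using u v w cl a_assoc[of u v w] by (simp add: add_Q)
qed

lemma proj_hom: "proj \<in> lhom U Q"
  by (rule lhomI) (simp_all add: carrier_Q add_Q smult_Q)

lemma fdQ: "fd U \<Longrightarrow> fd Q"
  using surj_fd[OF vsU vsQ proj_hom] carrier_Q by blast

lemma vdim_Q: "fd U \<Longrightarrow> vdim Q + vdim (U\<lparr>carrier := S\<rparr>) = vdim U"
proof -
  assume fd: "fd U"
  have "{u \<in> carrier U. proj u = \<zero>\<^bsub>Q\<^esub>} = S" using proj_zero_iff S_carrier by blast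
  then show ?thesis using rank_nullity_image[OF vsU vsQ proj_hom fd] by (simp flip: carrier_Q)
qed

lemma quotient_action_proj:
  assumes f: "act x \<in> lhom U U" "\<And>s. s \<in> S \<Longrightarrow> act x s \<in> S" and u: "u \<in> carrier U"
  shows "quotient_action U S act x (proj u) = proj (act x u)"
  unfolding quotient_action_def
proof (rule union_proj[OF u])
  show "\<exists>t\<in>S. act x (s \<oplus>\<^bsub>U\<^esub> u) = t \<oplus>\<^bsub>U\<^esub> act x u" if "s \<in> S" for s
    using f(2)[OF that] lhomD(2)[OF f(1) S_carrier[OF that] u] by auto
qed (use lhomD[OF f(1)] u in auto)

lemma quotient_action_hom:
  assumes f: "act x \<in> lhom U U" "\<And>s. s \<in> S \<Longrightarrow> act x s \<in> S"
  shows "quotient_action U S act x \<in> lhom Q Q"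
  using kvs_closed[OF vsU] lhomD[OF f(1)]
  by (intro lhomI) (auto simp: carrier_Q quotient_action_proj[where act = act, OF f] add_Q smult_Q)

end

text \<open>The vector \<open>w0\<close> has trivial stabiliser in the whole algebra, and the class
  of \<open>w\<close> has trivial stabiliser in that of \<open>v\<close>, so both maxima are
  attained at full dimension. The hypothesis \<open>stable\<close> makes the tangent space at
  \<open>v\<close> a submodule for the stabiliser.\<close>

lemma index_quotient_eq:
  fixes U :: "('k::field, 'u) module" and L :: "('k, 'q, 'n) module_scheme"
  assumes U: "kvs U" "fd U" and L: "kvs L"
    and act: "\<And>x. x \<in> carrier L \<Longrightarrow> act x \<in> lhom U U" and orb: "\<And>u. u \<in> carrier U \<Longrightarrow> (\<lambda>x. act x u) \<in> lhom L U"
    and w0: "w0 \<in> carrier U" "\<And>x. x \<in> carrier L \<Longrightarrow> act x w0 = \<zero>\<^bsub>U\<^esub> \<Longrightarrow> x = \<zero>\<^bsub>L\<^esub>"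
    and v: "v \<in> carrier U" and stable: "\<And>x y. x \<in> carrier L \<Longrightarrow> y \<in> carrier L \<Longrightarrow> act x v = \<zero>\<^bsub>U\<^esub>
      \<Longrightarrow> act x (act y v) \<in> tangent_space (carrier L) act v"
    and w: "w \<in> carrier U" "\<And>x. x \<in> carrier L \<Longrightarrow> act x v = \<zero>\<^bsub>U\<^esub> \<Longrightarrow> act x w \<in> tangent_space (carrier L) act v \<Longrightarrow> x = \<zero>\<^bsub>L\<^esub>"
  defines "W \<equiv> tangent_space (carrier L) act v"
  defines "Q \<equiv> quotient_space U W"
  shows "index (carrier L) (dual_space U) (dual_action U act) =
    index (stabiliser U (carrier L) act v) (dual_space Q) (dual_action Q (quotient_action U W act))"
proof -
  have W: "subsp W U" unfolding W_def tangent_space_def by (rule hom_image_subsp[OF L U(1) orb[OF v]])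
  interpret quotient U W by (rule quotient.intro[OF W])
  \<comment> \<open>The orbit map at \<open>w0\<close> embeds the Lie algebra into the
    finite-dimensional space \<open>U\<close>.\<close>
  have Lfd: "fd L"
    by (rule inj_fin_dim[OF linear_mapI[OF L U(1) orb[OF w0(1)]] inj_onI_kernel[OF L U(1) orb[OF w0(1)] w0(2)] U(2)])
  have 1: "index (carrier L) (dual_space U) (dual_action U act) = int (vdim U) - int (vdim L)"
  proof -
    have "index (carrier L) (dual_space U) (dual_action U act) =
      int (vdim U) - int (Max {vdim (U\<lparr>carrier := tangent_space (carrier L) act u\<rparr>) | u. u \<in> carrier U})"
    proof (rule index_dual[OF U act])
      show "subsp (tangent_space (carrier L) act u) U" if "u \<in> carrier U" for u
        unfolding tangent_space_def by (rule hom_image_subsp[OF L U(1) orb[OF that]])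
    qed
    moreover have "Max {vdim (U\<lparr>carrier := tangent_space (carrier L) act u\<rparr>) | u. u \<in> carrier U} = vdim L"
      by (rule Max_orbit_dim[OF L Lfd U(1) orb w0])
    ultimately show ?thesis by simp
  qed
  define K where "K = {x \<in> carrier L. act x v = \<zero>\<^bsub>U\<^esub>}"
  let ?K = "L\<lparr>carrier := K\<rparr>"
  let ?a = "quotient_action U W act"
  have K: "subsp K L" unfolding K_def by (rule hom_kernel_subsp[OF L U(1) orb[OF v]])
  note Kvs = subsp_vs[OF K] and Kfd = subsp_fd[OF K Lfd]
  have st: "stabiliser U (carrier L) act v = carrier ?K" by (simp add: stabiliser_def K_def)
  have KL: "x \<in> carrier L" if "x \<in> K" for x using that by (simp add: K_def)
  have inv: "act x s \<in> W" if "x \<in> K" "s \<in> W" for x s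
    using that stable unfolding W_def K_def tangent_space_def by blast
  have a: "?a x (proj u) = proj (act x u)" if "x \<in> K" "u \<in> carrier U" for x u
    by (rule quotient_action_proj[where act = act and x = x, OF act[OF KL[OF that(1)]] inv[OF that(1)] that(2)])
  have ahom: "?a x \<in> lhom Q Q" if "x \<in> K" for x
    unfolding Q_def by (rule quotient_action_hom[where act = act and x = x, OF act[OF KL[OF that]] inv[OF that]])
  have aorb: "(\<lambda>x. ?a x X) \<in> lhom ?K Q" if X: "X \<in> carrier Q" for X
  proof -
    obtain u where u: "u \<in> carrier U" "X = proj u" using X unfolding Q_def carrier_Q by auto
    note O = lhomD[OF orb[OF u(1)]]
    show ?thesis unfolding Q_def
    proof (rule lhomI, unfold u(2))
      fix x y c assume x: "x \<in> carrier ?K"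
      then have xL: "x \<in> carrier L" "x \<in> K" using KL by auto
      show "?a x (proj u) \<in> carrier (quotient_space U W)"
        using a xL u O by (simp add: carrier_Q)
      have "c \<odot>\<^bsub>L\<^esub> x \<in> K" using subspD(5)[OF K] x by simp
      then show "?a (c \<odot>\<^bsub>?K\<^esub> x) (proj u) = c \<odot>\<^bsub>quotient_space U W\<^esub> ?a x (proj u)"
        using a[OF _ u(1)] xL O by (simp add: smult_Q)
      assume y: "y \<in> carrier ?K"
      then have yL: "y \<in> carrier L" "y \<in> K" using KL by auto
      have "x \<oplus>\<^bsub>L\<^esub> y \<in> K" using subspD(4)[OF K] x y by simp
      then show "?a (x \<oplus>\<^bsub>?K\<^esub> y) (proj u) = ?a x (proj u) \<oplus>\<^bsub>quotient_space U W\<^esub> ?a y (proj u)"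
        using a[OF _ u(1)] xL yL O by (simp add: add_Q)
    qed
  qed
  have wQ: "proj w \<in> carrier Q" unfolding Q_def carrier_Q using w(1) by blast
  have wK: "x = \<zero>\<^bsub>?K\<^esub>" if x: "x \<in> carrier ?K" and 0: "?a x (proj w) = \<zero>\<^bsub>Q\<^esub>" for x
  proof -
    have xK: "x \<in> K" using x by simp
    have "act x w \<in> carrier U" using lhomD(1)[OF act[OF KL[OF xK]] w(1)] .
    then have "act x w \<in> W" using 0 proj_zero_iff unfolding Q_def a[OF xK w(1)] by blast
    then show ?thesis using w(2)[OF KL[OF xK]] xK by (simp add: K_def W_def)
  qed
  have Qvs: "kvs Q" and Qfd: "fd Q" unfolding Q_def using vsQ fdQ[OF U(2)] by auto
  have 2: "index (carrier ?K) (dual_space Q) (dual_action Q ?a) = int (vdim Q) - int (vdim ?K)"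
  proof -
    have "index (carrier ?K) (dual_space Q) (dual_action Q ?a) =
      int (vdim Q) - int (Max {vdim (Q\<lparr>carrier := tangent_space (carrier ?K) ?a u\<rparr>) | u. u \<in> carrier Q})"
    proof (rule index_dual[OF Qvs Qfd])
      show "?a x \<in> lhom Q Q" if "x \<in> carrier ?K" for x using ahom that by simp
      show "subsp (tangent_space (carrier ?K) ?a u) Q" if "u \<in> carrier Q" for u
        unfolding tangent_space_def by (rule hom_image_subsp[OF Kvs Qvs aorb[OF that]])
    qed
    moreover have "Max {vdim (Q\<lparr>carrier := tangent_space (carrier ?K) ?a u\<rparr>) | u. u \<in> carrier Q} = vdim ?K"
      by (rule Max_orbit_dim[OF Kvs Kfd Qvs aorb wQ wK])
    ultimately show ?thesis by simp
  qed
  \<comment> \<open>Rank-nullity for the orbit map at \<open>v\<close>. Together with the dimension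
    of the quotient it turns dim Q - dim K into dim U - dim L.\<close>
  have "vdim (U\<lparr>carrier := W\<rparr>) + vdim ?K = vdim L"
    using rank_nullity_image[OF L U(1) orb[OF v] Lfd] by (simp add: W_def tangent_space_def K_def)
  moreover have "vdim Q + vdim (U\<lparr>carrier := W\<rparr>) = vdim U" unfolding Q_def by (rule vdim_Q[OF U(2)])
  ultimately show ?thesis unfolding 1 st 2 by simp
qed

section \<open>The symmetric square as a space of symmetric matrices\<close>

lemma lookup_map_times [simp]:
  "Poly_Mapping.lookup (Poly_Mapping.map ((*) c) f) k = (c::'k::field) * Poly_Mapping.lookup f k"
  by (simp add: Poly_Mapping.map.rep_eq when_def)

lemma free_space_simps [simp]:
  "carrier (free_space S) = {f. Poly_Mapping.keys f \<subseteq> S}" "\<zero>\<^bsub>free_space S\<^esub> = 0"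
  "f \<oplus>\<^bsub>free_space S\<^esub> g = f + g" "c \<odot>\<^bsub>free_space S\<^esub> f = Poly_Mapping.map ((*) c) f"
  by (simp_all add: free_space_def)

lemma keys_map_times: "Poly_Mapping.keys (Poly_Mapping.map ((*) c) f) \<subseteq> Poly_Mapping.keys (f :: 'b \<Rightarrow>\<^sub>0 'k::field)"
  by (auto simp: in_keys_iff)

lemma free_space_vs:
  fixes S :: "'b set"
  shows "kvs (free_space S :: ('k::field, 'b \<Rightarrow>\<^sub>0 'k) module)"
proof (rule kvsI, unfold free_space_simps)
  fix f g :: "'b \<Rightarrow>\<^sub>0 'k" and c
  show "f \<in> {f. Poly_Mapping.keys f \<subseteq> S} \<Longrightarrow> g \<in> {f. Poly_Mapping.keys f \<subseteq> S} \<Longrightarrow> f + g \<in> {f. Poly_Mapping.keys f \<subseteq> S}"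
    using Poly_Mapping.keys_add[of f g] by blast
  show "f \<in> {f. Poly_Mapping.keys f \<subseteq> S} \<Longrightarrow> Poly_Mapping.map ((*) c) f \<in> {f. Poly_Mapping.keys f \<subseteq> S}"
    using keys_map_times[of c f] by blast
qed (auto intro!: poly_mapping_eqI simp: lookup_add algebra_simps)

text \<open>The functional on the free space with prescribed values on the symbols, the scalar
  companion of \<open>linear_extension\<close>. Coefficients of a linear extension are again of this
  form, which reduces linearity questions to scalars.\<close>

definition sext :: "('b \<Rightarrow> 'k) \<Rightarrow> ('b \<Rightarrow>\<^sub>0 'k) \<Rightarrow> 'k::field" where
  "sext h f = (\<Sum>b\<in>Poly_Mapping.keys f. Poly_Mapping.lookup f b * h b)"

lemma sext_superset:
  "finite A \<Longrightarrow> Poly_Mapping.keys f \<subseteq> A \<Longrightarrow> sext h f = (\<Sum>b\<in>A. Poly_Mapping.lookup f b * h b)"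
  unfolding sext_def by (rule sum.mono_neutral_left) (auto simp: in_keys_iff)

lemma sext_add: "sext h (f + g) = sext h f + sext h g"
proof -
  let ?A = "Poly_Mapping.keys f \<union> Poly_Mapping.keys g"
  have "sext h (f + g) = (\<Sum>b\<in>?A. Poly_Mapping.lookup (f + g) b * h b)"
    using Poly_Mapping.keys_add[of f g] by (intro sext_superset) auto
  moreover have "sext h f = (\<Sum>b\<in>?A. Poly_Mapping.lookup f b * h b)" "sext h g = (\<Sum>b\<in>?A. Poly_Mapping.lookup g b * h b)"
    by (intro sext_superset; auto)+
  ultimately show ?thesis by (simp add: lookup_add distrib_right sum.distrib)
qed

lemma sext_smult: "sext h (Poly_Mapping.map ((*) c) f) = c * sext h f"
proof -
  have "sext h (Poly_Mapping.map ((*) c) f) = (\<Sum>b\<in>Poly_Mapping.keys f. (c * Poly_Mapping.lookup f b) * h b)"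
    using sext_superset[OF _ keys_map_times, of f h c] by simp
  then show ?thesis by (simp add: sext_def sum_distrib_left mult.assoc)
qed

lemma sext_zero [simp]: "sext h 0 = 0"
  by (simp add: sext_def)

lemma sext_single [simp]: "sext h (Poly_Mapping.single b c) = c * h b"
  using sext_superset[of "{b}" "Poly_Mapping.single b c" h] by simp

lemma sext_minus: "sext h (f - g) = sext h f - sext h g"
  using sext_add[of h "f - g" g] by simp

lemma sext_sum: "sext h (\<Sum>i\<in>A. f i) = (\<Sum>i\<in>A. sext h (f i))"
  by (induction A rule: infinite_finite_induct) (simp_all add: sext_add)

lemma sext_lincomb: "sext (\<lambda>b. \<Sum>i\<in>A. a i * h i b) f = (\<Sum>i\<in>A. a i * sext (h i) f)"
proof -
  have "sext (\<lambda>b. \<Sum>i\<in>A. a i * h i b) f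
      = (\<Sum>b\<in>Poly_Mapping.keys f. \<Sum>i\<in>A. a i * (Poly_Mapping.lookup f b * h i b))"
    by (simp add: sext_def sum_distrib_left mult.left_commute)
  also have "\<dots> = (\<Sum>i\<in>A. a i * sext (h i) f)"
    unfolding sext_def sum_distrib_left by (rule sum.swap)
  finally show ?thesis .
qed

lemma sext_add_fun: "sext (\<lambda>b. h b + h' b) f = sext h f + sext h' f"
  by (simp add: sext_def distrib_left sum.distrib)

lemma sext_cong: "(\<And>b. b \<in> Poly_Mapping.keys f \<Longrightarrow> h b = h' b) \<Longrightarrow> sext h f = sext h' f"
  by (simp add: sext_def)

lemma lookup_linear_extension:
  "Poly_Mapping.lookup (linear_extension F f) k = sext (\<lambda>b. Poly_Mapping.lookup (F b) k) f"
  by (simp add: linear_extension_def lookup_sum sext_def)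

lemma sext_linear_extension: "sext h (linear_extension F f) = sext (\<lambda>b. sext h (F b)) f"
  unfolding linear_extension_def sext_sum sext_smult by (simp add: sext_def)

lemma linear_extension_hom:
  fixes F :: "'b \<Rightarrow> ('c \<Rightarrow>\<^sub>0 'k::field)"
  assumes "\<And>b. b \<in> S \<Longrightarrow> Poly_Mapping.keys (F b) \<subseteq> S'"
  shows "linear_extension F \<in> lhom (free_space S) (free_space S')"
proof (rule lhomI)
  fix f g :: "'b \<Rightarrow>\<^sub>0 'k" and c assume f: "f \<in> carrier (free_space S)"
  have "Poly_Mapping.keys (linear_extension F f) \<subseteq> S'"
  proof
    fix k assume "k \<in> Poly_Mapping.keys (linear_extension F f)"
    then have "sext (\<lambda>b. Poly_Mapping.lookup (F b) k) f \<noteq> 0" by (simp add: in_keys_iff lookup_linear_extension)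
    then obtain b where b: "b \<in> Poly_Mapping.keys f" "Poly_Mapping.lookup (F b) k \<noteq> 0"
      unfolding sext_def by (metis (no_types, lifting) mult_zero_right sum.neutral)
    then have "k \<in> Poly_Mapping.keys (F b)" "b \<in> S" using f by (auto simp: in_keys_iff)
    then show "k \<in> S'" using assms by blast
  qed
  then show "linear_extension F f \<in> carrier (free_space S')" by simp
  show "linear_extension F (c \<odot>\<^bsub>free_space S\<^esub> f) = c \<odot>\<^bsub>free_space S'\<^esub> linear_extension F f"
    by (intro poly_mapping_eqI) (simp add: lookup_linear_extension sext_smult)
  show "linear_extension F (f \<oplus>\<^bsub>free_space S\<^esub> g) = linear_extension F f \<oplus>\<^bsub>free_space S'\<^esub> linear_extension F g"
    by (intro poly_mapping_eqI) (simp add: lookup_linear_extension sext_add lookup_add)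
qed

lemma poly_mapping_sum_single: "f = (\<Sum>b\<in>Poly_Mapping.keys f. Poly_Mapping.single b (Poly_Mapping.lookup f b))"
  by (rule poly_mapping_eqI) (auto simp: lookup_sum lookup_single when_def in_keys_iff)

section \<open>Normal forms modulo the relations of the symmetric square\<close>

locale based_space =
  fixes V :: "('k::field, 'v) module" and n :: nat and b :: "nat \<Rightarrow> 'v" and co :: "nat \<Rightarrow> 'v \<Rightarrow> 'k"
  assumes V: "kvs V" and b: "\<And>i. i < n \<Longrightarrow> b i \<in> carrier V" and co: "\<And>i. i < n \<Longrightarrow> co i \<in> lhom V ground_space"
    and co_b: "\<And>i j. i < n \<Longrightarrow> j < n \<Longrightarrow> co i (b j) = (if i = j then 1 else 0)"
    and expand: "\<And>u. u \<in> carrier V \<Longrightarrow> (\<Oplus>\<^bsub>V\<^esub>i\<in>{..<n}. co i u \<odot>\<^bsub>V\<^esub> b i) = u"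

lemma based_space_exists:
  fixes V :: "('k::field, 'v) module"
  assumes "kvs V" "fd V"
  shows "\<exists>n b co. based_space V n b co"
proof (rule coordinates[OF assms])
  fix \<beta> \<phi> assume \<beta>: "finite \<beta>" "\<beta> \<subseteq> carrier V" "\<And>b. b \<in> \<beta> \<Longrightarrow> \<phi> b \<in> lhom V ground_space"
    "\<And>b c. b \<in> \<beta> \<Longrightarrow> c \<in> \<beta> \<Longrightarrow> \<phi> b c = (if b = c then 1 else 0)"
    "\<And>u. u \<in> carrier V \<Longrightarrow> (\<Oplus>\<^bsub>V\<^esub>b\<in>\<beta>. \<phi> b u \<odot>\<^bsub>V\<^esub> b) = u"
  obtain h where h: "bij_betw h {..<card \<beta>} \<beta>" using ex_bij_betw_nat_finite[OF \<beta>(1)] by (auto simp: atLeast0LessThan)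
  then have hin: "h i \<in> \<beta>" if "i < card \<beta>" for i using that by (auto simp: bij_betw_def)
  interpret vectorspace class_ring V by fact
  have "based_space V (card \<beta>) h (\<lambda>i. \<phi> (h i))"
  proof (rule based_space.intro)
    show "kvs V" by fact
    show "h i \<in> carrier V" "\<phi> (h i) \<in> lhom V ground_space" if "i < card \<beta>" for i using hin[OF that] \<beta> by auto
    show "\<phi> (h i) (h j) = (if i = j then 1 else 0)" if "i < card \<beta>" "j < card \<beta>" for i j
      using \<beta>(4)[OF hin[OF that(1)] hin[OF that(2)]] h that by (auto simp: bij_betw_def inj_on_eq_iff)
    show "(\<Oplus>\<^bsub>V\<^esub>i\<in>{..<card \<beta>}. \<phi> (h i) u \<odot>\<^bsub>V\<^esub> h i) = u" if u: "u \<in> carrier V" for u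
    proof -
      have "(\<lambda>b. \<phi> b u \<odot>\<^bsub>V\<^esub> b) \<in> h ` {..<card \<beta>} \<rightarrow> carrier V"
        using hin \<beta>(2) by (auto intro!: kvs_closed(3)[OF assms(1)])
      then have "(\<Oplus>\<^bsub>V\<^esub>b\<in>h ` {..<card \<beta>}. \<phi> b u \<odot>\<^bsub>V\<^esub> b) = (\<Oplus>\<^bsub>V\<^esub>i\<in>{..<card \<beta>}. \<phi> (h i) u \<odot>\<^bsub>V\<^esub> h i)"
        by (rule finsum_reindex) (use h in \<open>simp add: bij_betw_def\<close>)
      then show ?thesis using \<beta>(5)[OF u] h by (simp add: bij_betw_def)
    qed
  qed
  then show ?thesis by blast
qed

lemma span_image_subset:
  assumes U: "kvs U" "subsp S U" and T: "T \<subseteq> S"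
  shows "LinearCombinations.module.span class_ring U T \<subseteq> S"
proof -
  interpret vectorspace class_ring U by fact
  show ?thesis using span_is_subset[OF T] U(2) by (auto simp: VectorSpace.subspace_def)
qed

context based_space begin

abbreviation F where "F \<equiv> (free_square V :: ('k, 'v \<times> 'v \<Rightarrow>\<^sub>0 'k) module)"
abbreviation R where "R \<equiv> sym2_relations V"

lemma F_vs: "kvs F" by (rule free_space_vs)

lemma F_minus: "f \<in> carrier F \<Longrightarrow> g \<in> carrier F \<Longrightarrow> f - g \<in> carrier F"
  using keys_diff[of f g] by auto

lemma F_single: "u \<in> carrier V \<Longrightarrow> w \<in> carrier V \<Longrightarrow> Poly_Mapping.single (u, w) c \<in> carrier F"
  by simp

lemmas V_closed = kvs_closed[OF V]

definition rels :: "('v \<times> 'v \<Rightarrow>\<^sub>0 'k) set" where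
  "rels = {pure (u \<oplus>\<^bsub>V\<^esub> u') w - pure u w - pure u' w | u u' w.
         u \<in> carrier V \<and> u' \<in> carrier V \<and> w \<in> carrier V} \<union>
      {pure u (w \<oplus>\<^bsub>V\<^esub> w') - pure u w - pure u w' | u w w'.
         u \<in> carrier V \<and> w \<in> carrier V \<and> w' \<in> carrier V} \<union>
      {pure (c \<odot>\<^bsub>V\<^esub> u) w - Poly_Mapping.single (u, w) c | c u w.
         u \<in> carrier V \<and> w \<in> carrier V} \<union>
      {pure u (c \<odot>\<^bsub>V\<^esub> w) - Poly_Mapping.single (u, w) c | c u w.
         u \<in> carrier V \<and> w \<in> carrier V} \<union>
      {pure u w - pure w u | u w. u \<in> carrier V \<and> w \<in> carrier V}"

lemma R_eq: "R = LinearCombinations.module.span class_ring F rels"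
  by (simp only: sym2_relations_def rels_def)

lemma rels_carrier: "rels \<subseteq> carrier F"
  unfolding rels_def by (safe; intro F_minus F_single V_closed; assumption)

lemma R_subsp: "subsp R F"
proof -
  interpret vectorspace class_ring F by (rule F_vs)
  show ?thesis unfolding R_eq by (rule span_is_subspace[OF rels_carrier])
qed

lemma rels_R: "r \<in> rels \<Longrightarrow> r \<in> R"
proof -
  interpret vectorspace class_ring F by (rule F_vs)
  show "r \<in> rels \<Longrightarrow> r \<in> R" unfolding R_eq using in_own_span[OF rels_carrier] by blast
qed

lemma R_closed:
  shows R_zero: "0 \<in> R" and R_add: "f \<in> R \<Longrightarrow> g \<in> R \<Longrightarrow> f + g \<in> R"
    and R_smult: "f \<in> R \<Longrightarrow> Poly_Mapping.map ((*) c) f \<in> R"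
  using subspD(3-5)[OF R_subsp] by simp_all

lemma R_sum: "(\<And>i. i \<in> A \<Longrightarrow> f i \<in> R) \<Longrightarrow> (\<Sum>i\<in>A. f i) \<in> R"
  by (induction A rule: infinite_finite_induct) (simp_all add: R_zero R_add)

lemma R_trans: "f - g \<in> R \<Longrightarrow> g - h \<in> R \<Longrightarrow> f - h \<in> R"
  using R_add[of "f - g" "g - h"] by simp

lemma rel_add_left: "u \<in> carrier V \<Longrightarrow> u' \<in> carrier V \<Longrightarrow> w \<in> carrier V \<Longrightarrow>
    pure (u \<oplus>\<^bsub>V\<^esub> u') w - pure u w - pure u' w \<in> R"
  and rel_smult_left: "u \<in> carrier V \<Longrightarrow> w \<in> carrier V \<Longrightarrow> pure (c \<odot>\<^bsub>V\<^esub> u) w - Poly_Mapping.single (u, w) c \<in> R"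
  and rel_smult_right: "u \<in> carrier V \<Longrightarrow> w \<in> carrier V \<Longrightarrow> pure u (c \<odot>\<^bsub>V\<^esub> w) - Poly_Mapping.single (u, w) c \<in> R"
  and rel_swap: "u \<in> carrier V \<Longrightarrow> w \<in> carrier V \<Longrightarrow> pure u w - pure w u \<in> R"
  by (rule rels_R; unfold rels_def; blast)+

lemma map_single: "Poly_Mapping.map ((*) c) (Poly_Mapping.single k d) = Poly_Mapping.single k (c * d :: 'k)"
  by (rule poly_mapping_eqI) (simp add: lookup_single when_def)

lemma pure_sum_left:
  assumes "finite A" "g \<in> A \<rightarrow> carrier V" "w \<in> carrier V"
  shows "pure (\<Oplus>\<^bsub>V\<^esub>a\<in>A. g a) w - (\<Sum>a\<in>A. pure (g a) w) \<in> R"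
proof -
  interpret vectorspace class_ring V by (rule V)
  from assms(1,2) show ?thesis
  proof (induction A rule: finite_induct)
    case empty
    \<comment> \<open>For the empty sum, the relation with scalar 0 says that a product with the
      zero vector is trivial.\<close>
    then show ?case using rel_smult_left[OF V_closed(1) assms(3), of 0] by (simp add: lmult_0)
  next
    case (insert a A)
    then have g: "g a \<in> carrier V" "g \<in> A \<rightarrow> carrier V" by auto
    have s: "(\<Oplus>\<^bsub>V\<^esub>a\<in>A. g a) \<in> carrier V" using g by simp
    have "(pure (g a \<oplus>\<^bsub>V\<^esub> (\<Oplus>\<^bsub>V\<^esub>a\<in>A. g a)) w - pure (g a) w - pure (\<Oplus>\<^bsub>V\<^esub>a\<in>A. g a) w)
      + (pure (\<Oplus>\<^bsub>V\<^esub>a\<in>A. g a) w - (\<Sum>a\<in>A. pure (g a) w)) \<in> R"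
      by (rule R_add[OF rel_add_left[OF g(1) s assms(3)] insert.IH[OF g(2)]])
    then show ?case using insert g by (simp add: algebra_simps)
  qed
qed

lemma pure_sum_right:
  assumes "finite A" "g \<in> A \<rightarrow> carrier V" "w \<in> carrier V"
  shows "pure w (\<Oplus>\<^bsub>V\<^esub>a\<in>A. g a) - (\<Sum>a\<in>A. pure w (g a)) \<in> R"
proof -
  interpret vectorspace class_ring V by (rule V)
  have s: "(\<Oplus>\<^bsub>V\<^esub>a\<in>A. g a) \<in> carrier V" using assms(2) by simp
  have "(\<Sum>a\<in>A. pure (g a) w) - (\<Sum>a\<in>A. pure w (g a)) \<in> R"
    unfolding sum_subtractf[symmetric] using assms by (intro R_sum rel_swap) auto
  from R_trans[OF rel_swap[OF assms(3) s] R_trans[OF pure_sum_left[OF assms] this]] show ?thesis .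
qed

lemma pure_expand:
  assumes u: "u \<in> carrier V" and w: "w \<in> carrier V"
  shows "pure u w - (\<Sum>i<n. \<Sum>j<n. Poly_Mapping.single (b i, b j) (co i u * co j w)) \<in> R"
proof -
  have cb: "c \<odot>\<^bsub>V\<^esub> b i \<in> carrier V" if "i < n" for c i using b[OF that] V_closed by blast
  have 1: "pure u w - (\<Sum>i<n. pure (co i u \<odot>\<^bsub>V\<^esub> b i) w) \<in> R"
    using pure_sum_left[of "{..<n}" "\<lambda>i. co i u \<odot>\<^bsub>V\<^esub> b i" w] cb w expand[OF u] by auto
  have 2: "pure x w - (\<Sum>j<n. Poly_Mapping.single (x, b j) (co j w)) \<in> R" if x: "x \<in> carrier V" for x
  proof (rule R_trans)
    show "pure x w - (\<Sum>j<n. pure x (co j w \<odot>\<^bsub>V\<^esub> b j)) \<in> R"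
      using pure_sum_right[of "{..<n}" "\<lambda>j. co j w \<odot>\<^bsub>V\<^esub> b j" x] cb x expand[OF w] by auto
    show "(\<Sum>j<n. pure x (co j w \<odot>\<^bsub>V\<^esub> b j)) - (\<Sum>j<n. Poly_Mapping.single (x, b j) (co j w)) \<in> R"
      unfolding sum_subtractf[symmetric] using x b by (intro R_sum rel_smult_right) auto
  qed
  have 3: "pure (co i u \<odot>\<^bsub>V\<^esub> b i) w - (\<Sum>j<n. Poly_Mapping.single (b i, b j) (co i u * co j w)) \<in> R" if i: "i < n" for i
  proof (rule R_trans[OF rel_smult_left[OF b[OF i] w]])
    have "Poly_Mapping.map ((*) (co i u)) (pure (b i) w - (\<Sum>j<n. Poly_Mapping.single (b i, b j) (co j w))) \<in> R"
      by (rule R_smult[OF 2[OF b[OF i]]])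
    also have "Poly_Mapping.map ((*) (co i u)) (pure (b i) w - (\<Sum>j<n. Poly_Mapping.single (b i, b j) (co j w)))
      = Poly_Mapping.single (b i, w) (co i u) - (\<Sum>j<n. Poly_Mapping.single (b i, b j) (co i u * co j w))"
      by (rule poly_mapping_eqI)
         (simp add: lookup_minus lookup_sum right_diff_distrib sum_distrib_left lookup_single when_def if_distrib cong: if_cong)
    finally show "Poly_Mapping.single (b i, w) (co i u) - (\<Sum>j<n. Poly_Mapping.single (b i, b j) (co i u * co j w)) \<in> R" .
  qed
  show ?thesis
    by (rule R_trans[OF 1]) (unfold sum_subtractf[symmetric], intro R_sum 3, simp)
qed

text \<open>Bilinearity reduces every symbol to basis products, with coefficients given by products
  of coordinates. The two orders of a pair of distinct basis vectors are both kept here; they are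
  merged only when the kernel of \<open>Phi\<close> is computed.\<close>

lemma free_expand:
  assumes f: "f \<in> carrier F"
  shows "f - (\<Sum>i<n. \<Sum>j<n. Poly_Mapping.single (b i, b j) (sext (\<lambda>(u, w). co i u * co j w) f)) \<in> R"
proof -
  let ?g = "\<lambda>p. \<Sum>i<n. \<Sum>j<n. Poly_Mapping.single (b i, b j) (co i (fst p) * co j (snd p))"
  have "f - (\<Sum>p\<in>Poly_Mapping.keys f. Poly_Mapping.map ((*) (Poly_Mapping.lookup f p)) (?g p)) \<in> R"
  proof -
    have "Poly_Mapping.single p c - Poly_Mapping.map ((*) c) (?g p) \<in> R" if p: "p \<in> Poly_Mapping.keys f" for p c
    proof -
      have "fst p \<in> carrier V" "snd p \<in> carrier V" using p f by auto
      then have "Poly_Mapping.map ((*) c) (pure (fst p) (snd p) - ?g p) \<in> R" by (intro R_smult pure_expand)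
      also have "Poly_Mapping.map ((*) c) (pure (fst p) (snd p) - ?g p) = Poly_Mapping.single p c - Poly_Mapping.map ((*) c) (?g p)"
        by (rule poly_mapping_eqI) (simp add: lookup_minus right_diff_distrib lookup_single when_def)
      finally show ?thesis .
    qed
    then show ?thesis by (subst (1) poly_mapping_sum_single[of f], unfold sum_subtractf[symmetric], intro R_sum) blast
  qed
  also have "(\<Sum>p\<in>Poly_Mapping.keys f. Poly_Mapping.map ((*) (Poly_Mapping.lookup f p)) (?g p)) =
      (\<Sum>i<n. \<Sum>j<n. Poly_Mapping.single (b i, b j) (sext (\<lambda>(u, w). co i u * co j w) f))" (is "?l = ?r")
  proof (rule poly_mapping_eqI)
    fix k
    let ?d = "\<lambda>i j. if (b i, b j) = k then 1 else 0 :: 'k"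
    have s: "Poly_Mapping.lookup (Poly_Mapping.single (b i, b j) c) k = ?d i j * c" for i j c
      by (simp add: lookup_single when_def)
    have "Poly_Mapping.lookup ?l k = (\<Sum>p\<in>Poly_Mapping.keys f. \<Sum>i<n. \<Sum>j<n.
        ?d i j * (Poly_Mapping.lookup f p * (co i (fst p) * co j (snd p))))"
      by (simp only: lookup_sum lookup_map_times s sum_distrib_left mult.left_commute)
    also have "\<dots> = (\<Sum>i<n. \<Sum>j<n. \<Sum>p\<in>Poly_Mapping.keys f.
        ?d i j * (Poly_Mapping.lookup f p * (co i (fst p) * co j (snd p))))"
      by (subst sum.swap) (intro sum.cong refl sum.swap)
    also have "\<dots> = Poly_Mapping.lookup ?r k"
      by (simp only: lookup_sum s sext_def sum_distrib_left case_prod_beta)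
    finally show "Poly_Mapping.lookup ?l k = Poly_Mapping.lookup ?r k" .
  qed
  finally show ?thesis .
qed

end

section \<open>The symmetric square as symmetric matrices, with both actions\<close>

locale quadratic_space = based_space V n b co
  for V :: "('k::{alg_closed_field, field_char_0}, 'v) module" and n b co +
  fixes B :: "'v \<Rightarrow> 'v \<Rightarrow> 'k"
  assumes B: "nondegenerate_symmetric_form V B"
begin

text \<open>The entry (i, j) of u w^T + w u^T in coordinates. The factor 1/2 of symmetrisation is
  left out, so \<open>Phi\<close> gives twice the usual symmetric matrix of a tensor.\<close>

definition sprod :: "nat \<Rightarrow> nat \<Rightarrow> 'v \<times> 'v \<Rightarrow> 'k" where
  "sprod i j = (\<lambda>(u, w). co i u * co j w + co i w * co j u)"

definition Phi :: "('v \<times> 'v \<Rightarrow>\<^sub>0 'k) \<Rightarrow> 'k mat" where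
  "Phi f = mat n n (\<lambda>(i, j). sext (sprod i j) f)"

abbreviation M :: "'k mat set" where "M \<equiv> carrier_mat n n"

lemma Phi_M [simp]: "Phi f \<in> M" by (simp add: Phi_def)
lemma Phi_dim [simp]: "dim_row (Phi f) = n" "dim_col (Phi f) = n" by (simp_all add: Phi_def)

lemma Phi_index: "i < n \<Longrightarrow> j < n \<Longrightarrow> Phi f $$ (i, j) = sext (sprod i j) f" by (simp add: Phi_def)

lemma Phi_sym: "transpose_mat (Phi f) = Phi f"
proof (rule eq_matI)
  have "sprod i j = sprod j i" for i j by (auto simp: sprod_def fun_eq_iff)
  then show "transpose_mat (Phi f) $$ (i, j) = Phi f $$ (i, j)" if "i < dim_row (Phi f)" "j < dim_col (Phi f)" for i j
    using that by (simp add: Phi_index)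
qed simp_all

lemma Phi_add: "Phi (f + g) = Phi f + Phi g"
  by (rule eq_matI) (simp_all add: Phi_index sext_add)

lemma Phi_minus: "Phi (f - g) = Phi f - Phi g"
  by (rule eq_matI) (simp_all add: Phi_index sext_minus)

lemma Phi_smult: "Phi (Poly_Mapping.map ((*) c) f) = c \<cdot>\<^sub>m Phi f"
  by (rule eq_matI) (simp_all add: Phi_index sext_smult)

text \<open>Each matrix entry is a linear functional that is zero on the generating relations, hence
  on their span.\<close>

lemma Phi_R:
  assumes "f \<in> R" shows "Phi f = 0\<^sub>m n n"
proof -
  have "sext (sprod i j) f = 0" if ij: "i < n" "j < n" for i j
  proof -
    note c = lhomD[OF co[OF ij(1)]] lhomD[OF co[OF ij(2)]]
    have sub: "subsp {f \<in> carrier F. sext (sprod i j) f = 0} F"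
      by (rule subspI[OF F_vs]) (use kvs_closed[OF F_vs] in \<open>auto simp: sext_add sext_smult\<close>)
    have "rels \<subseteq> {f \<in> carrier F. sext (sprod i j) f = 0}"
    proof
      fix r assume r: "r \<in> rels"
      have "sext (sprod i j) r = 0" using r unfolding rels_def
        by (elim UnE CollectE exE conjE; hypsubst) (simp_all add: sext_minus sprod_def c, simp_all add: algebra_simps)
      then show "r \<in> {f \<in> carrier F. sext (sprod i j) f = 0}" using r rels_carrier by blast
    qed
    from span_image_subset[OF F_vs sub this] show ?thesis using assms unfolding R_eq by blast
  qed
  then show ?thesis by (intro eq_matI) (simp_all add: Phi_index)
qed

text \<open>If all symmetrised entries vanish, the coefficients of the normal form \<open>Z\<close>
  are antisymmetric. Doubling \<open>Z\<close> and exchanging indices in one copy exhibits it as a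
  combination of the relations that swap the factors; dividing by 2 puts \<open>Z\<close> itself
  into \<open>R\<close>.\<close>

lemma R_if_Phi_zero:
  assumes f: "f \<in> carrier F" and 0: "Phi f = 0\<^sub>m n n"
  shows "f \<in> R"
proof -
  define m where "m i j = sext (\<lambda>(u, w). co i u * co j w) f" for i j
  define Z where "Z = (\<Sum>i<n. \<Sum>j<n. Poly_Mapping.single (b i, b j) (m i j))"
  have anti: "m j i = - m i j" if "i < n" "j < n" for i j
  proof -
    have "sext (sprod i j) f = m i j + m j i"
      unfolding m_def sext_add_fun[symmetric] by (rule sext_cong) (auto simp: sprod_def mult.commute)
    then have "m i j + m j i = 0" using that Phi_index[of i j f] unfolding 0 by simp
    then show ?thesis by (simp add: eq_neg_iff_add_eq_0 add.commute)
  qed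
  have "Z = (\<Sum>i<n. \<Sum>j<n. Poly_Mapping.single (b j, b i) (m j i))" unfolding Z_def by (rule sum.swap)
  also have "\<dots> = - (\<Sum>i<n. \<Sum>j<n. Poly_Mapping.single (b j, b i) (m i j))"
    unfolding sum_negf[symmetric]
  proof (intro sum.cong refl)
    fix i j assume "i \<in> {..<n}" "j \<in> {..<n}"
    then have "m j i = - m i j" by (intro anti) simp_all
    then show "Poly_Mapping.single (b j, b i) (m j i) = - Poly_Mapping.single (b j, b i) (m i j)"
      by (simp add: single_uminus)
  qed
  finally have "Z + Z = (\<Sum>i<n. \<Sum>j<n. Poly_Mapping.single (b i, b j) (m i j) - Poly_Mapping.single (b j, b i) (m i j))"
    unfolding sum_subtractf by (simp add: Z_def)
  moreover have "Poly_Mapping.single (b i, b j) (m i j) - Poly_Mapping.single (b j, b i) (m i j) \<in> R" if ij: "i < n" "j < n" for i j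
  proof -
    have "Poly_Mapping.map ((*) (m i j)) (pure (b i) (b j) - pure (b j) (b i)) \<in> R"
      by (intro R_smult rel_swap b ij)
    also have "Poly_Mapping.map ((*) (m i j)) (pure (b i) (b j) - pure (b j) (b i))
        = Poly_Mapping.single (b i, b j) (m i j) - Poly_Mapping.single (b j, b i) (m i j)"
      by (rule poly_mapping_eqI) (simp add: lookup_minus lookup_single when_def)
    finally show ?thesis .
  qed
  ultimately have "Z + Z \<in> R" by (auto intro!: R_sum)
  then have "Poly_Mapping.map ((*) (1/2)) (Z + Z) \<in> R" by (rule R_smult)
  also have "Poly_Mapping.map ((*) (1/2)) (Z + Z) = Z" by (rule poly_mapping_eqI) (simp add: lookup_add)
  finally have "Z \<in> R" .
  moreover have "f - Z \<in> R" using free_expand[OF f] unfolding Z_def m_def .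
  ultimately show ?thesis using R_add[of "f - Z" Z] by simp
qed

sublocale Sq: quotient F R
  by (rule quotient.intro[OF R_subsp])

lemma sym2_eq: "sym2 V = Sq.Q" by (simp add: sym2_def)

lemma proj_eq_iff_Phi:
  assumes "f \<in> carrier F" "g \<in> carrier F"
  shows "Sq.proj f = Sq.proj g \<longleftrightarrow> Phi f = Phi g"
proof
  assume "Sq.proj f = Sq.proj g"
  then obtain s where "s \<in> R" "f = s + g" using Sq.proj_eq_iff[OF assms] by auto
  then show "Phi f = Phi g" using Phi_R[of s] by (simp add: Phi_add)
next
  assume "Phi f = Phi g"
  then have "Phi (f - g) = 0\<^sub>m n n" by (simp add: Phi_minus minus_r_inv_mat[of _ n n])
  then have "f - g \<in> R" by (rule R_if_Phi_zero[OF F_minus[OF assms]])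
  then show "Sq.proj f = Sq.proj g" using Sq.proj_eq_iff[OF assms] by force
qed

lemma Phi_surj:
  assumes T: "T \<in> M" "transpose_mat T = T"
  obtains f where "f \<in> carrier F" "Phi f = T"
proof -
  \<comment> \<open>The halves compensate for the missing 1/2 in \<open>sprod\<close>.\<close>
  let ?f = "(\<Sum>i<n. \<Sum>j<n. Poly_Mapping.single (b i, b j) (T $$ (i, j) / 2))"
  have "Poly_Mapping.keys ?f \<subseteq> carrier V \<times> carrier V"
  proof -
    have *: "Poly_Mapping.keys (\<Sum>i<n. g i) \<subseteq> X" if "\<And>i. i < n \<Longrightarrow> Poly_Mapping.keys (g i) \<subseteq> X"
      for g :: "nat \<Rightarrow> 'v \<times> 'v \<Rightarrow>\<^sub>0 'k" and X
    proof -
      have "(\<Union>i\<in>{..<n}. Poly_Mapping.keys (g i)) \<subseteq> X" using that by (intro UN_least) simp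
      then show ?thesis by (rule order.trans[OF Poly_Mapping.keys_sum])
    qed
    show ?thesis by (intro *) (simp add: b)
  qed
  then have fF: "?f \<in> carrier F" by simp
  have sym: "T $$ (j, i) = T $$ (i, j)" if "i < n" "j < n" for i j
    using that T(1) arg_cong[OF T(2), of "\<lambda>X. X $$ (i, j)"] by simp
  have "Phi ?f = T"
  proof (rule eq_matI)
    fix k l assume "k < dim_row T" "l < dim_col T"
    then have kl: "k < n" "l < n" using T by auto
    have "Phi ?f $$ (k, l) = (\<Sum>i<n. \<Sum>j<n. (T $$ (i, j) / 2) * (co k (b i) * co l (b j) + co k (b j) * co l (b i)))"
      using kl by (simp add: Phi_index sext_sum sprod_def)
    also have "\<dots> = (\<Sum>i<n. \<Sum>j<n. (if j = l then if i = k then T $$ (i, j) / 2 else 0 else 0) + (if j = k then if i = l then T $$ (i, j) / 2 else 0 else 0))"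
      using kl by (intro sum.cong refl) (auto simp: co_b)
    also have "\<dots> = T $$ (k, l) / 2 + T $$ (l, k) / 2"
      using kl by (simp add: sum.distrib)
    finally show "Phi ?f $$ (k, l) = T $$ (k, l)" using sym kl by simp
  qed (use T in simp_all)
  then show thesis by (rule that[OF fF])
qed

definition matrix :: "('v \<Rightarrow> 'v) \<Rightarrow> 'k mat" where
  "matrix x = mat n n (\<lambda>(i, j). co i (x (b j)))"

lemma matrix_M [simp]: "matrix x \<in> M" by (simp add: matrix_def)
lemma matrix_dim [simp]: "dim_row (matrix x) = n" "dim_col (matrix x) = n" by (simp_all add: matrix_def)

lemma functional_expand:
  assumes \<psi>: "\<psi> \<in> lhom V ground_space" and u: "u \<in> carrier V"
  shows "\<psi> u = (\<Sum>i<n. co i u * \<psi> (b i))"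
proof -
  have "(\<lambda>i. co i u \<odot>\<^bsub>V\<^esub> b i) \<in> {..<n} \<rightarrow> carrier V" using b by (auto intro!: V_closed(3))
  from dual_finsum[OF V \<psi> _ this] have "\<psi> u = (\<Sum>i<n. \<psi> (co i u \<odot>\<^bsub>V\<^esub> b i))" using expand[OF u] by simp
  then show ?thesis using lhomD(3)[OF \<psi>] b by simp
qed

lemma lhom_comp: "f \<in> lhom U W \<Longrightarrow> g \<in> lhom W Z \<Longrightarrow> (\<lambda>u. g (f u)) \<in> lhom U Z"
  by (rule lhomI) (simp_all add: lhomD)

lemma co_apply:
  assumes x: "x \<in> lhom V V" and i: "i < n" and u: "u \<in> carrier V"
  shows "co i (x u) = (\<Sum>k<n. matrix x $$ (i, k) * co k u)"
  using functional_expand[OF lhom_comp[OF x co[OF i]] u] i by (simp add: matrix_def mult.commute)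

lemma sprod_lie:
  assumes x: "x \<in> lhom V V" and ij: "i < n" "j < n" and u: "u \<in> carrier V" "w \<in> carrier V"
  shows "sprod i j (x u, w) + sprod i j (u, x w) =
    (\<Sum>k<n. matrix x $$ (i, k) * sprod k j (u, w)) + (\<Sum>k<n. matrix x $$ (j, k) * sprod i k (u, w))"
  unfolding sprod_def using u
  by (simp add: co_apply[OF x] ij sum_distrib_left sum_distrib_right distrib_left sum.distrib mult_ac)

lemma sprod_group:
  assumes x: "x \<in> lhom V V" and ij: "i < n" "j < n" and u: "u \<in> carrier V" "w \<in> carrier V"
  shows "sprod i j (x u, x w) = (\<Sum>k<n. matrix x $$ (i, k) * (\<Sum>l<n. matrix x $$ (j, l) * sprod k l (u, w)))"
proof -
  have "co i (x u) * co j (x w) = (\<Sum>k<n. matrix x $$ (i, k) * (\<Sum>l<n. matrix x $$ (j, l) * (co k u * co l w)))"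
    if "u \<in> carrier V" "w \<in> carrier V" for u w
    unfolding co_apply[OF x ij(1) that(1)] co_apply[OF x ij(2) that(2)] sum_product
    by (intro sum.cong refl) (simp add: sum_distrib_left mult_ac)
  from this[OF u] this[OF u(2,1)] show ?thesis
    unfolding sprod_def by (simp add: distrib_left sum.distrib)
qed

lemma mat_mult_index: "X \<in> M \<Longrightarrow> Y \<in> M \<Longrightarrow> i < n \<Longrightarrow> j < n \<Longrightarrow> (X * Y) $$ (i, j) = (\<Sum>k<n. X $$ (i, k) * Y $$ (k, j))"
  by (simp add: scalar_prod_def atLeast0LessThan)

abbreviation lieF where "lieF x \<equiv> linear_extension (\<lambda>(u, w). pure (x u) w + pure u (x w)) :: ('v \<times> 'v \<Rightarrow>\<^sub>0 'k) \<Rightarrow> _"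
abbreviation grpF where "grpF g \<equiv> linear_extension (\<lambda>(u, w). pure (g u) (g w)) :: ('v \<times> 'v \<Rightarrow>\<^sub>0 'k) \<Rightarrow> _"

lemma Phi_lie:
  assumes x: "x \<in> lhom V V" and f: "f \<in> carrier F"
  shows "Phi (lieF x f) = matrix x * Phi f + Phi f * transpose_mat (matrix x)"
proof (rule eq_matI)
  fix i j assume "i < dim_row (matrix x * Phi f + Phi f * transpose_mat (matrix x))"
    "j < dim_col (matrix x * Phi f + Phi f * transpose_mat (matrix x))"
  then have ij: "i < n" "j < n" by auto
  have "Phi (lieF x f) $$ (i, j) = sext (\<lambda>p. (\<Sum>k<n. matrix x $$ (i, k) * sprod k j p) + (\<Sum>k<n. matrix x $$ (j, k) * sprod i k p)) f"
    unfolding Phi_index[OF ij] sext_linear_extension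
  proof (rule sext_cong)
    fix p assume "p \<in> Poly_Mapping.keys f"
    then obtain u w where p: "p = (u, w)" "u \<in> carrier V" "w \<in> carrier V" using f by auto
    show "sext (sprod i j) (case p of (u, w) \<Rightarrow> pure (x u) w + pure u (x w)) =
      (\<Sum>k<n. matrix x $$ (i, k) * sprod k j p) + (\<Sum>k<n. matrix x $$ (j, k) * sprod i k p)"
      unfolding p(1) sprod_lie[OF x ij p(2,3), symmetric] by (simp add: sext_add)
  qed
  also have "\<dots> = (\<Sum>k<n. matrix x $$ (i, k) * Phi f $$ (k, j)) + (\<Sum>k<n. matrix x $$ (j, k) * Phi f $$ (i, k))"
    unfolding sext_add_fun sext_lincomb using ij by (simp add: Phi_index)
  also have "\<dots> = (matrix x * Phi f + Phi f * transpose_mat (matrix x)) $$ (i, j)"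
    using ij mat_mult_index[of "matrix x" "Phi f" i j] mat_mult_index[of "Phi f" "transpose_mat (matrix x)" i j]
    by (simp add: mult.commute del: index_mult_mat(1))
  finally show "Phi (lieF x f) $$ (i, j) = (matrix x * Phi f + Phi f * transpose_mat (matrix x)) $$ (i, j)" .
qed simp_all

lemma Phi_grp:
  assumes x: "x \<in> lhom V V" and f: "f \<in> carrier F"
  shows "Phi (grpF x f) = matrix x * Phi f * transpose_mat (matrix x)"
proof (rule eq_matI)
  fix i j assume "i < dim_row (matrix x * Phi f * transpose_mat (matrix x))"
    "j < dim_col (matrix x * Phi f * transpose_mat (matrix x))"
  then have ij: "i < n" "j < n" by auto
  have "Phi (grpF x f) $$ (i, j) = sext (\<lambda>p. (\<Sum>k<n. matrix x $$ (i, k) * (\<Sum>l<n. matrix x $$ (j, l) * sprod k l p))) f"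
    unfolding Phi_index[OF ij] sext_linear_extension
  proof (rule sext_cong)
    fix p assume "p \<in> Poly_Mapping.keys f"
    then obtain u w where p: "p = (u, w)" "u \<in> carrier V" "w \<in> carrier V" using f by auto
    show "sext (sprod i j) (case p of (u, w) \<Rightarrow> pure (x u) (x w)) =
      (\<Sum>k<n. matrix x $$ (i, k) * (\<Sum>l<n. matrix x $$ (j, l) * sprod k l p))"
      unfolding p(1) sprod_group[OF x ij p(2,3), symmetric] by simp
  qed
  also have "\<dots> = (\<Sum>k<n. matrix x $$ (i, k) * (\<Sum>l<n. matrix x $$ (j, l) * Phi f $$ (k, l)))"
    unfolding sext_lincomb using ij by (simp add: Phi_index)
  also have "\<dots> = (matrix x * (Phi f * transpose_mat (matrix x))) $$ (i, j)"
    using ij mult_carrier_mat[of "Phi f" n n "transpose_mat (matrix x)" n]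
      mat_mult_index[of "matrix x" "Phi f * transpose_mat (matrix x)" i j] mat_mult_index[of "Phi f" "transpose_mat (matrix x)" _ j]
    by (simp add: mult.commute del: index_mult_mat(1))
  also have "matrix x * (Phi f * transpose_mat (matrix x)) = matrix x * Phi f * transpose_mat (matrix x)"
    by (rule assoc_mult_mat[of _ n n _ n _ n, symmetric]) simp_all
  finally show "Phi (grpF x f) $$ (i, j) = (matrix x * Phi f * transpose_mat (matrix x)) $$ (i, j)" .
qed simp_all

lemma lieF_hom: "x \<in> lhom V V \<Longrightarrow> lieF x \<in> lhom F F"
proof (rule linear_extension_hom)
  fix p assume x: "x \<in> lhom V V" and "p \<in> carrier V \<times> carrier V"
  then obtain u w where p: "p = (u, w)" "u \<in> carrier V" "w \<in> carrier V" by auto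
  have "pure (x u) w + pure u (x w) \<in> carrier F"
    using kvs_closed(2)[OF F_vs F_single F_single, of "x u" w u "x w" 1 1] p lhomD(1)[OF x] by simp
  then show "Poly_Mapping.keys ((case p of (u, w) \<Rightarrow> pure (x u) w + pure u (x w)) :: 'v \<times> 'v \<Rightarrow>\<^sub>0 'k) \<subseteq> carrier V \<times> carrier V"
    using p by simp
qed

lemma grpF_hom: "x \<in> lhom V V \<Longrightarrow> grpF x \<in> lhom F F"
  by (rule linear_extension_hom) (auto simp: lhomD)

text \<open>Since \<open>R\<close> is the kernel of \<open>Phi\<close> on \<open>F\<close>, and
  \<open>Phi\<close> turns the action into a linear map on matrices, stability needs no inspection
  of the generating relations.\<close>

lemma lieF_R: "x \<in> lhom V V \<Longrightarrow> f \<in> R \<Longrightarrow> lieF x f \<in> R"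
  using Phi_R[of f] Phi_lie[of x f] Sq.S_carrier[of f] lhomD(1)[OF lieF_hom, of x f]
  by (intro R_if_Phi_zero) (auto simp: left_mult_zero_mat[of _ n n] right_mult_zero_mat[of _ n n])

lemma grpF_R: "x \<in> lhom V V \<Longrightarrow> f \<in> R \<Longrightarrow> grpF x f \<in> R"
  using Phi_R[of f] Phi_grp[of x f] Sq.S_carrier[of f] lhomD(1)[OF grpF_hom, of x f]
  by (intro R_if_Phi_zero) (auto simp: left_mult_zero_mat[of _ n n] right_mult_zero_mat[of _ n n])

lemma lie_proj:
  assumes "x \<in> lhom V V" "f \<in> carrier F"
  shows "sym2_lie_action V x (Sq.proj f) = Sq.proj (lieF x f)"
  unfolding sym2_lie_action_def
  by (rule Sq.quotient_action_proj[where act = lieF and x = x, OF lieF_hom[OF assms(1)] lieF_R[OF assms(1)] assms(2)])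

lemma lie_hom: "x \<in> lhom V V \<Longrightarrow> sym2_lie_action V x \<in> lhom (sym2 V) (sym2 V)"
  unfolding sym2_lie_action_def sym2_eq
  by (rule Sq.quotient_action_hom[where act = lieF and x = x, OF lieF_hom lieF_R])

lemma grp_proj:
  assumes "x \<in> lhom V V" "f \<in> carrier F"
  shows "sym2_group_action V x (Sq.proj f) = Sq.proj (grpF x f)"
  unfolding sym2_group_action_def
  by (rule Sq.quotient_action_proj[where act = grpF and x = x, OF grpF_hom[OF assms(1)] grpF_R[OF assms(1)] assms(2)])

section \<open>The Gram matrix, skew and orthogonal matrices\<close>

definition Gram :: "'k mat" where "Gram = mat n n (\<lambda>(i, j). B (b i) (b j))"

lemma Gram_M [simp]: "Gram \<in> M" by (simp add: Gram_def)
lemma Gram_dim [simp]: "dim_row Gram = n" "dim_col Gram = n" by (simp_all add: Gram_def)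

lemma B_right: "u \<in> carrier V \<Longrightarrow> (\<lambda>w. B u w) \<in> lhom V ground_space"
  and B_left: "w \<in> carrier V \<Longrightarrow> (\<lambda>u. B u w) \<in> lhom V ground_space"
  and B_sym: "u \<in> carrier V \<Longrightarrow> w \<in> carrier V \<Longrightarrow> B u w = B w u"
  and B_nondegenerate: "u \<in> carrier V \<Longrightarrow> (\<And>w. w \<in> carrier V \<Longrightarrow> B u w = 0) \<Longrightarrow> u = \<zero>\<^bsub>V\<^esub>"
  using B unfolding nondegenerate_symmetric_form_def by blast+

lemma Gram_sym: "transpose_mat Gram = Gram"
  by (rule eq_matI) (simp_all add: Gram_def B_sym b)

lemma co_eqI:
  assumes "u \<in> carrier V" "w \<in> carrier V" "\<And>i. i < n \<Longrightarrow> co i u = co i w"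
  shows "u = w"
proof -
  interpret vectorspace class_ring V by (rule V)
  have "(\<Oplus>\<^bsub>V\<^esub>i\<in>{..<n}. co i u \<odot>\<^bsub>V\<^esub> b i) = (\<Oplus>\<^bsub>V\<^esub>i\<in>{..<n}. co i w \<odot>\<^bsub>V\<^esub> b i)"
    using assms(3) b by (intro finsum_cong2) (auto intro!: V_closed(3))
  then show ?thesis using expand assms(1,2) by simp
qed

lemma co_zero: "i < n \<Longrightarrow> co i \<zero>\<^bsub>V\<^esub> = 0"
  using lhom_zero[OF V ground_space_vs co] by simp

text \<open>A kernel vector of the Gram matrix holds the coordinates of a vector \<open>u\<close>
  orthogonal to the whole basis, hence to the whole space, so \<open>u\<close> is zero by
  non-degeneracy.\<close>

lemma Gram_det: "det Gram \<noteq> 0"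
proof
  assume "det Gram = 0"
  then obtain v where v: "v \<in> carrier_vec n" "v \<noteq> 0\<^sub>v n" "Gram *\<^sub>v v = 0\<^sub>v n"
    using det_0_iff_vec_prod_zero_field[OF Gram_M] by blast
  interpret vectorspace class_ring V by (rule V)
  define u where "u = (\<Oplus>\<^bsub>V\<^esub>i\<in>{..<n}. v $ i \<odot>\<^bsub>V\<^esub> b i)"
  have m: "(\<lambda>i. v $ i \<odot>\<^bsub>V\<^esub> b i) \<in> {..<n} \<rightarrow> carrier V" using b by (auto intro!: V_closed(3))
  have u: "u \<in> carrier V" unfolding u_def by (rule finsum_closed[OF m])
  have val: "\<psi> u = (\<Sum>i<n. v $ i * \<psi> (b i))" if "\<psi> \<in> lhom V ground_space" for \<psi>
    unfolding u_def dual_finsum[OF V that _ m, simplified] using lhomD(3)[OF that] b by simp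
  have "B (b j) u = 0" if j: "j < n" for j
  proof -
    have "B (b j) u = (Gram *\<^sub>v v) $ j"
      using val[OF B_right[OF b[OF j]]] j v(1) by (simp add: Gram_def scalar_prod_def atLeast0LessThan mult.commute)
    then show ?thesis unfolding v(3) using j by simp
  qed
  then have "B w u = 0" if "w \<in> carrier V" for w
    using functional_expand[OF B_left[OF u] that] by simp
  then have "u = \<zero>\<^bsub>V\<^esub>" using B_nondegenerate[OF u] B_sym u by metis
  moreover have "co i u = v $ i" if "i < n" for i
    unfolding val[OF co[OF that]] using that by (simp add: co_b if_distrib[of "\<lambda>x. _ * x"] cong: if_cong)
  ultimately have "v $ i = 0" if "i < n" for i using co_zero that by metis
  then have "v = 0\<^sub>v n" using v(1) by (intro eq_vecI) auto
  then show False using v(2) by simp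
qed

lemma Gram_inverse:
  obtains H where "H \<in> M" "Gram * H = 1\<^sub>m n" "H * Gram = 1\<^sub>m n"
proof -
  have "Gram \<in> Units (ring_mat TYPE('k) n ())" by (rule det_non_zero_imp_unit[OF Gram_M Gram_det])
  then show thesis using that by (auto simp: Units_def ring_mat_simps)
qed

sublocale Sf: symmetric_form n Gram
proof
  show "X = 0\<^sub>m n n" if X: "X \<in> M" and 0: "Gram * X = 0\<^sub>m n n" for X
  proof (rule Gram_inverse)
    fix H assume H: "H \<in> M" "Gram * H = 1\<^sub>m n" "H * Gram = 1\<^sub>m n"
    have "X = (H * Gram) * X" using X H by simp
    also have "\<dots> = H * (Gram * X)" using X H by (intro assoc_mult_mat) auto
    finally show ?thesis using 0 H right_mult_zero_mat[OF H(1)] by simp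
  qed
qed (simp_all add: Gram_sym)

lemma B_apply_left:
  assumes "x \<in> lhom V V" "i < n" "w \<in> carrier V"
  shows "B (x (b i)) w = (\<Sum>k<n. matrix x $$ (k, i) * B (b k) w)"
  using functional_expand[OF B_left[OF assms(3)] lhomD(1)[OF assms(1) b[OF assms(2)]]] assms(2) by (simp add: matrix_def)

lemma B_apply_right:
  assumes "x \<in> lhom V V" "i < n" "w \<in> carrier V"
  shows "B w (x (b i)) = (\<Sum>k<n. B w (b k) * matrix x $$ (k, i))"
  using functional_expand[OF B_right[OF assms(3)] lhomD(1)[OF assms(1) b[OF assms(2)]]] assms(2)
  by (simp add: matrix_def mult.commute)

lemma so_lhom: "x \<in> so V B \<Longrightarrow> x \<in> lhom V V" and SO_lhom: "g \<in> SO V B \<Longrightarrow> g \<in> lhom V V"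
  by (simp_all add: so_def SO_def endomorphisms_def)

lemma so_skewadj:
  assumes x: "x \<in> so V B"
  shows "Sf.skewadj (matrix x)"
  unfolding Sf.skewadj_def
proof (intro conjI eq_matI)
  fix i j assume "i < dim_row (- (Gram * matrix x))" "j < dim_col (- (Gram * matrix x))"
  then have ij: "i < n" "j < n" by auto
  have "(transpose_mat (matrix x) * Gram) $$ (i, j) = B (x (b i)) (b j)"
    using mat_mult_index[of "transpose_mat (matrix x)" Gram i j] B_apply_left[OF so_lhom[OF x] ij(1) b[OF ij(2)]] ij
    by (simp add: Gram_def del: index_mult_mat(1))
  also have "\<dots> = - B (b i) (x (b j))"
    using x b[OF ij(1)] b[OF ij(2)] by (simp add: so_def eq_neg_iff_add_eq_0)
  also have "B (b i) (x (b j)) = (Gram * matrix x) $$ (i, j)"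
    using mat_mult_index[of Gram "matrix x" i j] B_apply_right[OF so_lhom[OF x] ij(2) b[OF ij(1)]] ij
    by (simp add: Gram_def del: index_mult_mat(1))
  finally show "(transpose_mat (matrix x) * Gram) $$ (i, j) = (- (Gram * matrix x)) $$ (i, j)" using ij by simp
qed simp_all

lemma SO_orthogonal:
  assumes g: "g \<in> SO V B"
  shows "transpose_mat (matrix g) * Gram * matrix g = Gram"
proof (rule eq_matI)
  fix i j assume "i < dim_row Gram" "j < dim_col Gram"
  then have ij: "i < n" "j < n" by auto
  note h = SO_lhom[OF g]
  have "(transpose_mat (matrix g) * (Gram * matrix g)) $$ (i, j) = (\<Sum>k<n. matrix g $$ (k, i) * (\<Sum>l<n. B (b k) (b l) * matrix g $$ (l, j)))"
    using mat_mult_index[of "transpose_mat (matrix g)" "Gram * matrix g" i j] mat_mult_index[of Gram "matrix g" _ j] ij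
      mult_carrier_mat[of Gram n n "matrix g" n]
    by (simp add: Gram_def del: index_mult_mat(1))
  also have "\<dots> = (\<Sum>k<n. matrix g $$ (k, i) * B (b k) (g (b j)))"
    using B_apply_right[OF h ij(2) b] by simp
  also have "\<dots> = B (g (b i)) (g (b j))"
    using B_apply_left[OF h ij(1) lhomD(1)[OF h b[OF ij(2)]]] by simp
  also have "\<dots> = B (b i) (b j)" using g b ij by (simp add: SO_def)
  finally show "(transpose_mat (matrix g) * Gram * matrix g) $$ (i, j) = Gram $$ (i, j)"
    using ij assoc_mult_mat[of "transpose_mat (matrix g)" n n Gram n "matrix g" n] by (simp add: Gram_def del: index_mult_mat(1))
qed simp_all

text \<open>Orthogonality of \<open>g\<close> makes \<open>g S g^T Gram\<close> conjugate to
  \<open>S Gram\<close>: multiplying by \<open>g\<close> on the right turns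
  \<open>g^T Gram g\<close> into \<open>Gram\<close>. Taking determinants in
  \<open>g^T Gram g = Gram\<close> shows that \<open>g\<close> is invertible, so its determinant can
  be cancelled.\<close>

lemma det_char_invariant:
  assumes g: "g \<in> SO V B" and S: "S \<in> M"
  shows "det (c \<cdot>\<^sub>m 1\<^sub>m n - matrix g * S * transpose_mat (matrix g) * Gram) = det (c \<cdot>\<^sub>m 1\<^sub>m n - S * Gram)"
proof -
  let ?g = "matrix g"
  have gT: "transpose_mat ?g \<in> M" by simp
  have "det (transpose_mat ?g * Gram * ?g) = det Gram" using SO_orthogonal[OF g] by simp
  moreover have "det (transpose_mat ?g * Gram * ?g) = det ?g * det Gram * det ?g"
    using gT by (simp add: det_mult[of _ n] det_transpose[of _ n])
  ultimately have dg: "det ?g \<noteq> 0" using Gram_det by auto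
  have "(c \<cdot>\<^sub>m 1\<^sub>m n - ?g * S * transpose_mat ?g * Gram) * ?g = c \<cdot>\<^sub>m ?g - ?g * (S * (transpose_mat ?g * Gram * ?g))"
    using S by (simp add: Sf.ring_M mult_smult_assoc_mat[of _ n n _ n])
  also have "\<dots> = ?g * (c \<cdot>\<^sub>m 1\<^sub>m n - S * Gram)"
    unfolding SO_orthogonal[OF g] using S by (simp add: Sf.ring_M mult_smult_distrib[of _ n n _ n])
  finally have "det ((c \<cdot>\<^sub>m 1\<^sub>m n - ?g * S * transpose_mat ?g * Gram) * ?g) = det (?g * (c \<cdot>\<^sub>m 1\<^sub>m n - S * Gram))" by simp
  then show ?thesis using S dg by (simp add: det_mult[of _ n])
qed

lemma matrix_zero_imp:
  assumes x: "x \<in> lhom V V" "x \<in> extensional (carrier V)" and 0: "matrix x = 0\<^sub>m n n"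
  shows "x = (\<lambda>u\<in>carrier V. \<zero>\<^bsub>V\<^esub>)"
proof
  fix u
  show "x u = (\<lambda>u\<in>carrier V. \<zero>\<^bsub>V\<^esub>) u"
  proof (cases "u \<in> carrier V")
    case True
    have "x u = \<zero>\<^bsub>V\<^esub>"
      by (rule co_eqI) (use True x V_closed co_zero co_apply[OF x(1) _ True] in \<open>auto simp: 0 lhomD\<close>)
    then show ?thesis using True by simp
  qed (use x(2) in \<open>auto simp: extensional_def\<close>)
qed

end

section \<open>Invariant polynomials and nilpotent vectors\<close>

lemma polynomial_functions_sum:
  "(\<And>a. a \<in> A \<Longrightarrow> p a \<in> polynomial_functions U) \<Longrightarrow> (\<lambda>u. \<Sum>a\<in>A. p a u) \<in> polynomial_functions U"
  by (induction A rule: infinite_finite_induct) (auto intro: polynomial_functions.intros)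

lemma polynomial_functions_prod:
  "(\<And>a. a \<in> A \<Longrightarrow> p a \<in> polynomial_functions U) \<Longrightarrow> (\<lambda>u. \<Prod>a\<in>A. p a u) \<in> polynomial_functions U"
  by (induction A rule: infinite_finite_induct) (auto intro: polynomial_functions.intros)

lemma polynomial_functions_minus:
  assumes "p \<in> polynomial_functions U" "q \<in> polynomial_functions U"
  shows "(\<lambda>u. p u - q u) \<in> polynomial_functions U"
  using polynomial_functions.add[OF assms(1) polynomial_functions.mult[OF polynomial_functions.const assms(2), of "- 1"]] by simp

context quadratic_space begin

lemma sym2_vs: "kvs (sym2 V)"
  unfolding sym2_eq by (rule Sq.vsQ)

lemma sym2_carrier: "carrier (sym2 V) = Sq.proj ` carrier F"
  unfolding sym2_eq by (rule Sq.carrier_Q)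

text \<open>Matrix entries as functions on the quotient, read off from a chosen representative; the
  choice is immaterial because \<open>Phi\<close> is constant on cosets.\<close>

definition entry :: "nat \<Rightarrow> nat \<Rightarrow> ('v \<times> 'v \<Rightarrow>\<^sub>0 'k) set \<Rightarrow> 'k" where
  "entry i j = (\<lambda>X\<in>carrier (sym2 V). Phi (SOME f. f \<in> carrier F \<and> Sq.proj f = X) $$ (i, j))"

lemma entry_proj:
  assumes "f \<in> carrier F"
  shows "entry i j (Sq.proj f) = Phi f $$ (i, j)"
proof -
  let ?g = "SOME g. g \<in> carrier F \<and> Sq.proj g = Sq.proj f"
  have "?g \<in> carrier F \<and> Sq.proj ?g = Sq.proj f" by (rule someI[of _ f]) (use assms in simp)
  then have "Phi ?g = Phi f" using proj_eq_iff_Phi[of ?g f] assms by blast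
  then show ?thesis using assms by (simp add: entry_def sym2_carrier)
qed

lemma entry_dual:
  assumes "i < n" "j < n"
  shows "entry i j \<in> carrier (dual_space (sym2 V))"
proof -
  have "entry i j \<in> lhom (sym2 V) ground_space"
  proof (rule lhomI)
    fix X Y c assume "X \<in> carrier (sym2 V)"
    then obtain f where f: "f \<in> carrier F" "X = Sq.proj f" by (auto simp: sym2_carrier)
    have "Poly_Mapping.map ((*) c) f \<in> carrier F" using kvs_closed(3)[OF F_vs f(1)] by simp
    then show "entry i j (c \<odot>\<^bsub>sym2 V\<^esub> X) = c \<odot>\<^bsub>ground_space\<^esub> entry i j X"
      using f assms Sq.smult_Q[OF f(1), of c] by (simp add: sym2_eq entry_proj Phi_smult)
    assume "Y \<in> carrier (sym2 V)"
    then obtain g where g: "g \<in> carrier F" "Y = Sq.proj g" by (auto simp: sym2_carrier)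
    have "f + g \<in> carrier F" using kvs_closed(2)[OF F_vs f(1) g(1)] by simp
    then show "entry i j (X \<oplus>\<^bsub>sym2 V\<^esub> Y) = entry i j X \<oplus>\<^bsub>ground_space\<^esub> entry i j Y"
      using f g assms Sq.add_Q[OF f(1) g(1)] by (simp add: sym2_eq entry_proj Phi_add)
  qed simp
  then show ?thesis by (simp add: dual_space_eq entry_def)
qed

text \<open>By the Leibniz formula the determinant is a sum of products of linear functionals and
  constants.\<close>

lemma char_matrix_polynomial:
  obtains p where "p \<in> polynomial_functions (sym2 V)"
    "\<And>f. f \<in> carrier F \<Longrightarrow> p (Sq.proj f) = det (c \<cdot>\<^sub>m 1\<^sub>m n - Phi f * Gram)"
proof
  let ?p = "\<lambda>X. \<Sum>\<sigma> | \<sigma> permutes {0..<n}. signof \<sigma> *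
    (\<Prod>r=0..<n. (if r = \<sigma> r then c else 0) - (\<Sum>k<n. entry r k X * Gram $$ (k, \<sigma> r)))"
  show "?p \<in> polynomial_functions (sym2 V)"
    by (intro polynomial_functions_sum polynomial_functions_prod polynomial_functions_minus
        polynomial_functions.mult polynomial_functions.const polynomial_functions.linear entry_dual) auto
  fix f assume f: "f \<in> carrier F"
  have M: "c \<cdot>\<^sub>m 1\<^sub>m n - Phi f * Gram \<in> M" by simp
  show "?p (Sq.proj f) = det (c \<cdot>\<^sub>m 1\<^sub>m n - Phi f * Gram)"
    unfolding det_def'[OF M]
  proof (intro sum.cong refl arg_cong2[of _ _ _ _ "(*)"] prod.cong)
    fix \<sigma> r assume "\<sigma> \<in> {\<sigma>. \<sigma> permutes {0..<n}}" and r: "r \<in> {0..<n}"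
    then have s: "\<sigma> r < n" by (metis atLeastLessThan_iff mem_Collect_eq permutes_in_image)
    then show "(if r = \<sigma> r then c else 0) - (\<Sum>k<n. entry r k (Sq.proj f) * Gram $$ (k, \<sigma> r))
      = (c \<cdot>\<^sub>m 1\<^sub>m n - Phi f * Gram) $$ (r, \<sigma> r)"
      using r mat_mult_index[of "Phi f" Gram r "\<sigma> r"] by (simp add: entry_proj[OF f] del: index_mult_mat(1))
  qed
qed

text \<open>The characteristic polynomial is controlled through its values rather than its
  coefficients. For each scalar \<open>c\<close> the function det (c - A) is constant on the orbit,
  so subtracting that constant gives a polynomial vanishing on the closure and hence at zero, where
  the determinant is \<open>c^n\<close>. Agreement at all scalars identifies the
  polynomials.\<close>

lemma nilpotent_vector_matrix:
  assumes f: "f \<in> carrier F" and nil: "nilpotent_vector (SO V B) (sym2_group_action V) (sym2 V) (Sq.proj f)"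
  shows "(Phi f * Gram) ^\<^sub>m n = 0\<^sub>m n n"
proof (rule nilpotent_if_char_poly_eq_monom)
  let ?A = "Phi f * Gram"
  show A: "?A \<in> M" by simp
  have "det (c \<cdot>\<^sub>m 1\<^sub>m n - ?A) = c ^ n" for c
  proof (rule char_matrix_polynomial[of c])
    fix p assume p: "p \<in> polynomial_functions (sym2 V)"
      "\<And>f. f \<in> carrier F \<Longrightarrow> p (Sq.proj f) = det (c \<cdot>\<^sub>m 1\<^sub>m n - Phi f * Gram)"
    let ?q = "\<lambda>X. p X - det (c \<cdot>\<^sub>m 1\<^sub>m n - ?A)"
    have q: "?q \<in> polynomial_functions (sym2 V)"
      by (rule polynomial_functions_minus[OF p(1) polynomial_functions.const])
    have "?q (sym2_group_action V g (Sq.proj f)) = 0" if g: "g \<in> SO V B" for g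
      using p(2)[OF lhomD(1)[OF grpF_hom[OF SO_lhom[OF g]] f]] det_char_invariant[OF g, of "Phi f" c]
      by (simp add: grp_proj[OF SO_lhom[OF g] f] Phi_grp[OF SO_lhom[OF g] f])
    then have orb: "\<forall>s\<in>(\<lambda>g. sym2_group_action V g (Sq.proj f)) ` SO V B. ?q s = 0" by simp
    have cl: "\<forall>p\<in>polynomial_functions (sym2 V).
        (\<forall>s\<in>(\<lambda>g. sym2_group_action V g (Sq.proj f)) ` SO V B. p s = 0) \<longrightarrow> p \<zero>\<^bsub>sym2 V\<^esub> = 0"
      using nil by (simp add: nilpotent_vector_def zariski_closure_def)
    have "?q \<zero>\<^bsub>sym2 V\<^esub> = 0" by (rule mp[OF bspec[OF cl q] orb])
    moreover have "\<zero>\<^bsub>sym2 V\<^esub> = Sq.proj 0" unfolding sym2_eq Sq.zero_Q by simp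
    moreover have "Phi 0 = 0\<^sub>m n n" by (rule eq_matI) (simp_all add: Phi_index)
    ultimately have "det (c \<cdot>\<^sub>m 1\<^sub>m n - ?A) = det (c \<cdot>\<^sub>m 1\<^sub>m n - 0\<^sub>m n n * Gram)"
      using p(2)[of 0] by simp
    also have "c \<cdot>\<^sub>m 1\<^sub>m n - 0\<^sub>m n n * Gram = c \<cdot>\<^sub>m 1\<^sub>m n" by simp
    finally show ?thesis by (simp add: det_smult)
  qed
  moreover have "- char_matrix ?A c = c \<cdot>\<^sub>m 1\<^sub>m n - ?A" for c
    using A by (intro eq_matI) (auto simp: char_matrix_def)
  ultimately have "poly (char_poly ?A) c = poly (monom 1 n) c" for c
    unfolding char_poly_matrix[OF A] by (simp add: poly_monom)
  then show "char_poly ?A = monom 1 n" by (metis ext poly_eq_poly_eq_iff)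
qed

lemma sym2_fd: "fd (sym2 V)"
proof -
  interpret Q: vectorspace class_ring "sym2 V" by (rule sym2_vs)
  define A where "A = (\<lambda>(i, j). Sq.proj (pure (b i) (b j))) ` ({..<n} \<times> {..<n})"
  have A: "A \<subseteq> carrier (sym2 V)" unfolding A_def sym2_carrier using b by auto
  have sp: "subsp (Q.span A) (sym2 V)" by (rule Q.span_is_subspace[OF A])
  \<comment> \<open>The elements whose class is already in the span of the basis products. It is
    closed under sums, so it contains the normal form of every element.\<close>
  define T where "T = {f \<in> carrier F. Sq.proj f \<in> Q.span A}"
  have T_add: "f + g \<in> T" if "f \<in> T" "g \<in> T" for f g
    using that subspD(4)[OF sp, of "Sq.proj f" "Sq.proj g"] Sq.add_Q[of f g] kvs_closed(2)[OF F_vs, of f g]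
    by (simp add: T_def sym2_eq)
  have T_zero: "0 \<in> T" using subspD(3)[OF sp] Sq.zero_Q by (simp add: T_def sym2_eq)
  have T_single: "Poly_Mapping.single (b i, b j) c \<in> T" if ij: "i < n" "j < n" for i j c
  proof -
    have p: "pure (b i) (b j) \<in> carrier F" using b ij by simp
    have "Sq.proj (pure (b i) (b j)) \<in> Q.span A" using Q.in_own_span[OF A] ij unfolding A_def by auto
    then have "c \<odot>\<^bsub>sym2 V\<^esub> Sq.proj (pure (b i) (b j)) \<in> Q.span A" by (rule subspD(5)[OF sp])
    then show ?thesis using Sq.smult_Q[OF p, of c] b ij by (simp add: T_def sym2_eq map_single)
  qed
  have T_sum: "(\<Sum>i\<in>I. g i) \<in> T" if "\<And>i. i \<in> I \<Longrightarrow> g i \<in> T" for I :: "nat set" and g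
    using that by (induction I rule: infinite_finite_induct) (simp_all add: T_zero T_add)
  have "Q.span A = carrier (sym2 V)"
  proof
    show "Q.span A \<subseteq> carrier (sym2 V)" by (rule subspD(2)[OF sp])
    show "carrier (sym2 V) \<subseteq> Q.span A"
    proof
      fix X assume "X \<in> carrier (sym2 V)"
      then obtain f where f: "f \<in> carrier F" "X = Sq.proj f" by (auto simp: sym2_carrier)
      let ?g = "\<Sum>i<n. \<Sum>j<n. Poly_Mapping.single (b i, b j) (sext (\<lambda>(u, w). co i u * co j w) f)"
      have g: "?g \<in> T" by (intro T_sum T_single) auto
      then have "Sq.proj f = Sq.proj ?g"
        using Sq.proj_eq_iff[OF f(1), of ?g] free_expand[OF f(1)] by (force simp: T_def)
      then show "X \<in> Q.span A" using g f by (simp add: T_def)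
    qed
  qed
  moreover have "finite A" by (simp add: A_def)
  ultimately show ?thesis unfolding Q.fin_dim_def using A by (intro exI[of _ A] conjI)
qed

section \<open>The orthogonal Lie algebra, its bracket and its orbit maps\<close>

lemma so_iff: "x \<in> so V B \<longleftrightarrow> x \<in> lhom V V \<and> x \<in> extensional (carrier V) \<and>
    (\<forall>u\<in>carrier V. \<forall>w\<in>carrier V. B (x u) w + B u (x w) = 0)"
  by (auto simp: so_def endomorphisms_def)

lemma so_subsp: "subsp (so V B) (hom_space V V)"
proof (rule subspI[OF hom_space_vs[OF V V]])
  note E = kvs_closed[OF hom_space_vs[OF V V]]
  note BR = lhomD[OF B_right] and BL = lhomD[OF B_left]
  have B0: "B \<zero>\<^bsub>V\<^esub> w = 0" "B w \<zero>\<^bsub>V\<^esub> = 0" if "w \<in> carrier V" for w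
    using lhom_zero[OF V ground_space_vs B_left[OF that]] lhom_zero[OF V ground_space_vs B_right[OF that]] by simp_all
  show "so V B \<subseteq> carrier (hom_space V V)" by (auto simp: so_iff)
  show "\<zero>\<^bsub>hom_space V V\<^esub> \<in> so V B"
    using E(1) B0 unfolding so_iff by simp
  fix x assume x: "x \<in> so V B"
  then have xh: "x \<in> lhom V V" "x \<in> carrier (hom_space V V)" by (auto simp: so_iff)
  show "c \<odot>\<^bsub>hom_space V V\<^esub> x \<in> so V B" for c
  proof -
    have "B ((c \<odot>\<^bsub>hom_space V V\<^esub> x) u) w + B u ((c \<odot>\<^bsub>hom_space V V\<^esub> x) w) = c * (B (x u) w + B u (x w))"
      if "u \<in> carrier V" "w \<in> carrier V" for u w
      using that lhomD(1)[OF xh(1)] by (simp add: BL(3) BR(3) distrib_left)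
    then show ?thesis using E(3)[OF xh(2), of c] x unfolding so_iff by simp
  qed
  fix y assume y: "y \<in> so V B"
  then have yh: "y \<in> lhom V V" "y \<in> carrier (hom_space V V)" by (auto simp: so_iff)
  have "B ((x \<oplus>\<^bsub>hom_space V V\<^esub> y) u) w + B u ((x \<oplus>\<^bsub>hom_space V V\<^esub> y) w)
      = (B (x u) w + B u (x w)) + (B (y u) w + B u (y w))"
    if "u \<in> carrier V" "w \<in> carrier V" for u w
    using that lhomD(1)[OF xh(1)] lhomD(1)[OF yh(1)] by (simp add: BL(2) BR(2))
  then show "x \<oplus>\<^bsub>hom_space V V\<^esub> y \<in> so V B" using E(2)[OF xh(2) yh(2)] x y unfolding so_iff by simp
qed

abbreviation L where "L \<equiv> (hom_space V V)\<lparr>carrier := so V B\<rparr>"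

lemma matrix_add:
  assumes "x \<in> lhom V V" "y \<in> lhom V V"
  shows "matrix (x \<oplus>\<^bsub>L\<^esub> y) = matrix x + matrix y"
  by (rule eq_matI) (use b assms in \<open>simp_all add: matrix_def lhomD(2)[OF co] lhomD(1)\<close>)

lemma matrix_smult:
  assumes "x \<in> lhom V V"
  shows "matrix (c \<odot>\<^bsub>L\<^esub> x) = c \<cdot>\<^sub>m matrix x"
  by (rule eq_matI) (use b assms in \<open>simp_all add: matrix_def lhomD(3)[OF co] lhomD(1)\<close>)

text \<open>The commutator, with the difference expressed through the scalar -1 and restricted to
  the carrier so that it is again an extensional endomorphism. It serves as the witness for the
  invariance of tangent spaces under stabilisers.\<close>

definition bracket :: "('v \<Rightarrow> 'v) \<Rightarrow> ('v \<Rightarrow> 'v) \<Rightarrow> 'v \<Rightarrow> 'v" where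
  "bracket x y = (\<lambda>u\<in>carrier V. x (y u) \<oplus>\<^bsub>V\<^esub> (- 1) \<odot>\<^bsub>V\<^esub> y (x u))"

lemma bracket_so:
  assumes x: "x \<in> so V B" and y: "y \<in> so V B"
  shows "bracket x y \<in> so V B"
proof -
  have xh: "x \<in> lhom V V" and yh: "y \<in> lhom V V" using x y by (auto simp: so_iff)
  note X = lhomD[OF xh] and Y = lhomD[OF yh]
  interpret vectorspace class_ring V by (rule V)
  have sm: "a \<odot>\<^bsub>V\<^esub> (c \<odot>\<^bsub>V\<^esub> u) = c \<odot>\<^bsub>V\<^esub> (a \<odot>\<^bsub>V\<^esub> u)" if "u \<in> carrier V" for a c u
    using that smult_assoc1[of a c u] smult_assoc1[of c a u] by (simp add: mult.commute)
  have dist: "c \<odot>\<^bsub>V\<^esub> (u \<oplus>\<^bsub>V\<^esub> w) = c \<odot>\<^bsub>V\<^esub> u \<oplus>\<^bsub>V\<^esub> c \<odot>\<^bsub>V\<^esub> w" if "u \<in> carrier V" "w \<in> carrier V" for c u w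
    using that smult_r_distr[of c u w] by simp
  have "bracket x y \<in> lhom V V"
    by (rule lhomI) (simp_all add: bracket_def X Y V_closed sm dist a_ac)
  moreover have "B (bracket x y u) w + B u (bracket x y w) = 0" if u: "u \<in> carrier V" and w: "w \<in> carrier V" for u w
  proof -
    have sk: "B (x u) w = - B u (x w)" "B (y u) w = - B u (y w)" if "u \<in> carrier V" "w \<in> carrier V" for u w
      using x y that by (auto simp: so_iff eq_neg_iff_add_eq_0)
    have "B (bracket x y u) w = B (x (y u)) w - B (y (x u)) w"
      using u w X Y V_closed by (simp add: bracket_def lhomD(2,3)[OF B_left])
    moreover have "B u (bracket x y w) = B u (x (y w)) - B u (y (x w))"
      using u w X Y V_closed by (simp add: bracket_def lhomD(2,3)[OF B_right])
    ultimately show ?thesis using u w X Y by (simp add: sk)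
  qed
  ultimately show ?thesis by (auto simp: so_iff bracket_def)
qed

lemma matrix_bracket:
  assumes x: "x \<in> lhom V V" and y: "y \<in> lhom V V"
  shows "matrix (bracket x y) = matrix x * matrix y - matrix y * matrix x"
proof (rule eq_matI)
  fix i j assume "i < dim_row (matrix x * matrix y - matrix y * matrix x)" "j < dim_col (matrix x * matrix y - matrix y * matrix x)"
  then have ij: "i < n" "j < n" by auto
  have c: "co i (x (y (b j))) = (matrix x * matrix y) $$ (i, j)" if "x \<in> lhom V V" "y \<in> lhom V V" for x y
    unfolding co_apply[OF that(1) ij(1) lhomD(1)[OF that(2) b[OF ij(2)]]]
    using ij mat_mult_index[of "matrix x" "matrix y" i j] by (simp add: matrix_def[of y] del: index_mult_mat(1))
  have "matrix (bracket x y) $$ (i, j) = co i (x (y (b j))) - co i (y (x (b j)))"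
    using ij b V_closed lhomD[OF x] lhomD[OF y] by (simp add: matrix_def bracket_def lhomD(2,3)[OF co])
  then show "matrix (bracket x y) $$ (i, j) = (matrix x * matrix y - matrix y * matrix x) $$ (i, j)"
    unfolding c[OF x y] c[OF y x] using ij by (simp del: index_mult_mat(1))
qed simp_all

abbreviation act where "act \<equiv> sym2_lie_action V"

lemma lieF_carrier: "x \<in> lhom V V \<Longrightarrow> f \<in> carrier F \<Longrightarrow> lieF x f \<in> carrier F"
  using lhomD(1)[OF lieF_hom] by blast

text \<open>Cosets are determined by their matrices under \<open>Phi\<close>, so linearity in
  \<open>x\<close> reduces to linearity of X S + S X^T in X.\<close>

lemma orbit_hom:
  assumes X: "X \<in> carrier (sym2 V)"
  shows "(\<lambda>x. act x X) \<in> lhom L (sym2 V)"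
proof -
  obtain f where f: "f \<in> carrier F" "X = Sq.proj f" using X by (auto simp: sym2_carrier)
  note so = subspD[OF so_subsp]
  have h: "x \<in> lhom V V" if "x \<in> so V B" for x using that by (rule so_lhom)
  show ?thesis
  proof (rule lhomI, unfold f(2))
    fix x y c assume "x \<in> carrier L"
    then have x: "x \<in> so V B" by simp
    note xf = lieF_carrier[OF h[OF x] f(1)]
    show "act x (Sq.proj f) \<in> carrier (sym2 V)"
      using xf by (simp add: lie_proj[OF h[OF x] f(1)] sym2_carrier)
    have cx: "c \<odot>\<^bsub>L\<^esub> x \<in> so V B" using so(5)[OF x, of c] by simp
    have "Sq.proj (lieF (c \<odot>\<^bsub>L\<^esub> x) f) = Sq.proj (Poly_Mapping.map ((*) c) (lieF x f))"
    proof (subst proj_eq_iff_Phi)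
      show "Phi (lieF (c \<odot>\<^bsub>L\<^esub> x) f) = Phi (Poly_Mapping.map ((*) c) (lieF x f))"
        unfolding Phi_smult Phi_lie[OF h[OF x] f(1)] Phi_lie[OF h[OF cx] f(1)] matrix_smult[OF h[OF x]]
        by (rule eq_matI) (auto simp: scalar_prod_def sum_distrib_left distrib_left mult.left_commute mult.assoc)
    qed (use lieF_carrier[OF h[OF cx] f(1)] kvs_closed(3)[OF F_vs xf] in auto)
    then show "act (c \<odot>\<^bsub>L\<^esub> x) (Sq.proj f) = c \<odot>\<^bsub>sym2 V\<^esub> act x (Sq.proj f)"
      unfolding lie_proj[OF h[OF x] f(1)] lie_proj[OF h[OF cx] f(1)] using Sq.smult_Q[OF xf, of c] by (simp add: sym2_eq)
    assume "y \<in> carrier L"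
    then have y: "y \<in> so V B" by simp
    note yf = lieF_carrier[OF h[OF y] f(1)]
    have xy: "x \<oplus>\<^bsub>L\<^esub> y \<in> so V B" using so(4)[OF x y] by simp
    have "Sq.proj (lieF (x \<oplus>\<^bsub>L\<^esub> y) f) = Sq.proj (lieF x f + lieF y f)"
    proof (subst proj_eq_iff_Phi)
      show "Phi (lieF (x \<oplus>\<^bsub>L\<^esub> y) f) = Phi (lieF x f + lieF y f)"
        unfolding Phi_add Phi_lie[OF h[OF x] f(1)] Phi_lie[OF h[OF y] f(1)] Phi_lie[OF h[OF xy] f(1)] matrix_add[OF h[OF x] h[OF y]]
        by (rule eq_matI) (auto simp: scalar_prod_def sum.distrib distrib_left distrib_right)
    qed (use lieF_carrier[OF h[OF xy] f(1)] kvs_closed(2)[OF F_vs xf yf] in auto)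
    then show "act (x \<oplus>\<^bsub>L\<^esub> y) (Sq.proj f) = act x (Sq.proj f) \<oplus>\<^bsub>sym2 V\<^esub> act y (Sq.proj f)"
      unfolding lie_proj[OF h[OF x] f(1)] lie_proj[OF h[OF y] f(1)] lie_proj[OF h[OF xy] f(1)]
      using Sq.add_Q[OF xf yf] by (simp add: sym2_eq)
  qed
qed

lemma act_zero_iff:
  assumes "x \<in> lhom V V" "f \<in> carrier F"
  shows "act x (Sq.proj f) = \<zero>\<^bsub>sym2 V\<^esub> \<longleftrightarrow> matrix x * Phi f + Phi f * transpose_mat (matrix x) = 0\<^sub>m n n"
proof -
  have "\<zero>\<^bsub>sym2 V\<^esub> = Sq.proj 0" unfolding sym2_eq Sq.zero_Q by simp
  moreover have "Phi 0 = 0\<^sub>m n n" by (rule eq_matI) (simp_all add: Phi_index)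
  ultimately show ?thesis
    using proj_eq_iff_Phi[of "lieF x f" 0] lieF_carrier[OF assms] by (simp add: lie_proj[OF assms] Phi_lie[OF assms])
qed

lemma act_eq_iff:
  assumes "x \<in> lhom V V" "f \<in> carrier F" "y \<in> lhom V V" "g \<in> carrier F"
  shows "act x (Sq.proj f) = act y (Sq.proj g) \<longleftrightarrow>
    matrix x * Phi f + Phi f * transpose_mat (matrix x) = matrix y * Phi g + Phi g * transpose_mat (matrix y)"
  using proj_eq_iff_Phi[of "lieF x f" "lieF y g"] lieF_carrier assms by (simp add: lie_proj Phi_lie)

text \<open>The module identity x (y v) = [x, y] v + y (x v), whose last term vanishes when x
  stabilises v. It is verified on symmetric matrices.\<close>

lemma act_stable:
  assumes x: "x \<in> so V B" and y: "y \<in> so V B" and f: "f \<in> carrier F" and 0: "act x (Sq.proj f) = \<zero>\<^bsub>sym2 V\<^esub>"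
  shows "act x (act y (Sq.proj f)) = act (bracket x y) (Sq.proj f)"
proof -
  let ?X = "matrix x" and ?Y = "matrix y" and ?S = "Phi f"
  have xh: "x \<in> lhom V V" and yh: "y \<in> lhom V V" using x y so_lhom by auto
  have zh: "bracket x y \<in> lhom V V" using bracket_so[OF x y] so_lhom by blast
  have z: "?X * ?S + ?S * transpose_mat ?X = 0\<^sub>m n n" using 0 act_zero_iff[OF xh f] by simp
  have T: "transpose_mat ?X \<in> Sf.M" "transpose_mat ?Y \<in> Sf.M" by simp_all
  have XS: "?X * ?S = - (?S * transpose_mat ?X)"
  proof (rule eq_matI)
    fix i j assume "i < dim_row (- (?S * transpose_mat ?X))" "j < dim_col (- (?S * transpose_mat ?X))"
    then show "(?X * ?S) $$ (i, j) = (- (?S * transpose_mat ?X)) $$ (i, j)"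
      using arg_cong[OF z, of "\<lambda>Z. Z $$ (i, j)"] by (simp add: eq_neg_iff_add_eq_0 del: index_mult_mat(1))
  qed simp_all
  have "?X * (?Y * ?S + ?S * transpose_mat ?Y) + (?Y * ?S + ?S * transpose_mat ?Y) * transpose_mat ?X
    = (?X * ?Y - ?Y * ?X) * ?S + ?S * transpose_mat (?X * ?Y - ?Y * ?X)
      + (?Y * (?X * ?S + ?S * transpose_mat ?X) + (?X * ?S + ?S * transpose_mat ?X) * transpose_mat ?Y)"
  proof -
    \<comment> \<open>What remains after multiplying out: the products \<open>P5\<close> = Y X S and
      \<open>P6\<close> = S X^T Y^T occur on the right with both signs.\<close>
    have e: "P1 + P2 + (P3 + P4) = (P1 - P5) + (P4 - P6) + ((P5 + P3) + (P2 + P6))"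
      if "P1 \<in> Sf.M" "P2 \<in> Sf.M" "P3 \<in> Sf.M" "P4 \<in> Sf.M" "P5 \<in> Sf.M" "P6 \<in> Sf.M" for P1 P2 P3 P4 P5 P6 :: "'k mat"
      using that by (intro eq_matI) auto
    have t: "transpose_mat (?X * ?Y - ?Y * ?X) = transpose_mat ?Y * transpose_mat ?X - transpose_mat ?X * transpose_mat ?Y"
      using transpose_mult[of ?X n n ?Y n] transpose_mult[of ?Y n n ?X n]
      by (simp add: transpose_minus[of _ n n])
    show ?thesis unfolding t using T
      by (simp add: Sf.ring_M) (rule e; simp)
  qed
  also have "\<dots> = (?X * ?Y - ?Y * ?X) * ?S + ?S * transpose_mat (?X * ?Y - ?Y * ?X)"
    unfolding z using right_mult_zero_mat[of ?Y n n n] left_mult_zero_mat[OF T(2), of n] by simp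
  finally have "Phi (lieF x (lieF y f)) = Phi (lieF (bracket x y) f)"
    unfolding Phi_lie[OF xh lieF_carrier[OF yh f]] Phi_lie[OF yh f] Phi_lie[OF zh f] matrix_bracket[OF xh yh] .
  then have "Sq.proj (lieF x (lieF y f)) = Sq.proj (lieF (bracket x y) f)"
    using proj_eq_iff_Phi lieF_carrier[OF xh lieF_carrier[OF yh f]] lieF_carrier[OF zh f] by blast
  then show ?thesis
    by (simp only: lie_proj[OF yh f] lie_proj[OF xh lieF_carrier[OF yh f]] lie_proj[OF zh f])
qed

section \<open>Generic vectors and the index equality\<close>

lemma generic_vector:
  assumes f: "f \<in> carrier F" and nil: "(Phi f * Gram) ^\<^sub>m N = 0\<^sub>m n n"
  obtains w where "w \<in> carrier (sym2 V)"
    "\<And>x. x \<in> so V B \<Longrightarrow> act x (Sq.proj f) = \<zero>\<^bsub>sym2 V\<^esub> \<Longrightarrow> act x w \<in> tangent_space (so V B) act (Sq.proj f)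
      \<Longrightarrow> x = \<zero>\<^bsub>L\<^esub>"
proof (rule Gram_inverse)
  fix H assume H: "H \<in> Sf.M" "Gram * H = 1\<^sub>m n" "H * Gram = 1\<^sub>m n"
  show thesis
  proof (rule Sf.generic_symmetric[OF H Phi_M Phi_sym nil])
    fix T assume T: "T \<in> Sf.M" "transpose_mat T = T"
      "\<And>X Y. Sf.skewadj X \<Longrightarrow> Sf.skewadj Y \<Longrightarrow> X * Phi f + Phi f * transpose_mat X = 0\<^sub>m n n
        \<Longrightarrow> X * T + T * transpose_mat X = Y * Phi f + Phi f * transpose_mat Y \<Longrightarrow> X = 0\<^sub>m n n"
    \<comment> \<open>Every symmetric matrix comes from a tensor, so the generic matrix
      \<open>T\<close> provides the vector; membership in the tangent space later supplies the
      second skew matrix.\<close>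
    obtain g where g: "g \<in> carrier F" "Phi g = T" using Phi_surj[OF T(1,2)] by blast
    show thesis
    proof (rule that)
      show "Sq.proj g \<in> carrier (sym2 V)" using g by (simp add: sym2_carrier)
      fix x assume x: "x \<in> so V B" and 0: "act x (Sq.proj f) = \<zero>\<^bsub>sym2 V\<^esub>"
        and t: "act x (Sq.proj g) \<in> tangent_space (so V B) act (Sq.proj f)"
      obtain y where y: "y \<in> so V B" "act x (Sq.proj g) = act y (Sq.proj f)" using t by (auto simp: tangent_space_def)
      note xh = so_lhom[OF x] and yh = so_lhom[OF y(1)]
      have "matrix x = 0\<^sub>m n n"
        using T(3)[OF so_skewadj[OF x] so_skewadj[OF y(1)]] 0 y(2)
        unfolding act_zero_iff[OF xh f] act_eq_iff[OF xh g(1) yh f] g(2) by blast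
      then show "x = \<zero>\<^bsub>L\<^esub>" using matrix_zero_imp[OF xh] x by (simp add: so_iff)
    qed
  qed
qed

lemma sym2_GNIB: "GNIB (SO V B) (sym2_group_action V) (so V B) (sym2_lie_action V) (sym2 V)"
  unfolding GNIB_def Let_def
proof (intro allI impI)
  fix v assume nil: "nilpotent_vector (SO V B) (sym2_group_action V) (sym2 V) v"
  then have vc: "v \<in> carrier (sym2 V)" by (simp add: nilpotent_vector_def)
  then obtain f where f: "f \<in> carrier F" "v = Sq.proj f" by (auto simp: sym2_carrier)
  have Lvs: "kvs L" by (rule subsp_vs[OF so_subsp])
  have F0: "0 \<in> carrier F" by simp
  have Phi0: "Phi 0 = 0\<^sub>m n n" by (rule eq_matI) (simp_all add: Phi_index)
  have z: "\<zero>\<^bsub>sym2 V\<^esub> = Sq.proj 0" unfolding sym2_eq Sq.zero_Q by simp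
  \<comment> \<open>The zero vector is nilpotent with exponent 1, so the same construction yields a
    vector with trivial stabiliser.\<close>
  have nil0: "(Phi 0 * Gram) ^\<^sub>m 1 = 0\<^sub>m n n" by (simp add: Phi0)
  obtain w0 where w0: "w0 \<in> carrier (sym2 V)"
    "\<And>x. x \<in> so V B \<Longrightarrow> act x (Sq.proj 0) = \<zero>\<^bsub>sym2 V\<^esub> \<Longrightarrow> act x w0 \<in> tangent_space (so V B) act (Sq.proj 0) \<Longrightarrow> x = \<zero>\<^bsub>L\<^esub>"
    using generic_vector[OF F0 nil0] by blast
  obtain w where w: "w \<in> carrier (sym2 V)"
    "\<And>x. x \<in> so V B \<Longrightarrow> act x v = \<zero>\<^bsub>sym2 V\<^esub> \<Longrightarrow> act x w \<in> tangent_space (so V B) act v \<Longrightarrow> x = \<zero>\<^bsub>L\<^esub>"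
    using generic_vector[OF f(1) nilpotent_vector_matrix[OF f(1)]] nil unfolding f(2) by blast
  have act0: "act x (Sq.proj 0) = \<zero>\<^bsub>sym2 V\<^esub>" if "x \<in> so V B" for x
    using lhom_zero[OF sym2_vs sym2_vs lie_hom[OF so_lhom[OF that]]] unfolding z .
  have "index (carrier L) (dual_space (sym2 V)) (dual_action (sym2 V) act) =
    index (stabiliser (sym2 V) (carrier L) act v) (dual_space (quotient_space (sym2 V) (tangent_space (carrier L) act v)))
      (dual_action (quotient_space (sym2 V) (tangent_space (carrier L) act v))
        (quotient_action (sym2 V) (tangent_space (carrier L) act v) act))"
  proof (rule index_quotient_eq[OF sym2_vs sym2_fd Lvs _ orbit_hom w0(1) _ vc _ w(1)])
    show "act x \<in> lhom (sym2 V) (sym2 V)" if "x \<in> carrier L" for x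
      using that by (intro lie_hom so_lhom) simp
    show "x = \<zero>\<^bsub>L\<^esub>" if x: "x \<in> carrier L" and "act x w0 = \<zero>\<^bsub>sym2 V\<^esub>" for x
    proof -
      have xs: "x \<in> so V B" using x by simp
      \<comment> \<open>At v = 0 the tangent space is zero, so lying in it is exactly the vanishing
        of \<open>act x w0\<close>.\<close>
      have "act x w0 = act x (Sq.proj 0)" unfolding that(2) act0[OF xs] ..
      then have "act x w0 \<in> tangent_space (so V B) act (Sq.proj 0)"
        unfolding tangent_space_def using xs by (rule image_eqI)
      then show ?thesis by (rule w0(2)[OF xs act0[OF xs]])
    qed
    show "act x (act y v) \<in> tangent_space (carrier L) act v"
      if "x \<in> carrier L" "y \<in> carrier L" "act x v = \<zero>\<^bsub>sym2 V\<^esub>" for x y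
      using that act_stable[of x y f] bracket_so[of x y] f unfolding tangent_space_def by auto
    show "x = \<zero>\<^bsub>L\<^esub>" if "x \<in> carrier L" "act x v = \<zero>\<^bsub>sym2 V\<^esub>" "act x w \<in> tangent_space (carrier L) act v" for x
      using w(2)[of x] that by simp
  qed
  then show "index (so V B) (dual_space (sym2 V)) (dual_action (sym2 V) act) =
    index (stabiliser (sym2 V) (so V B) act v) (dual_space (quotient_space (sym2 V) (tangent_space (so V B) act v)))
      (dual_action (quotient_space (sym2 V) (tangent_space (so V B) act v))
        (quotient_action (sym2 V) (tangent_space (so V B) act v) act))" by simp
qed

end

theorem theorem3p2:
  fixes V :: "('k::{alg_closed_field, field_char_0}, 'v) module"
    and B :: "'v \<Rightarrow> 'v \<Rightarrow> 'k"
  assumes "vectorspace class_ring V"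
    and "vectorspace.fin_dim class_ring V"
    and "nondegenerate_symmetric_form V B"
  shows "GNIB (SO V B) (sym2_group_action V) (so V B) (sym2_lie_action V) (sym2 V)"
proof -
  obtain n b co where "based_space V n b co" using based_space_exists[OF assms(1,2)] by blast
  then interpret quadratic_space V n b co B
    by (rule quadratic_space.intro) (rule quadratic_space_axioms.intro, rule assms(3))
  show ?thesis by (rule sym2_GNIB)
qed

end
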